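(* Let $I(z)$, $z\in\mathbb{R}^n$ ($n=2$ or $3$), be the imaging functional $$I(z) := \sum_{j=1}^N \left| \int_{\partial\Omega} \left( u_{\mathrm{sc}}(x,d_j)\, \frac{\partial\, \mathrm{Im}\,\Phi(x,z)}{\partial\nu(x)} - \frac{\partial u_{\mathrm{sc}}(x,d_j)}{\partial\nu(x)}\, \mathrm{Im}\,\Phi(x,z) \right) \mathrm{d}s(x)\right|^p .$$ Then $I(z)$ satisfies $$I(z) = \sum_{j=1}^N \left| \int_D \mathcal{K}(y,z)\cdot Q(y)\nabla u(y,d_j)\,\mathrm{d}y\right|^p ,$$ where $$\mathcal{K}(y,z) = \begin{cases} \dfrac14 \nabla_y J_0(k|y-z|), & \text{in } \mathbb{R}^2,\\[2mm] \dfrac{k}{4\pi}\nabla_y j_0(k|y-z|), & \text{in } \mathbb{R}^3.\end{cases}$$ Furthermore, $$I(z) = O\!\left(\frac{1}{\mathrm{dist}(z,D)^{p(n-1)/2}}\right)\quad\text{as } \mathrm{dist}(z,D)\to\infty,$$ where $\mathrm{dist}(z,D)$ is the distance from $z$ to $D$.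
   Context: Let $n\in\{2,3\}$, $k>0$ (wave number), and $\mathbb{S}^{n-1}=\{x\in\mathbb{R}^n:|x|=1\}$. Let $D\subset\mathbb{R}^n$ be a bounded Lipschitz domain and let $Q$ be a bounded $n\times n$ matrix-valued function on $\mathbb{R}^n$ with $Q=0$ in $\mathbb{R}^n\setminus\overline{D}$. $I_n$ is the $n\times n$ identity matrix. For a direction $d\in\mathbb{S}^{n-1}$ let $u_{\mathrm{in}}(x,d)=e^{ikx\cdot d}$ be the incident plane wave. The total field $u=u(x,d)$ and scattered field $u_{\mathrm{sc}}=u_{\mathrm{sc}}(x,d)$ solve (weakly, in $H^1_{\mathrm{loc}}(\mathbb{R}^n)$) $$\mathrm{div}((I_n+Q)\nabla u)+k^2u=0\ \text{ in }\mathbb{R}^n,\qquad u=u_{\mathrm{sc}}+u_{\mathrm{in}},$$ with the Sommerfeld radiation condition $\lim_{r\to\infty} r^{(n-1)/2}\left(\frac{\partial u_{\mathrm{sc}}}{\partial r}-iku_{\mathrm{sc}}\right)=0$, $r=|x|$, uniformly in $x/|x|\in\mathbb{S}^{n-1}$. Standing assumption: this direct scattering problem is well-posed. $\Omega\subset\mathbb{R}^n$ is a regular domain (bounded, with boundary smooth enough for Green's identities) such that $\overline{D}\subset\Omega$, and $\nu(x)$ is the outward unit normal to $\partial\Omega$ at $x$. Directions $d_1,\dots,d_N\in\mathbb{S}^{n-1}$ are given, and $p\in\mathbb{N}=\{1,2,\dots\}$ is fixed. $\Phi$ is the free-space Green's function of the Helmholtz equation: $\Phi(x,y)=\frac{i}{4}H^{(1)}_0(k|x-y|)$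 in $\mathbb{R}^2$ and $\Phi(x,y)=\frac{e^{ik|x-y|}}{4\pi|x-y|}$ in $\mathbb{R}^3$; $\mathrm{Im}\,\Phi$ denotes its imaginary part, which extends smoothly to all $x,y$. $J_0$ is the Bessel function of the first kind of order $0$, and $j_0(t)=\sin(t)/t$ is the spherical Bessel function of the first kind of order $0$. The dot denotes the bilinear product $a\cdot b=\sum_l a_lb_l$ (no complex conjugation). *)

theory Defs
  imports "HOL-Analysis.Analysis" "HOL-Library.Landau_Symbols"
begin

definition grad :: "(real^'n \<Rightarrow> 'a::real_normed_vector) \<Rightarrow> real^'n \<Rightarrow> 'a^'n" where
  "grad f x = (\<chi> i. frechet_derivative f (at x) (axis i 1))"

definition C1_on :: "(real^'n) set \<Rightarrow> (real^'n \<Rightarrow> 'a::real_normed_vector) \<Rightarrow> bool" where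
  "C1_on S f \<longleftrightarrow> (\<forall>x\<in>S. f differentiable (at x)) \<and> continuous_on S (grad f)"

primrec Ck :: "nat \<Rightarrow> (real^'n \<Rightarrow> 'a::real_normed_vector) \<Rightarrow> bool" where
  "Ck 0 f \<longleftrightarrow> continuous_on UNIV f"
| "Ck (Suc m) f \<longleftrightarrow> (\<forall>x. f differentiable (at x)) \<and> (\<forall>i. Ck m (\<lambda>x. grad f x $ i))"

definition test_function :: "(real^'n \<Rightarrow> complex) \<Rightarrow> bool" where
  "test_function \<phi> \<longleftrightarrow> (\<forall>m. Ck m \<phi>) \<and> compact (closure {x. \<phi> x \<noteq> 0})"

text \<open>The dot product without complex conjugation.\<close>

definition cdot :: "complex^'n \<Rightarrow> complex^'n \<Rightarrow> complex"  (infixl "\<odot>" 70) where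
  "a \<odot> b = (\<Sum>l\<in>UNIV. a $ l * b $ l)"

definition L2_loc :: "(real^'n \<Rightarrow> 'a::euclidean_space) \<Rightarrow> bool" where
  "L2_loc f \<longleftrightarrow> f \<in> borel_measurable lebesgue \<and>
     (\<forall>K. compact K \<longrightarrow> set_integrable lebesgue K (\<lambda>x. (norm (f x))\<^sup>2))"

definition is_weak_gradient :: "(real^'n \<Rightarrow> complex) \<Rightarrow> (real^'n \<Rightarrow> complex^'n) \<Rightarrow> bool" where
  "is_weak_gradient f G \<longleftrightarrow>
     (\<forall>\<phi>. test_function \<phi> \<longrightarrow>
        (\<forall>i. (LINT x|lebesgue. f x * grad \<phi> x $ i) = - (LINT x|lebesgue. G x $ i * \<phi> x)))"

definition H1_loc :: "(real^'n \<Rightarrow> complex) \<Rightarrow> bool" where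
  "H1_loc f \<longleftrightarrow> L2_loc f \<and> (\<exists>G. L2_loc G \<and> is_weak_gradient f G)"

text \<open>For \<open>f\<close> in \<open>H\<^sup>1\<close>-loc the weak gradient is determined almost everywhere;
  this picks one representative.\<close>

definition weak_gradient :: "(real^'n \<Rightarrow> complex) \<Rightarrow> real^'n \<Rightarrow> complex^'n" where
  "weak_gradient f = (SOME G. L2_loc G \<and> is_weak_gradient f G)"

text \<open>Near \<open>x0\<close>, and in the orthogonal coordinate system whose last axis is the unit vector
  \<open>e\<close>, the set \<open>S\<close> is the region above the graph of \<open>\<gamma>\<close>.  The function \<open>\<gamma>\<close> of the remaining
  \<open>n - 1\<close> coordinates is represented as a function on the whole space that is constant in the
  direction \<open>e\<close>.\<close>

definition local_graph ::
  "(real^'n) set \<Rightarrow> real^'n \<Rightarrow> real \<Rightarrow> real^'n \<Rightarrow> (real^'n \<Rightarrow> real) \<Rightarrow> bool" where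
  "local_graph S x0 r e \<gamma> \<longleftrightarrow>
     r > 0 \<and> norm e = 1 \<and> (\<forall>x t. \<gamma> (x + t *\<^sub>R e) = \<gamma> x) \<and>
     S \<inter> ball x0 r = {x \<in> ball x0 r. \<gamma> x < x \<bullet> e}"

definition bounded_Lipschitz_domain :: "(real^'n) set \<Rightarrow> bool" where
  "bounded_Lipschitz_domain S \<longleftrightarrow>
     open S \<and> connected S \<and> bounded S \<and> S \<noteq> {} \<and>
     (\<forall>x0\<in>frontier S. \<exists>r e \<gamma>. (\<exists>L. L-lipschitz_on UNIV \<gamma>) \<and> local_graph S x0 r e \<gamma>)"

definition bounded_C1_domain :: "(real^'n) set \<Rightarrow> bool" where
  "bounded_C1_domain S \<longleftrightarrow>
     open S \<and> connected S \<and> bounded S \<and> S \<noteq> {} \<and>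
     (\<forall>x0\<in>frontier S. \<exists>r e \<gamma>. C1_on UNIV \<gamma> \<and> local_graph S x0 r e \<gamma>)"

text \<open>The surface measure of the boundary of a \<open>C\<^sup>1\<close> domain, viewed as a Borel measure on the
  whole space: in graph coordinates it is \<open>sqrt (1 + |\<nabla>\<gamma>|\<^sup>2) dy\<close>, with \<open>y\<close> in the hyperplane
  orthogonal to \<open>e\<close>.  The integral over that hyperplane is written as the integral over the slab
  \<open>0 \<le> x \<bullet> e \<le> 1\<close> of a function that does not depend on the coordinate \<open>x \<bullet> e\<close>;
  the point \<open>x + (\<gamma> x - x \<bullet> e) e\<close> is the projection of \<open>x\<close> to the graph along \<open>e\<close>.\<close>

definition is_surface_measure :: "(real^'n) set \<Rightarrow> (real^'n) measure \<Rightarrow> bool" where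
  "is_surface_measure S \<sigma> \<longleftrightarrow>
     sets \<sigma> = sets borel \<and> emeasure \<sigma> (- frontier S) = 0 \<and>
     (\<forall>x0 r e \<gamma>. C1_on UNIV \<gamma> \<and> local_graph S x0 r e \<gamma> \<longrightarrow>
        (\<forall>A\<in>sets borel. A \<subseteq> ball x0 r \<longrightarrow>
           emeasure \<sigma> (A \<inter> frontier S) =
             (\<integral>\<^sup>+x. indicator {x. 0 \<le> x \<bullet> e \<and> x \<bullet> e \<le> 1} x *
                   indicator A (x + (\<gamma> x - x \<bullet> e) *\<^sub>R e) *
                   ennreal (sqrt (1 + (norm (grad \<gamma> x))\<^sup>2)) \<partial>lborel)))"

text \<open>Up to any cone around the tangent hyperplane, the half space on the side of \<open>- v\<close> is
  locally inside \<open>S\<close> and the one on the side of \<open>v\<close> is locally outside.\<close>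

definition is_outward_normal :: "(real^'n) set \<Rightarrow> real^'n \<Rightarrow> real^'n \<Rightarrow> bool" where
  "is_outward_normal S x v \<longleftrightarrow>
     norm v = 1 \<and>
     (\<forall>\<epsilon>>0. \<exists>\<delta>>0. \<forall>y\<in>ball x \<delta>.
        ((y - x) \<bullet> v < - \<epsilon> * norm (y - x) \<longrightarrow> y \<in> S) \<and>
        ((y - x) \<bullet> v > \<epsilon> * norm (y - x) \<longrightarrow> y \<notin> S))"

definition outward_normal :: "(real^'n) set \<Rightarrow> real^'n \<Rightarrow> real^'n" where
  "outward_normal S x = (THE v. is_outward_normal S x v)"

definition normal_deriv ::
  "(real^'n) set \<Rightarrow> (real^'n \<Rightarrow> 'a::real_normed_vector) \<Rightarrow> real^'n \<Rightarrow> 'a" where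
  "normal_deriv S f x = frechet_derivative f (at x) (outward_normal S x)"

definition bessel_J0 :: "real \<Rightarrow> real" where
  "bessel_J0 t = (\<Sum>m. (-1) ^ m / (fact m)\<^sup>2 * (t / 2) ^ (2 * m))"

definition bessel_Y0 :: "real \<Rightarrow> real" where
  "bessel_Y0 t =
     2 / pi * (ln (t / 2) + euler_mascheroni) * bessel_J0 t
     - 2 / pi * (\<Sum>m. (-1) ^ m * harm m / (fact m)\<^sup>2 * (t / 2) ^ (2 * m))"

definition hankel1_0 :: "real \<Rightarrow> complex" where
  "hankel1_0 t = of_real (bessel_J0 t) + \<i> * of_real (bessel_Y0 t)"

definition spherical_bessel_j0 :: "real \<Rightarrow> real" where
  "spherical_bessel_j0 t = (if t = 0 then 1 else sin t / t)"

text \<open>The second branch below (and in \<open>kernel_K\<close>) is the three-dimensional formula;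
  only dimensions 2 and 3 are used.\<close>

definition Phi :: "real \<Rightarrow> real^'n \<Rightarrow> real^'n \<Rightarrow> complex" where
  "Phi k x y =
     (if CARD('n) = 2 then \<i> / 4 * hankel1_0 (k * norm (x - y))
      else exp (\<i> * of_real (k * norm (x - y))) / of_real (4 * pi * norm (x - y)))"

text \<open>The imaginary part of \<open>Phi\<close>, extended continuously to the diagonal.\<close>

definition Im_Phi :: "real \<Rightarrow> real^'n \<Rightarrow> real^'n \<Rightarrow> real" where
  "Im_Phi k x z = (if x = z then Lim (at z) (\<lambda>y. Im (Phi k y z)) else Im (Phi k x z))"

definition kernel_K :: "real \<Rightarrow> real^'n \<Rightarrow> real^'n \<Rightarrow> complex^'n" where
  "kernel_K k y z =
     (if CARD('n) = 2
      then (1 / 4) *\<^sub>R grad (\<lambda>y. complex_of_real (bessel_J0 (k * norm (y - z)))) y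
      else (k / (4 * pi)) *\<^sub>R
             grad (\<lambda>y. complex_of_real (spherical_bessel_j0 (k * norm (y - z)))) y)"

definition plane_wave :: "real \<Rightarrow> real^'n \<Rightarrow> real^'n \<Rightarrow> complex" where
  "plane_wave k \<theta> x = exp (\<i> * of_real (k * (x \<bullet> \<theta>)))"

text \<open>Weak form of \<open>div ((I + Q) \<nabla>u) + k\<^sup>2 u = 0\<close> in the whole space.\<close>

definition weak_Helmholtz_solution ::
  "real \<Rightarrow> (real^'n \<Rightarrow> complex^'n^'n) \<Rightarrow> (real^'n \<Rightarrow> complex) \<Rightarrow> bool" where
  "weak_Helmholtz_solution k Q u \<longleftrightarrow>
     H1_loc u \<and>
     (\<forall>\<phi>. test_function \<phi> \<longrightarrow>
        (LINT x|lebesgue. ((mat 1 + Q x) *v weak_gradient u x) \<odot> grad \<phi> x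
                          - (of_real k)\<^sup>2 * u x * \<phi> x) = 0)"

definition Sommerfeld :: "real \<Rightarrow> (real^'n \<Rightarrow> complex) \<Rightarrow> bool" where
  "Sommerfeld k v \<longleftrightarrow>
     uniform_limit (sphere 0 1)
       (\<lambda>r \<theta>. of_real (r powr ((real CARD('n) - 1) / 2)) *
               (vector_derivative (\<lambda>\<rho>. v (\<rho> *\<^sub>R \<theta>)) (at r) - \<i> * of_real k * v (r *\<^sub>R \<theta>)))
       (\<lambda>\<theta>. 0) at_top"

text \<open>Elements of \<open>H\<^sup>1\<close>-loc are equivalence classes.  By interior regularity for the Helmholtz
  equation, the scattered field is smooth off the closure of \<open>D\<close> after modification on a null
  set.  The \<open>C1_on\<close> clause says that \<open>us\<close> is this representative, so that its radial
  and normal derivatives have their classical pointwise meaning.\<close>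

definition scattering_solution ::
  "real \<Rightarrow> (real^'n) set \<Rightarrow> (real^'n \<Rightarrow> complex^'n^'n) \<Rightarrow> real^'n
     \<Rightarrow> (real^'n \<Rightarrow> complex) \<Rightarrow> (real^'n \<Rightarrow> complex) \<Rightarrow> bool" where
  "scattering_solution k D Q \<theta> u us \<longleftrightarrow>
     weak_Helmholtz_solution k Q u \<and>
     (\<forall>x. u x = us x + plane_wave k \<theta> x) \<and>
     C1_on (- closure D) us \<and>
     Sommerfeld k us"

definition direct_problem_well_posed ::
  "real \<Rightarrow> (real^'n) set \<Rightarrow> (real^'n \<Rightarrow> complex^'n^'n) \<Rightarrow> bool" where
  "direct_problem_well_posed k D Q \<longleftrightarrow>
     (\<forall>\<theta>\<in>sphere 0 1.
        (\<exists>u us. scattering_solution k D Q \<theta> u us) \<and>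
        (\<forall>u us u' us'. scattering_solution k D Q \<theta> u us \<and> scattering_solution k D Q \<theta> u' us'
           \<longrightarrow> (AE x in lebesgue. us x = us' x)))"

text \<open>Fields take the position first and the direction second, as in \<open>u(x, d)\<close>.\<close>

definition imaging_functional ::
  "real \<Rightarrow> (real^'n) set \<Rightarrow> (real^'n) measure \<Rightarrow> (real^'n \<Rightarrow> real^'n \<Rightarrow> complex)
     \<Rightarrow> nat \<Rightarrow> (nat \<Rightarrow> real^'n) \<Rightarrow> nat \<Rightarrow> real^'n \<Rightarrow> real" where
  "imaging_functional k \<Omega> \<sigma> u_sc N d p z =
     (\<Sum>j=1..N. (cmod (LINT x:frontier \<Omega>|\<sigma>.
        u_sc x (d j) * of_real (normal_deriv \<Omega> (\<lambda>y. Im_Phi k y z) x)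
        - normal_deriv \<Omega> (\<lambda>y. u_sc y (d j)) x * of_real (Im_Phi k x z))) ^ p)"

end

theory Submission
  imports Defs "HOL-Computational_Algebra.Polynomial"
begin

text \<open>
  Let \<open>W\<close> be the imaginary part of \<open>\<Phi>(\<cdot>, z)\<close>.  The singularity of the Green's function is confined to its
  real part, so \<open>W\<close> is an entire solution of the Helmholtz equation; it is radial about \<open>z\<close>, and the kernel
  \<open>K(\<cdot>, z)\<close> is its gradient (\<open>kernel_K_eq_grad\<close>, \<open>laplacian_standing_wave\<close>).

  The integral representation is Green's second identity for the scattered field \<open>u\<^sub>s\<close> and \<open>W\<close> in \<open>\<Omega>\<close>.
  As the total field solves its equation only weakly, the identity is first read with a smooth cut-off
  \<open>\<eta>\<close> that equals 1 near the closure of \<open>D\<close>: testing with \<open>\<eta> W\<close> gives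
  \<open>\<integral> \<nabla>\<eta> \<bullet> (W \<nabla>u\<^sub>s - u\<^sub>s \<nabla>W) = - \<integral>\<^sub>D \<nabla>W \<bullet> Q \<nabla>u\<close> (\<open>scattered_field_flux\<close>).  The left-hand side involves \<open>u\<^sub>s\<close> only
  away from \<open>D\<close>, where it is a \<open>C\<^sup>1\<close> function.  Now \<open>\<eta>\<close> is taken to be the indicator function of \<open>\<Omega>\<close> convolved
  with a mollifier.  By the divergence theorem its gradient is minus the mollified vector measure
  \<open>\<nu> \<sigma>\<close> (\<open>grad_smoothed_indicator\<close>), so when the width of the mollifier tends to zero, the
  left-hand side tends to \<open>- \<integral> (W \<partial>\<^sub>\<nu>u\<^sub>s - u\<^sub>s \<partial>\<^sub>\<nu>W) d\<sigma>\<close> over the boundary of \<open>\<Omega>\<close>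
  (\<open>smoothed_indicator_flux\<close>), which is the integral in the imaging functional.  All derivatives
  fall on the mollifier, so continuity of the field \<open>W \<nabla>u\<^sub>s - u\<^sub>s \<nabla>W\<close> suffices.

  The divergence theorem for \<open>C\<^sup>1\<close> domains is proved in the form that is wanted here
  (\<open>gauss_green\<close>): the difference quotients of the indicator function converge weakly to the surface
  measure times the normal.  In a chart this is Fubini's theorem along the direction of the graph,
  combined with the speed at which the graph moves under translation; a partition of unity makes it
  global.

  For the decay, the volume integral is bounded by the supremum of \<open>|K(y, z)|\<close> over \<open>y\<close> in \<open>D\<close> times the
  integral of \<open>|Q \<nabla>u|\<close>.  The profile of \<open>W\<close>, rescaled by \<open>r\<close> to the power \<open>(n - 1)/2\<close>, satisfies an
  oscillator equation with a non-increasing energy (\<open>radial_profile_derivative_decay\<close>), so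
  \<open>|K(y, z)|\<close> is of order \<open>|y - z|\<close> to the power \<open>-(n - 1)/2\<close>.
\<close>

section \<open>Partial derivatives and smooth functions\<close>

lemma grad_component:
  assumes "(f has_derivative f') (at x)"
  shows "grad f x $ i = f' (axis i 1)"
  using frechet_derivative_at[OF assms] by (simp add: grad_def)

lemma Ck_one_iff:
  "Ck 1 f \<longleftrightarrow> (\<forall>x. f differentiable (at x)) \<and> (\<forall>i. continuous_on UNIV (\<lambda>x. grad f x $ i))"
  by (simp add: One_nat_def)

lemma Ck_Suc_imp_Ck: "Ck (Suc m) f \<Longrightarrow> Ck m f"
proof (induction m arbitrary: f)
  case 0
  then show ?case
    by (auto simp: continuous_on_eq_continuous_at intro: differentiable_imp_continuous_within)
next
  case (Suc m)
  from Suc.prems have "\<And>x. f differentiable (at x)" "\<And>i. Ck (Suc m) (\<lambda>x. grad f x $ i)" by simp_all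
  with Suc.IH show ?case by (simp del: Ck.simps(1)) 
qed

lemma Ck_mono: "Ck n f \<Longrightarrow> m \<le> n \<Longrightarrow> Ck m f"
  by (induction n) (auto simp: le_Suc_eq dest: Ck_Suc_imp_Ck simp del: Ck.simps)

lemma Ck_SucI:
  assumes "\<And>x. (f has_derivative f' x) (at x)" "\<And>i. Ck m (\<lambda>x. f' x (axis i 1))"
  shows "Ck (Suc m) f"
proof -
  have "(\<lambda>x. grad f x $ i) = (\<lambda>x. f' x (axis i 1))" for i
    using grad_component[OF assms(1)] by auto
  with assms show ?thesis by (auto simp: differentiable_def)
qed

lemma Ck_SucD:
  assumes "Ck (Suc m) f"
  shows "(f has_derivative frechet_derivative f (at x)) (at x)"
    and "Ck m (\<lambda>x. frechet_derivative f (at x) (axis i 1))"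
  using assms by (auto simp: frechet_derivative_works grad_def)

lemma Ck_imp_continuous_on: "Ck m f \<Longrightarrow> continuous_on S f"
  using Ck_mono[of m f 0] continuous_on_subset by fastforce

lemma Ck_const: "Ck m (\<lambda>x. c)"
proof (induction m arbitrary: c)
  case (Suc m)
  show ?case by (rule Ck_SucI[where f' = "\<lambda>_ _. 0"]) (auto simp: Suc)
qed simp

lemma Ck_add: "Ck m f \<Longrightarrow> Ck m g \<Longrightarrow> Ck m (\<lambda>x. f x + g x)"
proof (induction m arbitrary: f g)
  case 0
  then show ?case by (auto intro: continuous_on_add)
next
  case (Suc m)
  show ?case
    by (rule Ck_SucI[OF has_derivative_add[OF Ck_SucD(1) Ck_SucD(1)]])
       (use Suc in \<open>auto intro: Suc.IH Ck_SucD simp del: Ck.simps\<close>)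
qed

lemma Ck_mult:
  fixes f g :: "real^'n \<Rightarrow> complex"
  shows "Ck m f \<Longrightarrow> Ck m g \<Longrightarrow> Ck m (\<lambda>x. f x * g x)"
proof (induction m arbitrary: f g)
  case 0
  then show ?case by (auto intro: continuous_on_mult)
next
  case (Suc m)
  show ?case
    by (rule Ck_SucI[OF has_derivative_mult[OF Ck_SucD(1) Ck_SucD(1)]])
       (use Suc in \<open>auto intro!: Ck_add Suc.IH Ck_SucD simp del: Ck.simps intro: Ck_Suc_imp_Ck\<close>)
qed

lemma Ck_cmult:
  fixes f :: "real^'n \<Rightarrow> complex"
  shows "Ck m f \<Longrightarrow> Ck m (\<lambda>x. c * f x)"
  by (rule Ck_mult[OF Ck_const])

lemma Ck_diff:
  fixes f g :: "real^'n \<Rightarrow> complex"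
  shows "Ck m f \<Longrightarrow> Ck m g \<Longrightarrow> Ck m (\<lambda>x. f x - g x)"
  using Ck_add[OF _ Ck_cmult[of m g "-1"]] by simp

lemma Ck_component: "Ck m (\<lambda>x::real^'n. complex_of_real (x $ i - a))"
proof (cases m)
  case (Suc m')
  show ?thesis unfolding Suc
  proof (rule Ck_SucI)
    show "((\<lambda>x. complex_of_real (x $ i - a)) has_derivative (\<lambda>h. complex_of_real (h $ i))) (at x)" for x
      by (auto intro!: derivative_eq_intros bounded_linear_imp_has_derivative bounded_linear_vec_nth)
  qed (rule Ck_const)
qed (auto intro!: continuous_intros)

lemma has_derivative_radial:
  fixes z :: "real^'n"
  assumes "\<And>s. (g has_real_derivative g' s) (at s)"
  shows "((\<lambda>x. g ((norm (x - z))\<^sup>2)) has_derivative (\<lambda>h. 2 * ((x - z) \<bullet> h) * g' ((norm (x - z))\<^sup>2))) (at x)"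
proof -
  have "((\<lambda>x. (norm (x - z))\<^sup>2) has_derivative (\<lambda>h. 2 * ((x - z) \<bullet> h))) (at x)"
    unfolding power2_norm_eq_inner by (auto intro!: derivative_eq_intros simp: inner_commute)
  from DERIV_compose_FDERIV[OF assms this] show ?thesis .
qed

text \<open>Differentiating \<open>g (|x - z|\<^sup>2)\<close> produces the factor \<open>2 (x - z)\<close> and the derivative of \<open>g\<close>, so
  infinitely differentiable profiles \<open>g\<close>, presented as members of a family closed under
  differentiation, give infinitely differentiable radial functions.\<close>

lemma Ck_radial:
  fixes z :: "real^'n"
  assumes closed: "\<And>g. g \<in> G \<Longrightarrow> \<exists>g'\<in>G. \<forall>s. (g has_real_derivative g' s) (at s)" and "g \<in> G"
  shows "Ck m (\<lambda>x. complex_of_real (g ((norm (x - z))\<^sup>2)))"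
  using \<open>g \<in> G\<close>
proof (induction m arbitrary: g)
  case 0
  obtain g' where "\<And>s. (g has_real_derivative g' s) (at s)" using closed[OF 0] by auto
  hence "continuous_on UNIV g" by (meson DERIV_continuous_on has_field_derivative_at_within)
  hence "continuous_on UNIV (\<lambda>x::real^'n. g ((norm (x - z))\<^sup>2))"
    by (rule continuous_on_compose2) (auto intro!: continuous_intros)
  thus ?case by (auto intro: continuous_intros)
next
  case (Suc m)
  obtain g' where g': "\<And>s. (g has_real_derivative g' s) (at s)" "g' \<in> G" using closed[OF Suc.prems] by auto
  show ?case
  proof (rule Ck_SucI)
    show "((\<lambda>x. complex_of_real (g ((norm (x - z))\<^sup>2))) has_derivative
      (\<lambda>h. complex_of_real (2 * ((x - z) \<bullet> h) * g' ((norm (x - z))\<^sup>2)))) (at x)" for x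
      by (intro has_derivative_of_real has_derivative_radial g'(1))
    show "Ck m (\<lambda>x. complex_of_real (2 * ((x - z) \<bullet> axis i 1) * g' ((norm (x - z))\<^sup>2)))" for i
    proof -
      have "Ck m (\<lambda>x. 2 * (complex_of_real (x $ i - z $ i) * complex_of_real (g' ((norm (x - z))\<^sup>2))))"
        by (intro Ck_cmult Ck_mult Ck_component Suc.IH g'(2))
      moreover have "2 * (complex_of_real (x $ i - z $ i) * complex_of_real (g' ((norm (x - z))\<^sup>2)))
         = complex_of_real (2 * ((x - z) \<bullet> axis i 1) * g' ((norm (x - z))\<^sup>2))" for x
        by (simp add: inner_axis)
      ultimately show ?thesis by (simp only:)
    qed
  qed
qed

lemma grad_mult:
  fixes f g :: "real^'n \<Rightarrow> complex"
  assumes "f differentiable (at x)" "g differentiable (at x)"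
  shows "grad (\<lambda>x. f x * g x) x $ i = f x * grad g x $ i + grad f x $ i * g x"
  using grad_component[OF has_derivative_mult[OF assms(1)[unfolded frechet_derivative_works] assms(2)[unfolded frechet_derivative_works]]]
  by (simp add: grad_def)

lemma grad_diff:
  assumes "f differentiable (at x)" "g differentiable (at x)"
  shows "grad (\<lambda>x. f x - g x) x $ i = grad f x $ i - grad g x $ i"
  using grad_component[OF has_derivative_diff[OF assms(1)[unfolded frechet_derivative_works] assms(2)[unfolded frechet_derivative_works]]]
  by (simp add: grad_def)

lemma frechet_derivative_eq_grad:
  assumes "f differentiable (at x)"
  shows "frechet_derivative f (at x) v = (\<Sum>i\<in>UNIV. v $ i *\<^sub>R grad f x $ i)"
proof -
  have l: "linear (frechet_derivative f (at x))"
    using assms by (rule linear_frechet_derivative)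
  have "v = (\<Sum>i\<in>UNIV. v $ i *\<^sub>R axis i 1)"
    using basis_expansion[of v] by (simp add: scalar_mult_eq_scaleR)
  hence "frechet_derivative f (at x) v = frechet_derivative f (at x) (\<Sum>i\<in>UNIV. v $ i *\<^sub>R axis i 1)" by simp
  also have "\<dots> = (\<Sum>i\<in>UNIV. v $ i *\<^sub>R grad f x $ i)"
    using l by (simp add: linear_sum linear_scale grad_def)
  finally show ?thesis .
qed

lemma grad_eq_zero_outside_support:
  assumes "x \<notin> closure {x. f x \<noteq> 0}"
  shows "grad f x = 0"
proof -
  have z: "f y = 0" if "y \<in> - closure {x. f x \<noteq> 0}" for y
    using that closure_subset[of "{x. f x \<noteq> 0}"] by auto
  have "(f has_derivative (\<lambda>h. 0)) (at x)"
  proof (rule has_derivative_transform_within_open[OF has_derivative_const])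
    show "x \<in> - closure {x. f x \<noteq> 0}" using assms by simp
    show "0 = f y" if "y \<in> - closure {x. f x \<noteq> 0}" for y using z[OF that] ..
  qed (rule open_Compl[OF closed_closure])
  thus ?thesis by (simp add: vec_eq_iff grad_component)
qed

lemma test_functionD:
  assumes "test_function f"
  shows "Ck m f" "compact (closure {x. f x \<noteq> 0})"
  using assms by (auto simp: test_function_def)

lemma test_function_of_support_subset:
  assumes "test_function f" "\<And>m. Ck m g" "{x. g x \<noteq> 0} \<subseteq> closure {x. f x \<noteq> 0}"
  shows "test_function g"
proof -
  have "closure {x. g x \<noteq> 0} = closure {x. f x \<noteq> 0} \<inter> closure {x. g x \<noteq> 0}"
    using closure_minimal[OF assms(3) closed_closure] by blast
  hence "compact (closure {x. g x \<noteq> 0})"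
    using compact_Int_closed[OF test_functionD(2)[OF assms(1)] closed_closure[of "{x. g x \<noteq> 0}"]] by simp
  thus ?thesis unfolding test_function_def using assms(2) by simp
qed

lemma test_function_mult:
  fixes f g :: "real^'n \<Rightarrow> complex"
  assumes "test_function f" "\<And>m. Ck m g"
  shows "test_function (\<lambda>x. f x * g x)"
proof (rule test_function_of_support_subset[OF assms(1)])
  show "{x. f x * g x \<noteq> 0} \<subseteq> closure {x. f x \<noteq> 0}"
    using closure_subset by fastforce
qed (rule Ck_mult[OF test_functionD(1)[OF assms(1)] assms(2)])

lemma test_function_grad:
  assumes "test_function f"
  shows "test_function (\<lambda>x. grad f x $ i)"
proof (rule test_function_of_support_subset[OF assms])
  show "{x. grad f x $ i \<noteq> 0} \<subseteq> closure {x. f x \<noteq> 0}"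
  proof
    fix x assume "x \<in> {x. grad f x $ i \<noteq> 0}"
    thus "x \<in> closure {x. f x \<noteq> 0}" using grad_eq_zero_outside_support[of x f] by force
  qed
  show "Ck m (\<lambda>x. grad f x $ i)" for m
    using test_functionD(1)[OF assms, of "Suc m"] by simp
qed

lemma has_derivative_plane_wave:
  "(plane_wave k \<theta> has_derivative (\<lambda>h. \<i> * of_real k * of_real (h \<bullet> \<theta>) * plane_wave k \<theta> x)) (at x)"
proof -
  have "((\<lambda>x. \<i> * complex_of_real (k * (x \<bullet> \<theta>))) has_derivative (\<lambda>h. \<i> * complex_of_real (k * (h \<bullet> \<theta>)))) (at x)"
    by (auto intro!: derivative_eq_intros)
  hence "((\<lambda>x. exp (\<i> * complex_of_real (k * (x \<bullet> \<theta>)))) has_derivative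
    (\<lambda>h. \<i> * complex_of_real (k * (h \<bullet> \<theta>)) * exp (\<i> * complex_of_real (k * (x \<bullet> \<theta>))))) (at x)"
    using has_derivative_compose[OF _ DERIV_exp[unfolded has_field_derivative_def]] by (simp add: mult.commute)
  thus ?thesis by (simp add: plane_wave_def[abs_def] mult_ac)
qed

lemma grad_plane_wave: "grad (plane_wave k \<theta>) x $ i = \<i> * of_real k * of_real (\<theta> $ i) * plane_wave k \<theta> x"
  unfolding grad_component[OF has_derivative_plane_wave] by (simp add: inner_axis inner_commute)

lemma Ck_plane_wave: "Ck m (plane_wave k \<theta>)"
proof (induction m)
  case 0
  show ?case unfolding plane_wave_def by (auto intro!: continuous_intros)
next
  case (Suc m)
  show ?case
    by (rule Ck_SucI[OF has_derivative_plane_wave]) (intro Ck_cmult Suc)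
qed

section \<open>Mollifiers\<close>

text \<open>The functions \<open>p (1/t) exp (-1/t)\<close>, extended by zero to \<open>t \<le> 0\<close>.  Admitting every polynomial
  \<open>p\<close> makes the family closed under differentiation; the bump functions only use \<open>p = 1\<close>.\<close>

definition flat :: "real poly \<Rightarrow> real \<Rightarrow> real" where
  "flat p t = (if t > 0 then poly p (inverse t) / exp (inverse t) else 0)"

lemma poly_div_exp_tendsto_0: "((\<lambda>x::real. poly p x / exp x) \<longlongrightarrow> 0) at_top"
proof -
  have "((\<lambda>x. \<Sum>i\<le>degree p. coeff p i * (x ^ i / exp x)) \<longlongrightarrow> (\<Sum>i\<le>degree p. coeff p i * 0)) at_top"
    by (intro tendsto_sum tendsto_mult tendsto_const tendsto_power_div_exp_0)
  thus ?thesis by (simp add: poly_altdef sum_divide_distrib)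
qed

lemma has_real_derivative_flat:
  "(flat p has_real_derivative flat ((p - pderiv p) * monom 1 2) t) (at t)"
proof (cases t "0::real" rule: linorder_cases)
  case less
  have "(flat p has_real_derivative 0) (at t)"
    by (rule has_field_derivative_transform_within_open[OF DERIV_const[of 0], of "{..<0}"])
       (use less in \<open>auto simp: flat_def\<close>)
  with less show ?thesis by (simp add: flat_def)
next
  case equal
  have "((\<lambda>h. (flat p (0 + h) - flat p 0) / h) \<longlongrightarrow> 0) (at_right 0)"
    unfolding filterlim_at_right_to_top
  proof (rule Lim_transform_eventually[OF poly_div_exp_tendsto_0[of "pCons 0 p"]])
    show "\<forall>\<^sub>F x in at_top. poly (pCons 0 p) x / exp x = (flat p (0 + inverse x) - flat p 0) / inverse x"
      using eventually_gt_at_top[of 0] by eventually_elim (auto simp: flat_def field_simps)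
  qed
  moreover have "((\<lambda>h. (flat p (0 + h) - flat p 0) / h) \<longlongrightarrow> 0) (at_left 0)"
    by (rule tendsto_eventually) (auto simp: flat_def eventually_at_filter)
  ultimately have "((\<lambda>h. (flat p (0 + h) - flat p 0) / h) \<longlongrightarrow> 0) (at 0)"
    by (rule filterlim_split_at[rotated])
  with equal show ?thesis by (simp add: DERIV_def flat_def)
next
  case greater
  have "((\<lambda>x. poly p x / exp x) has_real_derivative (poly (pderiv p) x - poly p x) / exp x) (at x)" for x
    by (rule derivative_eq_intros poly_DERIV refl | simp)+ (simp add: field_simps)
  moreover have "(inverse has_real_derivative - (inverse t ^ 2)) (at t)"
    using DERIV_inverse[of t] greater by (simp add: power2_eq_square)
  ultimately have "((\<lambda>t. poly p (inverse t) / exp (inverse t)) has_real_derivative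
     (poly (pderiv p) (inverse t) - poly p (inverse t)) / exp (inverse t) * (- (inverse t ^ 2))) (at t)"
    by (rule DERIV_chain2)
  also have "(poly (pderiv p) (inverse t) - poly p (inverse t)) / exp (inverse t) * (- (inverse t ^ 2))
     = poly ((p - pderiv p) * monom 1 2) (inverse t) / exp (inverse t)"
    by (simp add: poly_monom algebra_simps diff_divide_distrib)
  finally have "((\<lambda>t. poly p (inverse t) / exp (inverse t)) has_real_derivative
     poly ((p - pderiv p) * monom 1 2) (inverse t) / exp (inverse t)) (at t)" .
  hence "(flat p has_real_derivative poly ((p - pderiv p) * monom 1 2) (inverse t) / exp (inverse t)) (at t)"
    by (rule has_field_derivative_transform_within_open[of _ _ _ "{0<..}"])
       (use greater in \<open>auto simp: flat_def\<close>)
  with greater show ?thesis by (simp add: flat_def)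
qed

text \<open>The argument \<open>\<epsilon>\<^sup>2 - |x|\<^sup>2\<close> is a smooth function of \<open>x\<close> that is positive exactly on the ball of radius
  \<open>\<epsilon>\<close>, so no smoothness question arises at the origin.\<close>

definition mollifier :: "real \<Rightarrow> real^'n \<Rightarrow> real" where
  "mollifier \<epsilon> x = flat 1 (\<epsilon>\<^sup>2 - (norm x)\<^sup>2) / (LINT y|lborel. flat 1 (\<epsilon>\<^sup>2 - (norm (y::real^'n))\<^sup>2))"

lemma Ck_flat_radial: "Ck m (\<lambda>x::real^'n. complex_of_real (flat 1 (c - (norm x)\<^sup>2)))"
proof -
  let ?G = "{\<lambda>s. a * flat p (c - s) |a p. True}"
  have "Ck m (\<lambda>x. complex_of_real ((\<lambda>s. flat 1 (c - s)) ((norm (x - (0::real^'n)))\<^sup>2)))"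
  proof (rule Ck_radial[where G = ?G])
    show "(\<lambda>s. flat 1 (c - s)) \<in> ?G" by (auto intro!: exI[of _ 1])
    show "\<exists>g'\<in>?G. \<forall>s. (g has_real_derivative g' s) (at s)" if "g \<in> ?G" for g
    proof -
      from that obtain a p where g: "g = (\<lambda>s. a * flat p (c - s))" by auto
      have "(g has_real_derivative - a * flat ((p - pderiv p) * monom 1 2) (c - s)) (at s)" for s
        unfolding g by (rule derivative_eq_intros DERIV_chain2[OF has_real_derivative_flat] refl)+ simp
      thus ?thesis by (intro bexI[of _ "\<lambda>s. - a * flat ((p - pderiv p) * monom 1 2) (c - s)"]) blast+
    qed
  qed
  thus ?thesis by simp
qed

lemma Ck_mollifier: "Ck m (\<lambda>x. complex_of_real (mollifier \<epsilon> x))"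
  using Ck_cmult[OF Ck_flat_radial, of m "1 / (LINT y|lborel. flat 1 (\<epsilon>\<^sup>2 - (norm (y::real^'n))\<^sup>2))" "\<epsilon>\<^sup>2"]
  by (simp add: mollifier_def)

lemma mollifier_minus [simp]: "mollifier \<epsilon> (- x) = mollifier \<epsilon> x"
  by (simp add: mollifier_def)

lemma continuous_on_flat_radial: "continuous_on S (\<lambda>x::real^'n. flat 1 (c - (norm x)\<^sup>2))"
proof -
  have "continuous_on S (\<lambda>x. Re (complex_of_real (flat 1 (c - (norm (x::real^'n))\<^sup>2))))"
    by (intro continuous_on_Re Ck_imp_continuous_on[OF Ck_flat_radial])
  thus ?thesis by simp
qed

lemma continuous_on_mollifier: "continuous_on S (mollifier \<epsilon>)"
  unfolding mollifier_def[abs_def] using continuous_on_flat_radial[of S "\<epsilon>\<^sup>2"]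
  by (simp add: divide_inverse continuous_on_mult_right)

lemma flat_nonneg: "flat 1 t \<ge> 0" by (simp add: flat_def)

lemma flat_radial_eq_0_iff: "\<epsilon> > 0 \<Longrightarrow> flat 1 (\<epsilon>\<^sup>2 - (norm x)\<^sup>2) = 0 \<longleftrightarrow> norm x \<ge> \<epsilon>"
proof -
  assume "\<epsilon> > 0"
  hence "(norm x)\<^sup>2 < \<epsilon>\<^sup>2 \<longleftrightarrow> norm x < \<epsilon>"
    by (metis less_eq_real_def norm_ge_zero power2_less_imp_less power_strict_mono pos2)
  thus ?thesis by (simp add: flat_def not_less)
qed

lemma integrable_lborel_continuous_compact_support:
  fixes f :: "'a::euclidean_space \<Rightarrow> 'b::euclidean_space"
  assumes "continuous_on UNIV f" "compact K" "\<And>x. x \<notin> K \<Longrightarrow> f x = 0"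
  shows "integrable lborel f"
proof -
  have "integrable lborel (\<lambda>x. indicator K x *\<^sub>R f x)"
    using borel_integrable_compact[OF assms(2) continuous_on_subset[OF assms(1)]] by simp
  also have "(\<lambda>x. indicator K x *\<^sub>R f x) = f"
    using assms(3) by (auto simp: fun_eq_iff indicator_def)
  finally show ?thesis .
qed

lemma
  assumes "\<epsilon> > 0"
  shows mollifier_nonneg: "mollifier \<epsilon> (x::real^'n) \<ge> 0"
    and mollifier_eq_0: "norm (x::real^'n) \<ge> \<epsilon> \<Longrightarrow> mollifier \<epsilon> x = 0"
    and integrable_mollifier: "integrable lborel (mollifier \<epsilon> :: real^'n \<Rightarrow> real)"
    and integral_mollifier: "(LINT x|lborel. mollifier \<epsilon> (x::real^'n)) = 1"
proof -
  let ?b = "\<lambda>x::real^'n. flat 1 (\<epsilon>\<^sup>2 - (norm x)\<^sup>2)"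
  have int: "integrable lborel ?b"
    by (rule integrable_lborel_continuous_compact_support[OF continuous_on_flat_radial compact_cball[of 0 \<epsilon>]])
       (simp add: flat_radial_eq_0_iff[OF assms])
  have "(LINT x|lborel. ?b x) \<noteq> 0"
  proof
    assume "(LINT x|lborel. ?b x) = 0"
    hence "AE x in lborel. ?b x = 0"
      by (subst (asm) integral_nonneg_eq_0_iff_AE[OF int]) (simp_all add: flat_nonneg)
    hence "AE x in lborel. x \<notin> ball (0::real^'n) \<epsilon>"
      by eventually_elim (simp add: flat_radial_eq_0_iff[OF assms])
    hence "ball (0::real^'n) \<epsilon> \<in> null_sets lborel"
      by (subst (asm) AE_iff_null_sets[symmetric]) auto
    hence "negligible (ball (0::real^'n) \<epsilon>)"
      by (simp add: negligible_iff_null_sets null_sets_completionI)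
    thus False using open_not_negligible[of "ball (0::real^'n) \<epsilon>"] assms by simp
  qed
  moreover have "(LINT x|lborel. ?b x) \<ge> 0" by (simp add: flat_nonneg)
  ultimately have pos: "(LINT x|lborel. ?b x) > 0" by linarith
  show "mollifier \<epsilon> x \<ge> 0" using pos by (simp add: mollifier_def flat_nonneg)
  show "norm x \<ge> \<epsilon> \<Longrightarrow> mollifier \<epsilon> x = 0"
    using flat_radial_eq_0_iff[OF assms, of x] by (simp add: mollifier_def)
  show "integrable lborel (mollifier \<epsilon> :: real^'n \<Rightarrow> real)"
    unfolding mollifier_def[abs_def] using int by simp
  show "(LINT x|lborel. mollifier \<epsilon> (x::real^'n)) = 1"
    unfolding mollifier_def using pos by simp
qed

section \<open>The radial standing wave\<close>

text \<open>A radial function \<open>g (|x|\<^sup>2)\<close> solves the Helmholtz equation in dimension \<open>n\<close> iff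
  \<open>4 s g'' + 2 n g' + k\<^sup>2 g = 0\<close>.  The recursion is this equation read off at the power series of \<open>g\<close>
  in \<open>s = |x|\<^sup>2\<close>.  It yields \<open>J\<^sub>0 (k |x|)\<close> for \<open>n = 2\<close> and \<open>j\<^sub>0 (k |x|)\<close> for \<open>n = 3\<close>, so both dimensions are
  treated at once.\<close>

fun radial_coeff :: "real \<Rightarrow> nat \<Rightarrow> nat \<Rightarrow> real" where
  "radial_coeff k n 0 = 1"
| "radial_coeff k n (Suc m) = - (k\<^sup>2) * radial_coeff k n m / (real (Suc m) * (4 * real m + 2 * real n))"

definition radial_profile :: "real \<Rightarrow> nat \<Rightarrow> real \<Rightarrow> real" where
  "radial_profile k n s = (\<Sum>m. radial_coeff k n m * s ^ m)"

definition radial_profile' :: "real \<Rightarrow> nat \<Rightarrow> real \<Rightarrow> real" where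
  "radial_profile' k n s = (\<Sum>m. diffs (radial_coeff k n) m * s ^ m)"

definition radial_profile'' :: "real \<Rightarrow> nat \<Rightarrow> real \<Rightarrow> real" where
  "radial_profile'' k n s = (\<Sum>m. diffs (diffs (radial_coeff k n)) m * s ^ m)"

lemma abs_radial_coeff_le:
  assumes "n > 0"
  shows "\<bar>radial_coeff k n m\<bar> \<le> (k\<^sup>2) ^ m / fact m"
proof (induction m)
  case (Suc m)
  have "\<bar>radial_coeff k n (Suc m)\<bar> = k\<^sup>2 / (real (Suc m) * (4 * real m + 2 * real n)) * \<bar>radial_coeff k n m\<bar>"
    by (simp add: abs_mult)
  also have "\<dots> \<le> k\<^sup>2 / (real (Suc m) * 1) * ((k\<^sup>2) ^ m / fact m)"
    by (intro mult_mono divide_left_mono Suc.IH) (use assms in auto)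
  finally show ?case by (simp add: field_simps)
qed simp

lemma summable_radial_coeff:
  assumes "n > 0"
  shows "summable (\<lambda>m. radial_coeff k n m * y ^ m)"
proof (rule summable_comparison_test'[where N = 0])
  show "summable (\<lambda>m. inverse (fact m) *\<^sub>R (k\<^sup>2 * \<bar>y\<bar>) ^ m :: real)" by (rule summable_exp_generic)
  show "norm (radial_coeff k n m * y ^ m) \<le> inverse (fact m) *\<^sub>R (k\<^sup>2 * \<bar>y\<bar>) ^ m" for m
    using mult_right_mono[OF abs_radial_coeff_le[OF assms, of k m], of "\<bar>y\<bar> ^ m"]
    by (simp add: abs_mult power_abs power_mult_distrib field_simps)
qed

lemma has_real_derivative_radial_profile:
  assumes "n > 0"
  shows "(radial_profile k n has_real_derivative radial_profile' k n s) (at s)"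
  unfolding radial_profile_def[abs_def] radial_profile'_def
  by (rule termdiffs_strong_converges_everywhere[OF summable_radial_coeff[OF assms]])

lemma has_real_derivative_radial_profile':
  assumes "n > 0"
  shows "(radial_profile' k n has_real_derivative radial_profile'' k n s) (at s)"
  unfolding radial_profile'_def[abs_def] radial_profile''_def
  by (intro termdiffs_strong_converges_everywhere termdiff_converges_all summable_radial_coeff assms)

lemma radial_profile_ode:
  assumes "n > 0"
  shows "4 * s * radial_profile'' k n s + 2 * real n * radial_profile' k n s + k\<^sup>2 * radial_profile k n s = 0"
proof -
  let ?a = "radial_coeff k n"
  let ?b = "\<lambda>m. real m * real (Suc m) * ?a (Suc m)"
  have s0: "(\<lambda>m. ?a m * s ^ m) sums radial_profile k n s"
    unfolding radial_profile_def by (intro summable_sums summable_radial_coeff assms)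
  have s1: "(\<lambda>m. diffs ?a m * s ^ m) sums radial_profile' k n s"
    unfolding radial_profile'_def
    by (intro summable_sums termdiff_converges_all summable_radial_coeff assms)
  have s2: "(\<lambda>m. diffs (diffs ?a) m * s ^ m) sums radial_profile'' k n s"
    unfolding radial_profile''_def
    by (intro summable_sums termdiff_converges_all summable_radial_coeff assms)
  have "(\<lambda>m. ?b (Suc m) * s ^ Suc m) sums (s * radial_profile'' k n s)"
    using sums_mult[OF s2, of s] by (simp add: diffs_def mult_ac)
  hence s3: "(\<lambda>m. ?b m * s ^ m) sums (s * radial_profile'' k n s)"
    using sums_Suc_iff[of "\<lambda>m. ?b m * s ^ m"] by simp
  have "(\<lambda>m. 4 * (?b m * s ^ m) + 2 * real n * (diffs ?a m * s ^ m) + k\<^sup>2 * (?a m * s ^ m)) sums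
    (4 * (s * radial_profile'' k n s) + 2 * real n * radial_profile' k n s + k\<^sup>2 * radial_profile k n s)"
    by (intro sums_add sums_mult s0 s1 s3)
  moreover have "4 * (?b m * s ^ m) + 2 * real n * (diffs ?a m * s ^ m) + k\<^sup>2 * (?a m * s ^ m) = 0" for m
  proof -
    have "real (Suc m) * (4 * real m + 2 * real n) \<noteq> 0"
      using assms by (auto simp: add_nonneg_eq_0_iff simp del: of_nat_Suc)
    hence "?a (Suc m) * (real (Suc m) * (4 * real m + 2 * real n)) = - (k\<^sup>2) * ?a m"
      by (simp del: of_nat_Suc)
    hence "4 * ?b m + 2 * real n * diffs ?a m + k\<^sup>2 * ?a m = 0"
      by (simp add: diffs_def algebra_simps del: radial_coeff.simps)
    hence "(4 * ?b m + 2 * real n * diffs ?a m + k\<^sup>2 * ?a m) * s ^ m = 0" by simp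
    thus ?thesis by (simp only: algebra_simps)
  qed
  ultimately have "(\<lambda>m. 0) sums (4 * (s * radial_profile'' k n s) + 2 * real n * radial_profile' k n s + k\<^sup>2 * radial_profile k n s)"
    by simp
  from sums_unique2[OF this sums_zero] show ?thesis by (simp add: mult.assoc)
qed

lemma bessel_J0_eq_radial_profile: "bessel_J0 (k * r) = radial_profile k 2 (r\<^sup>2)"
proof -
  have "radial_coeff k 2 m = (-1) ^ m / (fact m)\<^sup>2 * (k / 2) ^ (2 * m)" for m
  proof (induction m)
    case (Suc m)
    have "radial_coeff k 2 (Suc m) = - (k\<^sup>2) * ((-1) ^ m / (fact m)\<^sup>2 * (k / 2) ^ (2 * m)) / (4 * (real (Suc m))\<^sup>2)"
      by (simp add: Suc.IH) (simp add: power2_eq_square algebra_simps)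
    also have "\<dots> = (-1) ^ Suc m / (fact (Suc m))\<^sup>2 * (k / 2) ^ (2 * Suc m)"
    proof -
      have "(k / 2) ^ (2 * Suc m) = (k / 2) ^ (2 * m) * (k\<^sup>2 / 4)"
        by (simp add: power2_eq_square)
      moreover have "(fact (Suc m))\<^sup>2 = (real (Suc m))\<^sup>2 * (fact m)\<^sup>2"
        by (simp only: fact_Suc power_mult_distrib)
      ultimately show ?thesis by (simp add: power2_eq_square mult_ac del: fact_Suc of_nat_Suc)
    qed
    finally show ?case .
  qed simp
  moreover have "(k / 2) ^ (2 * m) * (r\<^sup>2) ^ m = (k * r / 2) ^ (2 * m)" for m
    by (simp add: power_mult_distrib power_divide power_mult)
  ultimately show ?thesis unfolding bessel_J0_def radial_profile_def
    by (simp add: mult.assoc)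
qed

lemma spherical_bessel_j0_eq_radial_profile: "spherical_bessel_j0 (k * r) = radial_profile k 3 (r\<^sup>2)"
proof -
  have c: "radial_coeff k 3 m = (-1) ^ m / fact (2 * m + 1) * k ^ (2 * m)" for m
    by (induction m) (simp_all add: field_simps power2_eq_square)
  have "(\<lambda>m. radial_coeff k 3 m * (r\<^sup>2) ^ m) sums spherical_bessel_j0 (k * r)"
  proof (cases "k * r = 0")
    case True
    have "(\<lambda>m. (-1) ^ m / fact (2 * m + 1) * (k * r) ^ (2 * m)) sums (\<Sum>m\<in>{0}. (-1) ^ m / fact (2 * m + 1) * (k * r) ^ (2 * m))"
      by (rule sums_finite) (auto simp: True)
    moreover have "k ^ (2 * m) * (r\<^sup>2) ^ m = (k * r) ^ (2 * m)" for m
      by (simp add: power_mult_distrib power_mult)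
    ultimately show ?thesis using True by (simp add: c spherical_bessel_j0_def mult.assoc)
  next
    case False
    have "(\<lambda>m. (-1) ^ m / fact (2 * m + 1) * (k * r) ^ (2 * m + 1) / (k * r)) sums (sin (k * r) / (k * r))"
      by (intro sums_divide sin_paired)
    moreover have "(-1) ^ m / fact (2 * m + 1) * (k * r) ^ (2 * m + 1) / (k * r)
        = radial_coeff k 3 m * (r\<^sup>2) ^ m" for m
    proof -
      have "(k * r) ^ (2 * m + 1) / (k * r) = k ^ (2 * m) * (r\<^sup>2) ^ m"
        using False by (simp add: power_mult_distrib power_mult)
      thus ?thesis unfolding c by (metis mult.assoc times_divide_eq_right)
    qed
    ultimately show ?thesis using False by (simp add: spherical_bessel_j0_def)
  qed
  thus ?thesis unfolding radial_profile_def by (simp add: sums_iff)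
qed

text \<open>With \<open>h r = g (r\<^sup>2)\<close> and \<open>a = (n - 1)/2\<close>, the function \<open>v = r\<^sup>a h\<close> satisfies
  \<open>v'' + (k\<^sup>2 - a (a - 1) / r\<^sup>2) v = 0\<close>.  In dimensions 2 and 3 the number \<open>c = a (a - 1)\<close> is \<open>-1/4\<close> and \<open>0\<close>, so
  the energy \<open>v'\<^sup>2 + (k\<^sup>2 - c / r\<^sup>2) v\<^sup>2\<close> has derivative \<open>2 c v\<^sup>2 / r\<^sup>3 \<le> 0\<close> and therefore stays below its value
  at \<open>r = 1\<close>.  Hence \<open>v\<close> and \<open>v'\<close> are bounded, which is the claim.\<close>

lemma radial_profile_derivative_decay:
  assumes "n = 2 \<or> n = 3" and "k > 0"
  shows "\<exists>C. \<forall>r\<ge>1. \<bar>2 * r * radial_profile' k n (r\<^sup>2)\<bar> \<le> C * r powr (- ((real n - 1) / 2))"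
proof -
  define a where "a = (real n - 1) / 2"
  define c where "c = a * (a - 1)"
  have n: "n > 0" and a: "a > 0" and c: "c \<le> 0" using assms(1) by (auto simp: a_def c_def)
  define h where "h r = radial_profile k n (r\<^sup>2)" for r
  define p where "p r = 2 * r * radial_profile' k n (r\<^sup>2)" for r
  \<comment> \<open>\<open>q = v' / r powr a\<close>, and \<open>E\<close> is the energy of \<open>v\<close> expressed through \<open>h\<close> and its derivative \<open>p\<close>.\<close>
  define q where "q r = p r + a * h r * inverse r" for r
  define E where "E r = r ^ (n - 1) * ((q r)\<^sup>2 + (k\<^sup>2 - c * (inverse r)\<^sup>2) * (h r)\<^sup>2)" for r
  have sq: "((\<lambda>r. r\<^sup>2) has_real_derivative 2 * r) (at r)" for r :: real
    by (auto intro!: derivative_eq_intros)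
  have h': "(h has_real_derivative p r) (at r)" for r
    unfolding h_def[abs_def] p_def
    using DERIV_chain2[OF has_real_derivative_radial_profile[OF n] sq] by (simp add: mult_ac)
  have p': "(p has_real_derivative - 2 * a * p r * inverse r - k\<^sup>2 * h r) (at r)" if "r > 0" for r
  proof -
    have "(p has_real_derivative 2 * radial_profile' k n (r\<^sup>2) + 2 * r * (radial_profile'' k n (r\<^sup>2) * (2 * r))) (at r)"
      unfolding p_def[abs_def]
      by (auto intro!: derivative_eq_intros DERIV_chain2[OF has_real_derivative_radial_profile'[OF n] sq])
    also have "2 * radial_profile' k n (r\<^sup>2) + 2 * r * (radial_profile'' k n (r\<^sup>2) * (2 * r))
      = - 2 * a * p r * inverse r - k\<^sup>2 * h r"
    proof -
      have "- 2 * a * p r * inverse r = - (real n - 1) * (2 * radial_profile' k n (r\<^sup>2))"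
        using that by (simp add: a_def p_def)
      thus ?thesis using radial_profile_ode[OF n, of "r\<^sup>2" k]
        by (simp add: h_def algebra_simps power2_eq_square)
    qed
    finally show ?thesis .
  qed
  have E': "(E has_real_derivative r ^ (n - 1) * (2 * c * (h r)\<^sup>2 * inverse r ^ 3)) (at r)" if "r > 0" for r
  proof -
    have w': "(inverse has_real_derivative - (inverse r)\<^sup>2) (at r)"
      using DERIV_inverse[of r] that by (simp add: power2_eq_square)
    have pow': "((\<lambda>r. r ^ (n - 1)) has_real_derivative 2 * a * (r ^ (n - 1) * inverse r)) (at r)"
    proof -
      have "((\<lambda>r. r ^ (n - 1)) has_real_derivative real (n - 1) * r ^ (n - 1 - 1)) (at r)"
        using DERIV_pow[of "n - 1" r] by simp
      also have "real (n - 1) * r ^ (n - 1 - 1) = 2 * a * (r ^ (n - 1) * inverse r)"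
        using assms(1) that by (auto simp: a_def power2_eq_square)
      finally show ?thesis .
    qed
    have q': "(q has_real_derivative (- 2 * a * p r * inverse r - k\<^sup>2 * h r)
        + a * (p r * inverse r + h r * - (inverse r)\<^sup>2)) (at r)"
      unfolding q_def[abs_def]
      by (rule derivative_eq_intros p'[OF that] h' w' refl)+ (simp add: algebra_simps)
    have "(E has_real_derivative
       2 * a * (r ^ (n - 1) * inverse r) * ((q r)\<^sup>2 + (k\<^sup>2 - c * (inverse r)\<^sup>2) * (h r)\<^sup>2)
       + r ^ (n - 1) * (2 * q r * ((- 2 * a * p r * inverse r - k\<^sup>2 * h r)
        + a * (p r * inverse r + h r * - (inverse r)\<^sup>2))
        + 2 * c * inverse r ^ 3 * (h r)\<^sup>2 + (k\<^sup>2 - c * (inverse r)\<^sup>2) * (2 * h r * p r))) (at r)"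
      unfolding E_def[abs_def]
      by (rule derivative_eq_intros pow' q' h' w' refl)+
         (simp add: algebra_simps power2_eq_square power3_eq_cube)
    also have "2 * a * (r ^ (n - 1) * inverse r) * ((q r)\<^sup>2 + (k\<^sup>2 - c * (inverse r)\<^sup>2) * (h r)\<^sup>2)
       + r ^ (n - 1) * (2 * q r * ((- 2 * a * p r * inverse r - k\<^sup>2 * h r)
        + a * (p r * inverse r + h r * - (inverse r)\<^sup>2))
        + 2 * c * inverse r ^ 3 * (h r)\<^sup>2 + (k\<^sup>2 - c * (inverse r)\<^sup>2) * (2 * h r * p r))
       = r ^ (n - 1) * (2 * c * (h r)\<^sup>2 * inverse r ^ 3)"
      unfolding q_def c_def by algebra
    finally show ?thesis .
  qed
  define M where "M = E 1"
  have EM: "E r \<le> M" if "r \<ge> 1" for r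
    unfolding M_def
  proof (rule DERIV_nonpos_imp_nonincreasing[OF that])
    fix x :: real assume x: "1 \<le> x" "x \<le> r"
    have "x ^ (n - 1) * (2 * c * (h x)\<^sup>2 * inverse x ^ 3) \<le> 0"
      using x c by (intro mult_nonneg_nonpos mult_nonpos_nonneg) auto
    thus "\<exists>y. (E has_real_derivative y) (at x) \<and> y \<le> 0" using E'[of x] x by auto
  qed
  have bound: "\<bar>p r\<bar> \<le> sqrt M * (1 + a / k) * r powr (- a)" if "r \<ge> 1" for r
  proof -
    let ?s = "r powr a"
    have s: "?s > 0" using that by simp
    have s2: "?s\<^sup>2 = r ^ (n - 1)"
    proof -
      have "?s\<^sup>2 = r powr real (n - 1)"
        using assms(1) by (auto simp: a_def power2_eq_square powr_add[symmetric])
      thus ?thesis using that by (simp add: powr_realpow)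
    qed
    have nn: "- c * (inverse r)\<^sup>2 * (h r)\<^sup>2 \<ge> 0" using c by (intro mult_nonneg_nonneg) auto
    have "?s\<^sup>2 * ((q r)\<^sup>2 + k\<^sup>2 * (h r)\<^sup>2) \<le> ?s\<^sup>2 * ((q r)\<^sup>2 + (k\<^sup>2 - c * (inverse r)\<^sup>2) * (h r)\<^sup>2)"
      using nn by (intro mult_left_mono) (auto simp: algebra_simps)
    also have "\<dots> \<le> M" using EM[OF that] by (simp add: E_def s2)
    finally have *: "(?s * q r)\<^sup>2 + (?s * k * h r)\<^sup>2 \<le> M" by (simp add: power_mult_distrib algebra_simps)
    have "\<bar>?s * q r\<bar> \<le> sqrt M"
      using * by (intro real_le_rsqrt) (simp, smt (verit) zero_le_power2)
    hence qb: "?s * \<bar>q r\<bar> \<le> sqrt M" using s by (simp add: abs_mult)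
    have "\<bar>?s * k * h r\<bar> \<le> sqrt M"
      using * by (intro real_le_rsqrt) (simp, smt (verit) zero_le_power2)
    hence hb: "?s * \<bar>h r\<bar> \<le> sqrt M / k" using s \<open>k > 0\<close> by (simp add: abs_mult field_simps)
    have "\<bar>p r\<bar> \<le> \<bar>q r\<bar> + a * \<bar>h r\<bar>"
    proof -
      have "\<bar>p r\<bar> \<le> \<bar>q r\<bar> + \<bar>a * h r * inverse r\<bar>" unfolding q_def by linarith
      also have "\<bar>a * h r * inverse r\<bar> \<le> a * \<bar>h r\<bar> * 1"
        using that a mult_right_mono[OF that, of "\<bar>h r\<bar>"] by (simp add: abs_mult field_simps)
      finally show ?thesis by simp
    qed
    hence "?s * \<bar>p r\<bar> \<le> ?s * \<bar>q r\<bar> + a * (?s * \<bar>h r\<bar>)"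
      using mult_left_mono[of "\<bar>p r\<bar>" "\<bar>q r\<bar> + a * \<bar>h r\<bar>" ?s] s by (simp add: algebra_simps)
    also have "\<dots> \<le> sqrt M + a * (sqrt M / k)"
      using qb hb a by (intro add_mono mult_left_mono) auto
    finally have "?s * \<bar>p r\<bar> \<le> sqrt M * (1 + a / k)" by (simp add: algebra_simps)
    thus ?thesis using s by (simp add: powr_minus field_simps)
  qed
  show ?thesis using bound unfolding p_def a_def by blast
qed

text \<open>The factors that turn \<open>J\<^sub>0\<close> and \<open>j\<^sub>0\<close> into the imaginary part of the Green's function.\<close>

definition wave_factor :: "real \<Rightarrow> nat \<Rightarrow> real" where
  "wave_factor k n = (if n = 2 then 1 / 4 else k / (4 * pi))"

text \<open>The imaginary part of the Green's function with pole \<open>z\<close>, complex-valued so that multiples of it can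
  serve as test functions.\<close>

definition standing_wave :: "real \<Rightarrow> real^'n \<Rightarrow> real^'n \<Rightarrow> complex" where
  "standing_wave k z x = of_real (Im_Phi k x z)"

lemma radial_profile_0 [simp]: "radial_profile k n 0 = 1"
  by (simp add: radial_profile_def powser_zero)

context
  fixes k :: real and z :: "real^'n"
begin

lemma Ck_radial_profile: "Ck m (\<lambda>x. complex_of_real (radial_profile k CARD('n) ((norm (x - z))\<^sup>2)))"
proof (rule Ck_radial[where G = "{\<lambda>s. \<Sum>m. a m * s ^ m | a. \<forall>y::real. summable (\<lambda>m. a m * y ^ m)}"])
  show "radial_profile k CARD('n) \<in> {\<lambda>s. \<Sum>m. a m * s ^ m | a. \<forall>y::real. summable (\<lambda>m. a m * y ^ m)}"
    unfolding radial_profile_def[abs_def] using summable_radial_coeff[of "CARD('n)" k] by auto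
next
  fix g assume "g \<in> {\<lambda>s. \<Sum>m. a m * s ^ m | a. \<forall>y::real. summable (\<lambda>m. a m * y ^ m)}"
  then obtain a where g: "g = (\<lambda>s. \<Sum>m. a m * s ^ m)" and a: "\<And>y::real. summable (\<lambda>m. a m * y ^ m)" by auto
  have "(g has_real_derivative (\<Sum>m. diffs a m * s ^ m)) (at s)" for s
    unfolding g by (rule termdiffs_strong_converges_everywhere[OF a])
  moreover have "summable (\<lambda>m. diffs a m * y ^ m)" for y
    by (rule termdiff_converges_all[OF a])
  ultimately show "\<exists>g'\<in>{\<lambda>s. \<Sum>m. a m * s ^ m | a. \<forall>y::real. summable (\<lambda>m. a m * y ^ m)}.
      \<forall>s. (g has_real_derivative g' s) (at s)"
    by (intro bexI[of _ "\<lambda>s. \<Sum>m. diffs a m * s ^ m"]) auto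
qed

text \<open>Off the diagonal this is a computation; on the diagonal the value is a limit, which exists because
  the right-hand side is continuous at \<open>z\<close>.\<close>

lemma Im_Phi_eq_radial_profile:
  assumes dim: "CARD('n) = 2 \<or> CARD('n) = 3" and k: "k > 0"
  shows "Im_Phi k x z = wave_factor k CARD('n) * radial_profile k CARD('n) ((norm (x - z))\<^sup>2)"
proof -
  have off: "Im (Phi k x z) = wave_factor k CARD('n) * radial_profile k CARD('n) ((norm (x - z))\<^sup>2)" if "x \<noteq> z" for x
  proof (cases "CARD('n) = 2")
    case True
    thus ?thesis by (simp add: wave_factor_def Phi_def hankel1_0_def bessel_J0_eq_radial_profile)
  next
    case False
    hence c3: "CARD('n) = 3" using dim by simp
    have "Im (exp (\<i> * of_real t) / of_real s) = sin t / s" for t s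
      by (simp add: Im_exp)
    hence "Im (Phi k x z) = sin (k * norm (x - z)) / (4 * pi * norm (x - z))"
      unfolding Phi_def using False by (simp only: if_False)
    thus ?thesis using that k c3
      by (simp add: spherical_bessel_j0_eq_radial_profile[symmetric] spherical_bessel_j0_def wave_factor_def)
  qed
  show ?thesis
  proof (cases "x = z")
    case True
    have "continuous_on UNIV (\<lambda>x. Re (complex_of_real (radial_profile k CARD('n) ((norm (x - z))\<^sup>2))))"
      by (intro continuous_on_Re Ck_imp_continuous_on[OF Ck_radial_profile])
    hence "continuous_on UNIV (\<lambda>x. wave_factor k CARD('n) * radial_profile k CARD('n) ((norm (x - z))\<^sup>2))"
      by (intro continuous_on_mult_left) simp
    hence "isCont (\<lambda>x. wave_factor k CARD('n) * radial_profile k CARD('n) ((norm (x - z))\<^sup>2)) z"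
      by (simp add: continuous_on_eq_continuous_at)
    hence "((\<lambda>x. wave_factor k CARD('n) * radial_profile k CARD('n) ((norm (x - z))\<^sup>2)) \<longlongrightarrow> wave_factor k CARD('n)) (at z)"
      by (simp add: isCont_def)
    hence "((\<lambda>x. Im (Phi k x z)) \<longlongrightarrow> wave_factor k CARD('n)) (at z)"
      by (rule Lim_transform_eventually) (auto simp: eventually_at_filter off)
    hence "Lim (at z) (\<lambda>x. Im (Phi k x z)) = wave_factor k CARD('n)" by (intro tendsto_Lim) auto
    thus ?thesis using True by (simp add: Im_Phi_def)
  qed (simp add: Im_Phi_def off)
qed

context
  assumes dim: "CARD('n) = 2 \<or> CARD('n) = 3" and k: "k > 0"
begin

lemma standing_wave_eq:
  "standing_wave k z = (\<lambda>x. of_real (wave_factor k CARD('n)) * of_real (radial_profile k CARD('n) ((norm (x - z))\<^sup>2)))"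
  by (auto simp: standing_wave_def Im_Phi_eq_radial_profile[OF dim k])

lemma Ck_standing_wave: "Ck m (standing_wave k z)"
  unfolding standing_wave_eq by (rule Ck_cmult[OF Ck_radial_profile])

lemma kernel_K_eq_grad: "kernel_K k y z = grad (standing_wave k z) y"
proof -
  let ?f = "\<lambda>x. complex_of_real (radial_profile k CARD('n) ((norm (x - z))\<^sup>2))"
  have d: "?f differentiable (at x)" for x using Ck_radial_profile[of "Suc 0"] by simp
  have "grad (\<lambda>x. complex_of_real (wave_factor k CARD('n)) * ?f x) y = wave_factor k CARD('n) *\<^sub>R grad ?f y"
  proof (rule vec_eq_iff[THEN iffD2, rule_format])
    fix i show "grad (\<lambda>x. complex_of_real (wave_factor k CARD('n)) * ?f x) y $ i = (wave_factor k CARD('n) *\<^sub>R grad ?f y) $ i"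
      using grad_mult[OF differentiable_const d, of "complex_of_real (wave_factor k CARD('n))" y i]
      by (simp only: grad_component[OF has_derivative_const] vector_scaleR_component)
         (simp add: scaleR_conv_of_real)
  qed
  moreover have "kernel_K k y z = wave_factor k CARD('n) *\<^sub>R grad ?f y"
    using dim by (auto simp: wave_factor_def kernel_K_def bessel_J0_eq_radial_profile spherical_bessel_j0_eq_radial_profile)
  ultimately show ?thesis unfolding standing_wave_eq by simp
qed

lemma grad_standing_wave:
  "grad (standing_wave k z) x $ i = of_real (wave_factor k CARD('n) * (2 * (x $ i - z $ i) * radial_profile' k CARD('n) ((norm (x - z))\<^sup>2)))"
proof -
  have "(standing_wave k z has_derivative (\<lambda>h. of_real (wave_factor k CARD('n) * (2 * ((x - z) \<bullet> h) * radial_profile' k CARD('n) ((norm (x - z))\<^sup>2))))) (at x)"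
    unfolding standing_wave_eq of_real_mult[symmetric]
    by (intro has_derivative_of_real has_derivative_mult_right has_derivative_radial has_real_derivative_radial_profile) simp
  from grad_component[OF this] show ?thesis by (simp add: inner_axis)
qed

text \<open>The trace of the Hessian of \<open>g (|x - z|\<^sup>2)\<close> is \<open>4 s g'' + 2 n g'\<close> at \<open>s = |x - z|\<^sup>2\<close>, so this is the
  ordinary differential equation of the profile.\<close>

lemma laplacian_standing_wave:
  "(\<Sum>i\<in>UNIV. grad (\<lambda>x. grad (standing_wave k z) x $ i) x $ i) = - (of_real k)\<^sup>2 * standing_wave k z x"
proof -
  let ?g = "radial_profile k CARD('n) ((norm (x - z))\<^sup>2)"
  let ?g' = "radial_profile' k CARD('n) ((norm (x - z))\<^sup>2)"
  let ?g'' = "radial_profile'' k CARD('n) ((norm (x - z))\<^sup>2)"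
  have "grad (\<lambda>x. grad (standing_wave k z) x $ i) x $ i
      = of_real (wave_factor k CARD('n) * (2 * ?g' + 4 * (x $ i - z $ i)\<^sup>2 * ?g''))" for i
  proof -
    have c: "((\<lambda>x. x $ i - z $ i) has_derivative (\<lambda>h. h $ i)) (at x)"
      by (auto intro!: derivative_eq_intros bounded_linear_imp_has_derivative bounded_linear_vec_nth)
    have "((\<lambda>x. grad (standing_wave k z) x $ i) has_derivative
      (\<lambda>h. of_real (wave_factor k CARD('n) * (2 * (((x $ i - z $ i) * (2 * ((x - z) \<bullet> h) * ?g'')) + h $ i * ?g'))))) (at x)"
      unfolding grad_standing_wave mult.assoc[of 2]
      by (intro has_derivative_of_real has_derivative_mult_right has_derivative_mult c
           has_derivative_radial[unfolded mult.assoc[of 2]] has_real_derivative_radial_profile') simp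
    from grad_component[OF this, of i] show ?thesis
      by (simp add: inner_axis power2_eq_square algebra_simps)
  qed
  hence "(\<Sum>i\<in>UNIV. grad (\<lambda>x. grad (standing_wave k z) x $ i) x $ i)
     = of_real (\<Sum>i\<in>UNIV. wave_factor k CARD('n) * (2 * ?g' + 4 * (x $ i - z $ i)\<^sup>2 * ?g''))" by simp
  also have "(\<Sum>i\<in>UNIV. wave_factor k CARD('n) * (2 * ?g' + 4 * (x $ i - z $ i)\<^sup>2 * ?g''))
     = wave_factor k CARD('n) * (4 * (\<Sum>i\<in>UNIV. (x $ i - z $ i)\<^sup>2) * ?g'' + 2 * real CARD('n) * ?g')"
    by (simp add: sum_distrib_left[symmetric] sum.distrib sum_distrib_right[symmetric] algebra_simps)
  also have "(\<Sum>i\<in>UNIV. (x $ i - z $ i)\<^sup>2) = (norm (x - z))\<^sup>2"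
    using power2_norm_eq_inner[of "x - z"] by (simp add: inner_vec_def power2_eq_square)
  also have "4 * (norm (x - z))\<^sup>2 * ?g'' + 2 * real CARD('n) * ?g' = - (k\<^sup>2) * ?g"
    using radial_profile_ode[of "CARD('n)" "(norm (x - z))\<^sup>2" k] by simp
  finally show ?thesis unfolding standing_wave_eq by simp
qed

lemma norm_grad_standing_wave:
  "norm (grad (standing_wave k z) x) = \<bar>wave_factor k CARD('n)\<bar> * \<bar>2 * norm (x - z) * radial_profile' k CARD('n) ((norm (x - z))\<^sup>2)\<bar>"
proof -
  let ?g' = "radial_profile' k CARD('n) ((norm (x - z))\<^sup>2)"
  let ?v = "(wave_factor k CARD('n) * 2 * ?g') *\<^sub>R (x - z)"
  have "norm (grad (standing_wave k z) x $ i) = norm (?v $ i)" for i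
    unfolding grad_standing_wave norm_of_real by (simp add: algebra_simps)
  hence "norm (grad (standing_wave k z) x) = norm ?v"
    unfolding norm_vec_def[of "grad (standing_wave k z) x"] norm_vec_def[of ?v] by simp
  thus ?thesis by (simp add: abs_mult)
qed

end
end

lemma kernel_K_decay:
  assumes dim: "CARD('n) = 2 \<or> CARD('n) = 3" and k: "k > 0"
  shows "\<exists>C\<ge>0. \<forall>y z::real^'n. norm (y - z) \<ge> 1 \<longrightarrow>
    norm (kernel_K k y z) \<le> C * norm (y - z) powr (- ((real CARD('n) - 1) / 2))"
proof -
  obtain C where C: "\<And>r. r \<ge> 1 \<Longrightarrow>
     \<bar>2 * r * radial_profile' k CARD('n) (r\<^sup>2)\<bar> \<le> C * r powr (- ((real CARD('n) - 1) / 2))"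
    using radial_profile_derivative_decay[OF dim k] by blast
  let ?c = "\<bar>wave_factor k CARD('n)\<bar>"
  have "0 \<le> C" using C[of 1] abs_ge_zero[of "2 * 1 * radial_profile' k CARD('n) (1\<^sup>2)"] by simp
  moreover have "norm (kernel_K k y z) \<le> ?c * C * norm (y - z) powr (- ((real CARD('n) - 1) / 2))"
    if "norm (y - z) \<ge> 1" for y z :: "real^'n"
    unfolding kernel_K_eq_grad[OF dim k] norm_grad_standing_wave[OF dim k] mult.assoc[of _ C]
    by (intro mult_left_mono C that) simp
  ultimately show ?thesis by (intro exI[of _ "?c * C"]) simp
qed

section \<open>Integration by parts and smoothed indicator functions\<close>

lemma integrable_lborel_shift:
  fixes f :: "'a::euclidean_space \<Rightarrow> 'b::{banach, second_countable_topology}"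
  assumes "integrable lborel f"
  shows "integrable lborel (\<lambda>x. f (x + c))"
proof -
  have "integrable (distr lborel borel ((+) c)) f" using assms by (simp add: lborel_distr_plus)
  thus ?thesis using assms by (subst (asm) integrable_distr_eq) (simp_all add: add.commute)
qed

lemma lborel_integral_shift:
  fixes f :: "'a::euclidean_space \<Rightarrow> 'b::{banach, second_countable_topology}"
  assumes "f \<in> borel_measurable borel"
  shows "(LINT x|lborel. f (x + c)) = (LINT x|lborel. f x)"
proof -
  have "(LINT x|distr lborel borel ((+) c). f x) = (LINT x|lborel. f (c + x))"
    by (rule integral_distr) (use assms in simp_all)
  thus ?thesis by (simp add: lborel_distr_plus add.commute)
qed

lemma continuous_compact_support_bounded:
  fixes f :: "'a::t2_space \<Rightarrow> 'b::real_normed_vector"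
  assumes "continuous_on UNIV f" "compact K" "\<And>x. x \<notin> K \<Longrightarrow> f x = 0"
  obtains B where "B \<ge> 0" "\<And>x. norm (f x) \<le> B"
proof -
  have "bounded (f ` K)"
    by (intro compact_imp_bounded compact_continuous_image continuous_on_subset[OF assms(1)] assms(2)) simp
  then obtain B where B: "\<And>x. x \<in> K \<Longrightarrow> norm (f x) \<le> B" by (auto simp: bounded_iff)
  have "norm (f x) \<le> max B 0" for x
    using B[of x] assms(3)[of x] by (cases "x \<in> K") auto
  thus ?thesis using that[of "max B 0"] by simp
qed

text \<open>Supplies the dominating functions for all difference quotients below.\<close>

lemma Ck_one_Lipschitz:
  fixes F :: "real^'n \<Rightarrow> complex"
  assumes "Ck 1 F" "compact (closure {x. F x \<noteq> 0})"
  obtains L where "L \<ge> 0" "\<And>x y. norm (F x - F y) \<le> L * norm (x - y)"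
    "\<And>x h. norm (frechet_derivative F (at x) h) \<le> L * norm h"
proof -
  have cont: "continuous_on UNIV (\<lambda>x. grad F x $ i)" for i using assms(1) unfolding Ck_one_iff by blast
  have diff: "F differentiable (at x)" for x using assms(1) unfolding Ck_one_iff by blast
  have "\<exists>B. B \<ge> 0 \<and> (\<forall>x. norm (grad F x $ i) \<le> B)" for i
  proof -
    have "grad F x $ i = 0" if "x \<notin> closure {x. F x \<noteq> 0}" for x
      using grad_eq_zero_outside_support[OF that] by simp
    from continuous_compact_support_bounded[OF cont assms(2) this]
    obtain B where "B \<ge> 0" "\<And>x. norm (grad F x $ i) \<le> B" by blast
    thus ?thesis by blast
  qed
  then obtain B where B: "\<And>i. B i \<ge> 0" "\<And>i x. norm (grad F x $ i) \<le> B i" by metis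
  let ?L = "\<Sum>i\<in>UNIV. B i"
  have D: "norm (frechet_derivative F (at x) h) \<le> ?L * norm h" for x h
  proof -
    have "norm (frechet_derivative F (at x) h) \<le> (\<Sum>i\<in>UNIV. norm (h $ i *\<^sub>R grad F x $ i))"
      unfolding frechet_derivative_eq_grad[OF diff] by (rule norm_sum)
    also have "\<dots> \<le> (\<Sum>i\<in>UNIV. norm h * B i)"
      unfolding norm_scaleR by (intro sum_mono mult_mono B) (use component_le_norm_cart in auto)
    finally show ?thesis by (simp add: sum_distrib_left mult.commute)
  qed
  have "norm (F x - F y) \<le> ?L * norm (x - y)" for x y
  proof (rule differentiable_bound[where S = UNIV and f' = "\<lambda>x. frechet_derivative F (at x)"])
    show "(F has_derivative frechet_derivative F (at x)) (at x within UNIV)" for x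
      using diff[of x] by (simp add: frechet_derivative_works)
    show "onorm (frechet_derivative F (at x)) \<le> ?L" for x
      by (rule onorm_le) (rule D)
  qed auto
  with D show ?thesis using that[of ?L] B(1) by (simp add: sum_nonneg)
qed

lemma directional_difference_quotient:
  assumes "F differentiable (at x)"
  shows "((\<lambda>t. (F (x + t *\<^sub>R v) - F x) /\<^sub>R t) \<longlongrightarrow> frechet_derivative F (at x) v) (at 0)"
proof -
  have F: "(F has_derivative frechet_derivative F (at x)) (at (x + 0 *\<^sub>R v))"
    using assms by (simp add: frechet_derivative_works)
  have l: "((\<lambda>t. x + t *\<^sub>R v) has_derivative (\<lambda>t. t *\<^sub>R v)) (at 0)"
    by (auto intro!: derivative_eq_intros)
  have lin: "linear (frechet_derivative F (at x))"
    using assms by (rule linear_frechet_derivative)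
  have "((\<lambda>t. F (x + t *\<^sub>R v)) has_derivative (\<lambda>t. t *\<^sub>R frechet_derivative F (at x) v)) (at 0)"
    using has_derivative_compose[OF l F] by (simp only: linear_scale[OF lin])
  hence d: "((\<lambda>h. norm (F (x + h *\<^sub>R v) - F x - h *\<^sub>R frechet_derivative F (at x) v) / \<bar>h\<bar>) \<longlongrightarrow> 0) (at 0)"
    by (simp add: has_derivative_at)
  have "((\<lambda>t. norm ((F (x + t *\<^sub>R v) - F x) /\<^sub>R t - frechet_derivative F (at x) v)) \<longlongrightarrow> 0) (at 0)"
  proof (rule Lim_transform_eventually[OF d])
    have "norm (F (x + h *\<^sub>R v) - F x - h *\<^sub>R frechet_derivative F (at x) v) / \<bar>h\<bar>
       = norm ((F (x + h *\<^sub>R v) - F x) /\<^sub>R h - frechet_derivative F (at x) v)" if "h \<noteq> 0" for h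
    proof -
      have "(F (x + h *\<^sub>R v) - F x) /\<^sub>R h - frechet_derivative F (at x) v
         = (F (x + h *\<^sub>R v) - F x - h *\<^sub>R frechet_derivative F (at x) v) /\<^sub>R h"
        using that by (simp add: scaleR_diff_right)
      thus ?thesis by (simp add: divide_inverse mult.commute)
    qed
    thus "\<forall>\<^sub>F h in at 0. norm (F (x + h *\<^sub>R v) - F x - h *\<^sub>R frechet_derivative F (at x) v) / \<bar>h\<bar>
       = norm ((F (x + h *\<^sub>R v) - F x) /\<^sub>R h - frechet_derivative F (at x) v)"
      by (simp add: eventually_at_filter)
  qed
  thus ?thesis by (simp only: tendsto_norm_zero_iff LIM_zero_iff)
qed

text \<open>Translation invariance makes the integral of every difference quotient vanish, and the difference
  quotients of a compactly supported \<open>C\<^sup>1\<close> function are dominated by its Lipschitz constant.\<close>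

lemma integral_grad_eq_0:
  fixes F :: "real^'n \<Rightarrow> complex"
  assumes F: "Ck 1 F" and K: "compact (closure {x. F x \<noteq> 0})"
  shows "(LINT x|lborel. grad F x $ i) = 0"
proof -
  let ?e = "axis i (1::real) :: real^'n"
  let ?h = "\<lambda>m. inverse (real (Suc m))"
  let ?q = "\<lambda>m x. (F (x + ?h m *\<^sub>R ?e) - F x) /\<^sub>R ?h m"
  obtain L where L: "L \<ge> 0" "\<And>x y. norm (F x - F y) \<le> L * norm (x - y)"
    by (rule Ck_one_Lipschitz[OF F K]) (rule that)
  obtain R where R: "\<And>x. F x \<noteq> 0 \<Longrightarrow> norm x \<le> R"
    using compact_imp_bounded[OF K] closure_subset[of "{x. F x \<noteq> 0}"] unfolding bounded_iff by blast
  have contF: "continuous_on UNIV F" using F by (rule Ck_imp_continuous_on)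
  hence measF: "F \<in> borel_measurable borel" by (rule borel_measurable_continuous_onI)
  have Fz: "F x = 0" if "x \<notin> closure {x. F x \<noteq> 0}" for x
    using that closure_subset[of "{x. F x \<noteq> 0}"] by blast
  have intF: "integrable lborel F"
    by (rule integrable_lborel_continuous_compact_support[OF contF K Fz])
  have quotient_bound: "norm ((F (x + h *\<^sub>R ?e) - F x) /\<^sub>R h) \<le> L * indicator (cball 0 (R + 1)) x"
    if h: "0 < h" "h \<le> 1" for h x
  proof (cases "norm x \<le> R + 1")
    case True
    have "norm (F (x + h *\<^sub>R ?e) - F x) \<le> L * h"
      using L(2)[of "x + h *\<^sub>R ?e" x] h by simp
    thus ?thesis using True h by (simp add: divide_inverse[symmetric] mult.commute[of "inverse h"] divide_le_eq)
  next
    case False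
    have "norm (x + h *\<^sub>R ?e) \<ge> norm x - h"
      using norm_diff_ineq[of x "h *\<^sub>R ?e"] h by simp
    hence "R < norm (x + h *\<^sub>R ?e)" "R < norm x" using False h by linarith+
    hence "F (x + h *\<^sub>R ?e) = 0" "F x = 0" using R by (meson not_le)+
    thus ?thesis using False by simp
  qed
  have lim: "(\<lambda>m. LINT x|lborel. ?q m x) \<longlonglongrightarrow> (LINT x|lborel. grad F x $ i)"
  proof (rule integral_dominated_convergence[where w = "\<lambda>x. L * indicator (cball 0 (R + 1)) x"])
    show "(\<lambda>x. grad F x $ i) \<in> borel_measurable lborel"
      using F unfolding Ck_one_iff by (simp add: borel_measurable_continuous_onI)
    show "?q m \<in> borel_measurable lborel" for m
      using measF by measurable
    show "integrable lborel (\<lambda>x::real^'n. L * indicator (cball 0 (R + 1)) x)"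
      by (intro integrable_mult_right integrable_real_indicator emeasure_lborel_cball_finite) auto
    show "AE x in lborel. (\<lambda>m. ?q m x) \<longlonglongrightarrow> grad F x $ i"
    proof (rule AE_I2)
      fix x
      have "((\<lambda>t. (F (x + t *\<^sub>R ?e) - F x) /\<^sub>R t) \<longlongrightarrow> grad F x $ i) (at 0)"
        using directional_difference_quotient[of F x ?e] F by (simp add: Ck_one_iff grad_def)
      moreover have "filterlim ?h (at 0) sequentially"
        using LIMSEQ_inverse_real_of_nat by (simp add: filterlim_at)
      ultimately show "(\<lambda>m. ?q m x) \<longlonglongrightarrow> grad F x $ i"
        by (rule filterlim_compose)
    qed
    show "AE x in lborel. norm (?q m x) \<le> L * indicator (cball 0 (R + 1)) x" for m
      by (intro AE_I2 quotient_bound) (auto simp: field_simps)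
  qed
  have "(LINT x|lborel. ?q m x) = 0" for m
    using integrable_lborel_shift[OF intF] intF lborel_integral_shift[OF measF] by simp
  with lim have "(\<lambda>m. 0) \<longlonglongrightarrow> (LINT x|lborel. grad F x $ i)" by simp
  thus ?thesis by (simp add: LIMSEQ_const_iff)
qed

lemma test_function_integrable:
  assumes "test_function f"
  shows "integrable lborel f"
proof (rule integrable_lborel_continuous_compact_support[OF Ck_imp_continuous_on[of 0] test_functionD(2)[OF assms]])
  show "Ck 0 f" by (rule test_functionD(1)[OF assms])
  show "f x = 0" if "x \<notin> closure {x. f x \<noteq> 0}" for x
    using that closure_subset[of "{x. f x \<noteq> 0}"] by blast
qed

text \<open>The convolution of \<open>f\<close> with the indicator function of \<open>S\<close>.\<close>

definition convolve :: "(real^'n) set \<Rightarrow> (real^'n \<Rightarrow> complex) \<Rightarrow> real^'n \<Rightarrow> complex" where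
  "convolve S f x = (LINT y:S|lborel. f (x - y))"

lemma set_integrable_translated:
  fixes f :: "real^'n \<Rightarrow> 'a::euclidean_space"
  assumes "bounded S" "S \<in> sets borel" "continuous_on UNIV f"
  shows "set_integrable lborel S (\<lambda>y. f (x - y))"
proof -
  obtain R where R: "S \<subseteq> cball 0 R" using bounded_subset_ballD[OF assms(1), of 0] ball_subset_cball by blast
  have "continuous_on (cball 0 R) (\<lambda>y. f (x - y))"
    by (intro continuous_on_compose2[OF assms(3)] continuous_intros) simp
  hence "set_integrable lborel (cball 0 R) (\<lambda>y. f (x - y))"
    unfolding set_integrable_def by (intro borel_integrable_compact) simp_all
  thus ?thesis by (rule set_integrable_subset) (use assms R in auto)
qed

text \<open>Differentiation under the integral sign: the remainder of the linear approximation of \<open>f\<close>, divided by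
  the length of the increment, tends to zero pointwise and is bounded by twice the Lipschitz constant,
  so dominated convergence applies on the bounded set \<open>S\<close>.\<close>

lemma has_derivative_convolve:
  fixes S :: "(real^'n) set"
  assumes S: "bounded S" "S \<in> sets borel" and f: "test_function f"
  shows "(convolve S f has_derivative (\<lambda>h. \<Sum>i\<in>UNIV. h $ i *\<^sub>R convolve S (\<lambda>x. grad f x $ i) x)) (at x)"
proof -
  let ?D = "\<lambda>h. \<Sum>i\<in>UNIV. h $ i *\<^sub>R convolve S (\<lambda>x. grad f x $ i) x"
  have Ck1: "Ck 1 f" and cont: "continuous_on UNIV f" and contg: "continuous_on UNIV (\<lambda>x. grad f x $ i)" for i
    using test_functionD(1)[OF f] test_functionD(1)[OF f, THEN Ck_imp_continuous_on]
      test_functionD(1)[OF test_function_grad[OF f], THEN Ck_imp_continuous_on] by blast+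
  have diff: "f differentiable (at y)" for y using Ck1 unfolding Ck_one_iff by blast
  obtain L where L: "L \<ge> 0" "\<And>x y. norm (f x - f y) \<le> L * norm (x - y)"
      "\<And>x h. norm (frechet_derivative f (at x) h) \<le> L * norm h"
    by (rule Ck_one_Lipschitz[OF Ck1 test_functionD(2)[OF f]]) (rule that)
  have intf: "set_integrable lborel S (\<lambda>y. f (x - y))" for x
    by (rule set_integrable_translated[OF S cont])
  have intg: "set_integrable lborel S (\<lambda>y. grad f (x - y) $ i)" for x i
    by (rule set_integrable_translated[OF S contg])
  let ?r = "\<lambda>h y. f (x + h - y) - f (x - y) - (\<Sum>i\<in>UNIV. h $ i *\<^sub>R grad f (x - y) $ i)"
  have swap: "indicator S y *\<^sub>R h $ i *\<^sub>R grad f (x - y) $ i = h $ i *\<^sub>R indicator S y *\<^sub>R grad f (x - y) $ i"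
    for y h i by (rule scaleR_left_commute)
  have D: "?D h = (LINT y:S|lborel. (\<Sum>i\<in>UNIV. h $ i *\<^sub>R grad f (x - y) $ i))" for h
    unfolding convolve_def set_lebesgue_integral_def scaleR_sum_right swap
    using intg[unfolded set_integrable_def] by (subst Bochner_Integration.integral_sum) (auto simp del: scaleR_scaleR)
  have intD: "set_integrable lborel S (\<lambda>y. \<Sum>i\<in>UNIV. h $ i *\<^sub>R grad f (x - y) $ i)" for h
    using intg[unfolded set_integrable_def] unfolding set_integrable_def scaleR_sum_right swap
    by (intro Bochner_Integration.integrable_sum) (simp del: scaleR_scaleR)
  have intr: "set_integrable lborel S (?r h)" for h
    by (intro set_integral_diff intf intD)
  have rem: "convolve S f (x + h) - convolve S f x - ?D h = (LINT y:S|lborel. ?r h y)" for h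
    unfolding D unfolding convolve_def
    using set_integral_diff[OF set_integral_diff(1)[OF intf[of "x + h"] intf[of x]] intD[of h]]
      set_integral_diff(2)[OF intf[of "x + h"] intf[of x]] by simp
  have rb: "norm (?r h y) \<le> 2 * L * norm h" for h y
  proof -
    have "norm (?r h y) \<le> norm (f (x + h - y) - f (x - y)) + norm (frechet_derivative f (at (x - y)) h)"
      unfolding frechet_derivative_eq_grad[OF diff] by (rule norm_triangle_ineq4)
    also have "\<dots> \<le> L * norm h + L * norm h"
      using L(2)[of "x + h - y" "x - y"] L(3) by (intro add_mono) (simp_all add: algebra_simps)
    finally show ?thesis by simp
  qed
  show ?thesis unfolding has_derivative_at
  proof (intro conjI)
    show "bounded_linear ?D"
      by (intro bounded_linear_sum bounded_linear_scaleR_const bounded_linear_vec_nth)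
    show "((\<lambda>h. norm (convolve S f (x + h) - convolve S f x - ?D h) / norm h) \<longlongrightarrow> 0) (at 0)"
      unfolding tendsto_at_iff_sequentially comp_def
    proof (intro allI impI)
      fix X :: "nat \<Rightarrow> real^'n" assume X: "\<forall>i. X i \<in> UNIV - {0}" and X0: "X \<longlonglongrightarrow> 0"
      have Xat: "filterlim X (at 0) sequentially"
        using X X0 by (simp add: filterlim_at)
      let ?s = "\<lambda>m y. indicator S y * (norm (?r (X m) y) / norm (X m))"
      have "(\<lambda>m. LINT y|lborel. ?s m y) \<longlonglongrightarrow> (LINT y|(lborel :: (real^'n) measure). (0::real))"
      proof (rule integral_dominated_convergence[where w = "\<lambda>y. 2 * L * indicator S y"])
        show "?s m \<in> borel_measurable lborel" for m
        proof -
          have "(\<lambda>y. norm (indicator S y *\<^sub>R ?r (X m) y) / norm (X m)) \<in> borel_measurable lborel"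
            using borel_measurable_integrable[OF intr[of "X m", unfolded set_integrable_def]] by measurable
          thus ?thesis by simp
        qed
        show "integrable lborel (\<lambda>y::real^'n. 2 * L * indicator S y)"
          by (intro integrable_mult_right integrable_real_indicator)
             (use S emeasure_bounded_finite in auto)
        show "AE y in lborel. (\<lambda>m. ?s m y) \<longlonglongrightarrow> 0"
        proof (rule AE_I2)
          fix y
          have "((\<lambda>h. norm (f ((x - y) + h) - f (x - y) - frechet_derivative f (at (x - y)) h) / norm h) \<longlongrightarrow> 0) (at 0)"
            using diff[of "x - y"] by (simp add: frechet_derivative_works has_derivative_at)
          from filterlim_compose[OF this Xat]
          have "(\<lambda>m. norm (?r (X m) y) / norm (X m)) \<longlonglongrightarrow> 0"
            by (simp add: frechet_derivative_eq_grad[OF diff] algebra_simps)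
          from tendsto_mult_right_zero[OF this] show "(\<lambda>m. ?s m y) \<longlonglongrightarrow> 0" .
        qed
        show "AE y in lborel. norm (?s m y) \<le> 2 * L * indicator S y" for m
          using rb[of "X m"] X by (intro AE_I2) (auto simp: indicator_def field_simps)
      qed simp
      hence lim: "(\<lambda>m. LINT y|lborel. ?s m y) \<longlonglongrightarrow> 0" by simp
      show "(\<lambda>m. norm (convolve S f (x + X m) - convolve S f x - ?D (X m)) / norm (X m)) \<longlonglongrightarrow> 0"
      proof (rule tendsto_sandwich[OF _ _ tendsto_const lim])
        have "norm (convolve S f (x + X m) - convolve S f x - ?D (X m)) / norm (X m) \<le> (LINT y|lborel. ?s m y)" for m
        proof -
          have "norm (LINT y:S|lborel. ?r (X m) y) \<le> (LINT y|lborel. norm (indicator S y *\<^sub>R ?r (X m) y))"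
            unfolding set_lebesgue_integral_def by (rule integral_norm_bound)
          also have "\<dots> = (LINT y|lborel. ?s m y * norm (X m))"
            using X by (intro Bochner_Integration.integral_cong) auto
          also have "\<dots> = (LINT y|lborel. ?s m y) * norm (X m)" by simp
          finally show ?thesis unfolding rem using X by (simp add: divide_le_eq)
        qed
        thus "\<forall>\<^sub>F m in sequentially. norm (convolve S f (x + X m) - convolve S f x - ?D (X m)) / norm (X m)
            \<le> (LINT y|lborel. ?s m y)" by simp
      qed simp
    qed
  qed
qed

text \<open>The partial derivatives of a convolution are convolutions with test functions again.\<close>

lemma Ck_convolve:
  assumes S: "bounded S" "S \<in> sets borel" and f: "test_function f"
  shows "Ck m (convolve S f)"
  using f
proof (induction m arbitrary: f)
  case 0
  have "convolve S f differentiable (at x)" for x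
    using has_derivative_convolve[OF S 0] unfolding differentiable_def by blast
  thus ?case by (auto simp: continuous_on_eq_continuous_at intro: differentiable_imp_continuous_within)
next
  case (Suc m)
  have "(\<Sum>j\<in>UNIV. axis i 1 $ j *\<^sub>R convolve S (\<lambda>x. grad f x $ j) x) = convolve S (\<lambda>x. grad f x $ i) x" for x i
    by (subst sum.remove[of _ i]) (auto simp: axis_def intro!: sum.neutral)
  thus ?case
    by (intro Ck_SucI[OF has_derivative_convolve[OF S Suc.prems]]) (simp add: Suc.IH test_function_grad Suc.prems)
qed

text \<open>Smooth, equal to 1 inside \<open>S\<close> and to 0 outside, except within distance \<open>\<epsilon>\<close> of the boundary.\<close>

definition smoothed_indicator :: "real \<Rightarrow> (real^'n) set \<Rightarrow> real^'n \<Rightarrow> complex" where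
  "smoothed_indicator \<epsilon> S = convolve S (\<lambda>x. of_real (mollifier \<epsilon> x))"

lemma test_function_mollifier:
  assumes "\<epsilon> > 0"
  shows "test_function (\<lambda>x::real^'n. complex_of_real (mollifier \<epsilon> x))"
proof -
  have "{x::real^'n. complex_of_real (mollifier \<epsilon> x) \<noteq> 0} \<subseteq> cball 0 \<epsilon>"
  proof
    fix x :: "real^'n" assume "x \<in> {x. complex_of_real (mollifier \<epsilon> x) \<noteq> 0}"
    thus "x \<in> cball 0 \<epsilon>" using mollifier_eq_0[OF assms, of x] by (cases "\<epsilon> \<le> norm x") auto
  qed
  hence "closure {x::real^'n. complex_of_real (mollifier \<epsilon> x) \<noteq> 0} \<subseteq> cball 0 \<epsilon>"
    by (simp add: closure_minimal)
  thus ?thesis unfolding test_function_def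
    using compact_Int_closed[OF compact_cball[of 0 \<epsilon>] closed_closure] Ck_mollifier by (metis inf.absorb2)
qed

lemma smoothed_indicator_eq_0:
  assumes "\<epsilon> > 0" "ball x \<epsilon> \<inter> S = {}"
  shows "smoothed_indicator \<epsilon> S x = 0"
proof -
  have z: "indicator S y *\<^sub>R complex_of_real (mollifier \<epsilon> (x - y)) = 0" for y
    using assms mollifier_eq_0[OF assms(1), of "x - y"]
    by (cases "y \<in> ball x \<epsilon>") (auto simp: dist_norm indicator_def)
  show ?thesis unfolding smoothed_indicator_def convolve_def set_lebesgue_integral_def z by simp
qed

lemma smoothed_indicator_eq_1:
  fixes S :: "(real^'n) set"
  assumes "\<epsilon> > 0" "ball x \<epsilon> \<subseteq> S"
  shows "smoothed_indicator \<epsilon> S x = 1"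
proof -
  have "indicator S y *\<^sub>R complex_of_real (mollifier \<epsilon> (x - y)) = complex_of_real (mollifier \<epsilon> (y + (- x)))" for y
  proof -
    have "mollifier \<epsilon> (x - y) = mollifier \<epsilon> (y - x)" using mollifier_minus[of \<epsilon> "x - y"] by simp
    thus ?thesis using assms mollifier_eq_0[OF assms(1), of "x - y"]
      by (cases "y \<in> ball x \<epsilon>") (auto simp: dist_norm indicator_def)
  qed
  hence "smoothed_indicator \<epsilon> S x = (LINT y|lborel. complex_of_real (mollifier \<epsilon> (y + (- x))))"
    by (simp add: smoothed_indicator_def convolve_def set_lebesgue_integral_def)
  also have "\<dots> = complex_of_real (LINT y|lborel. mollifier \<epsilon> (y + (- x)))"
    by (intro integral_of_real integrable_lborel_shift integrable_mollifier assms(1))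
  also have "(LINT y|lborel. mollifier \<epsilon> (y + (- x))) = (LINT y|lborel. mollifier \<epsilon> (y :: real^'n))"
    by (rule lborel_integral_shift[OF borel_measurable_continuous_onI[OF continuous_on_mollifier]])
  finally show ?thesis unfolding integral_mollifier[OF assms(1)] by simp
qed

lemma test_function_smoothed_indicator:
  assumes "\<epsilon> > 0" "bounded S" "S \<in> sets borel"
  shows "test_function (smoothed_indicator \<epsilon> S)"
proof -
  obtain R where R: "S \<subseteq> cball 0 R" using bounded_subset_ballD[OF assms(2), of 0] ball_subset_cball by blast
  have "x \<in> cball 0 (R + \<epsilon>)" if "smoothed_indicator \<epsilon> S x \<noteq> 0" for x
  proof -
    have "ball x \<epsilon> \<inter> S \<noteq> {}" using smoothed_indicator_eq_0[OF assms(1), of x S] that by argo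
    then obtain y where "y \<in> ball x \<epsilon>" "y \<in> S" by auto
    hence "norm y \<le> R" "norm (x - y) < \<epsilon>" using R by (auto simp: dist_norm)
    thus ?thesis using norm_triangle_ineq2[of x y] by simp
  qed
  hence "closure {x. smoothed_indicator \<epsilon> S x \<noteq> 0} \<subseteq> cball 0 (R + \<epsilon>)"
    by (intro closure_minimal) auto
  hence "compact (closure {x. smoothed_indicator \<epsilon> S x \<noteq> 0})"
    using compact_Int_closed[OF compact_cball[of 0 "R + \<epsilon>"] closed_closure] by (metis inf.absorb2)
  thus ?thesis unfolding test_function_def
    using Ck_convolve[OF assms(2,3) test_function_mollifier[OF assms(1)]] by (simp add: smoothed_indicator_def)
qed

section \<open>Boundary charts and outward normals\<close>

lemma tendsto_zeroI_eps:
  fixes f :: "'a \<Rightarrow> real"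
  assumes "\<And>\<epsilon>. \<epsilon> > 0 \<Longrightarrow> \<forall>\<^sub>F x in F. \<bar>f x\<bar> \<le> \<epsilon>"
  shows "(f \<longlongrightarrow> 0) F"
proof (rule tendstoI)
  fix \<epsilon> :: real assume "\<epsilon> > 0"
  hence "\<forall>\<^sub>F x in F. \<bar>f x\<bar> \<le> \<epsilon> / 2" by (intro assms) simp
  thus "\<forall>\<^sub>F x in F. dist (f x) 0 < \<epsilon>"
    by eventually_elim (use \<open>\<epsilon> > 0\<close> in simp)
qed

text \<open>The difference of the two indicators is \<open>-1\<close> between \<open>b\<close> and \<open>a m\<close> (or \<open>+1\<close>, in the other order), so the
  integral is approximately \<open>- \<psi> b (a m - b)\<close>.  This one-dimensional fact is the core of the Gauss-Green
  formula: \<open>b\<close> and \<open>a m\<close> will be the heights of a boundary graph and of its translate.\<close>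

lemma interval_average_tendsto:
  fixes \<psi> :: "real \<Rightarrow> real"
  assumes cont: "continuous_on UNIV \<psi>" and bdd: "\<And>t. \<bar>\<psi> t\<bar> \<le> B"
    and h: "\<And>m. h m > 0" and h0: "h \<longlonglongrightarrow> 0" and lim: "(\<lambda>m. (a m - b) / h m) \<longlonglongrightarrow> \<beta>"
  shows "(\<lambda>m. (LINT t|lborel. \<psi> t * (indicator {a m<..} t - indicator {b<..} t)) / h m) \<longlonglongrightarrow> - \<psi> b * \<beta>"
    and "\<bar>LINT t|lborel. \<psi> t * (indicator {a m<..} t - indicator {b<..} t)\<bar> \<le> B * \<bar>a m - b\<bar>"
proof -
  let ?w = "\<lambda>c t. indicator {c<..} t - indicator {b<..} t :: real"
  have w: "?w c t = indicator {c<..b} t - indicator {b<..c} t" for c t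
    by (auto simp: indicator_def)
  have absw: "\<bar>?w c t\<bar> = indicator {min c b<..max c b} t" for c t
    by (auto simp: indicator_def)
  have fin: "emeasure lborel {c<..d::real} < \<infinity>" for c d by (cases "c \<le> d") auto
  have intw: "integrable lborel (?w c)" for c
    unfolding w by (intro Bochner_Integration.integrable_diff integrable_real_indicator)
      (use fin in auto)
  have intw': "integrable lborel (\<lambda>t. \<bar>?w c t\<bar>)" for c
    unfolding absw by (intro integrable_real_indicator) (use fin in auto)
  have intI: "integrable lborel (indicator {c<..d::real} :: real \<Rightarrow> real)" for c d
    by (intro integrable_real_indicator fin) simp
  have int0: "(LINT t|lborel. ?w c t) = b - c" for c
  proof -
    have "(LINT t|lborel. ?w c t) = measure lborel {c<..b} - measure lborel {b<..c}"
      unfolding w by (subst Bochner_Integration.integral_diff) (auto intro: intI)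
    thus ?thesis by (cases "c \<le> b") auto
  qed
  have int1: "(LINT t|lborel. \<bar>?w c t\<bar>) = \<bar>c - b\<bar>" for c
    unfolding absw by simp
  have meas: "\<psi> \<in> borel_measurable borel" using cont by (rule borel_measurable_continuous_onI)
  have intp: "integrable lborel (\<lambda>t. \<psi> t * ?w c t)" for c
  proof (rule Bochner_Integration.integrable_bound[where f = "\<lambda>t. B * \<bar>?w c t\<bar>"])
    show "integrable lborel (\<lambda>t. B * \<bar>?w c t\<bar>)" using intw' by simp
    show "(\<lambda>t. \<psi> t * ?w c t) \<in> borel_measurable lborel" using meas by measurable
    show "AE t in lborel. norm (\<psi> t * ?w c t) \<le> norm (B * \<bar>?w c t\<bar>)"
      using bdd by (intro AE_I2) (simp add: abs_mult, meson abs_ge_self abs_ge_zero mult_right_mono order_trans)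
  qed
  have est: "\<bar>LINT t|lborel. f t * ?w c t\<bar> \<le> C * \<bar>c - b\<bar>"
    if f: "integrable lborel (\<lambda>t. f t * ?w c t)" and C: "\<And>t. min c b \<le> t \<Longrightarrow> t \<le> max c b \<Longrightarrow> \<bar>f t\<bar> \<le> C" for f :: "real \<Rightarrow> real" and c C
  proof -
    have "\<bar>LINT t|lborel. f t * ?w c t\<bar> \<le> (LINT t|lborel. \<bar>f t * ?w c t\<bar>)"
      using integral_norm_bound[of lborel "\<lambda>t. f t * ?w c t"] by simp
    also have "\<dots> \<le> (LINT t|lborel. C * \<bar>?w c t\<bar>)"
    proof (rule integral_mono)
      show "integrable lborel (\<lambda>t. \<bar>f t * ?w c t\<bar>)" using f by (rule integrable_abs)
      show "integrable lborel (\<lambda>t. C * \<bar>?w c t\<bar>)" using intw' by simp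
      show "\<bar>f t * ?w c t\<bar> \<le> C * \<bar>?w c t\<bar>" for t
        using C[of t] unfolding abs_mult absw by (auto simp: indicator_def)
    qed
    finally show ?thesis using int1 by simp
  qed
  show "\<bar>LINT t|lborel. \<psi> t * ?w (a m) t\<bar> \<le> B * \<bar>a m - b\<bar>"
    by (rule est[OF intp bdd])
  have "(\<lambda>m. (a m - b) / h m * h m) \<longlonglongrightarrow> \<beta> * 0" by (intro tendsto_mult lim h0)
  moreover have "(a m - b) / h m * h m = a m - b" for m using h[of m] by simp
  ultimately have ab: "(\<lambda>m. a m - b) \<longlonglongrightarrow> 0" by simp
  let ?r = "\<lambda>m. (LINT t|lborel. (\<psi> t - \<psi> b) * ?w (a m) t) / h m"
  have "?r \<longlonglongrightarrow> 0"
  proof (rule tendsto_zeroI_eps)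
    fix \<epsilon> :: real assume \<epsilon>: "\<epsilon> > 0"
    \<comment> \<open>\<open>K\<close> eventually exceeds the modulus of the quotient whose limit is \<open>\<beta>\<close>; the summand 1 keeps it positive when \<open>\<beta> = 0\<close>.\<close>
    define K where "K = \<bar>\<beta>\<bar> + 1"
    have K: "K > 0" by (simp add: K_def)
    have "isCont \<psi> b" using cont by (simp add: continuous_on_eq_continuous_at)
    then obtain \<delta> where \<delta>: "\<delta> > 0" "\<And>t. \<bar>t - b\<bar> < \<delta> \<Longrightarrow> \<bar>\<psi> t - \<psi> b\<bar> < \<epsilon> / K"
      using \<epsilon> K unfolding continuous_at_eps_delta dist_real_def by (metis divide_pos_pos)
    have "\<forall>\<^sub>F m in sequentially. \<bar>a m - b\<bar> < \<delta>"
      using tendstoD[OF ab \<delta>(1)] by simp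
    moreover have "\<forall>\<^sub>F m in sequentially. \<bar>(a m - b) / h m\<bar> < K"
      using order_tendstoD(2)[OF tendsto_rabs[OF lim], of K] by (simp add: K_def)
    ultimately show "\<forall>\<^sub>F m in sequentially. \<bar>?r m\<bar> \<le> \<epsilon>"
    proof eventually_elim
      case (elim m)
      have *: "\<bar>LINT t|lborel. (\<psi> t - \<psi> b) * ?w (a m) t\<bar> \<le> \<epsilon> / K * \<bar>a m - b\<bar>"
      proof (rule est)
        show "integrable lborel (\<lambda>t. (\<psi> t - \<psi> b) * ?w (a m) t)"
          unfolding left_diff_distrib using intp intw by (intro Bochner_Integration.integrable_diff) auto
        show "\<bar>\<psi> t - \<psi> b\<bar> \<le> \<epsilon> / K" if "min (a m) b \<le> t" "t \<le> max (a m) b" for t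
          using \<delta>(2)[of t] elim(1) that by linarith
      qed
      have "\<bar>?r m\<bar> \<le> \<epsilon> / K * \<bar>(a m - b) / h m\<bar>"
        using divide_right_mono[OF *, of "h m"] h[of m] by simp
      also have "\<dots> \<le> \<epsilon> / K * K" using elim(2) \<epsilon> K by (intro mult_left_mono) auto
      finally show ?case using K by simp
    qed
  qed
  hence "(\<lambda>m. ?r m + \<psi> b * (- ((a m - b) / h m))) \<longlonglongrightarrow> 0 + \<psi> b * (- \<beta>)"
    by (intro tendsto_intros lim)
  moreover have "?r m + \<psi> b * (- ((a m - b) / h m)) = (LINT t|lborel. \<psi> t * ?w (a m) t) / h m" for m
  proof -
    have "(LINT t|lborel. (\<psi> t - \<psi> b) * ?w (a m) t) = (LINT t|lborel. \<psi> t * ?w (a m) t) - \<psi> b * (b - a m)"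
      unfolding left_diff_distrib[of "\<psi> _"] int0[symmetric] using intp intw
      by (subst Bochner_Integration.integral_diff) (auto simp del: integral_diff)
    moreover have "X / H + c * (- ((a m - b) / H)) = Y / H" if "X = Y - c * (b - a m)" for X Y c H :: real
      unfolding that by (simp add: diff_divide_distrib right_diff_distrib)
    ultimately show ?thesis by blast
  qed
  ultimately show "(\<lambda>m. (LINT t|lborel. \<psi> t * ?w (a m) t) / h m) \<longlonglongrightarrow> - \<psi> b * \<beta>" by simp
qed

text \<open>An integral over the hyperplane orthogonal to \<open>e\<close> is the integral over this slab of a function
  that does not depend on the coordinate \<open>x \<bullet> e\<close>.\<close>

abbreviation slab :: "real^'n \<Rightarrow> (real^'n) set" where
  "slab e \<equiv> {x. 0 \<le> x \<bullet> e \<and> x \<bullet> e \<le> 1}"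

lemma slab_borel [measurable]: "slab e \<in> sets borel"
proof -
  have "closed (slab e)" by (intro closed_Collect_conj closed_Collect_le continuous_intros)
  thus ?thesis by simp
qed

text \<open>Fubini's theorem along \<open>e\<close> without rotating coordinates: after translating by \<open>t e\<close> and exchanging the
  integrals, every point \<open>x\<close> is counted with weight \<open>\<integral> 1\<^bsub>slab\<^esub> (x - t e) dt = 1\<close>.\<close>

lemma lborel_eq_slab_times_line:
  fixes e :: "real^'n"
  assumes e: "norm e = 1"
  shows "distr (density (lborel \<Otimes>\<^sub>M lborel) (\<lambda>(x, t). indicator (slab e) x)) borel (\<lambda>(x, t). x + t *\<^sub>R e)
    = (lborel :: (real^'n) measure)" (is "distr ?P borel ?T = _")
proof (rule measure_eqI)
  fix A assume "A \<in> sets (distr ?P borel ?T)"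
  hence A[measurable]: "A \<in> sets borel" by simp
  have "emeasure (distr ?P borel ?T) A = (\<integral>\<^sup>+x. indicator A x \<partial>distr ?P borel ?T)" by simp
  also have "\<dots> = (\<integral>\<^sup>+p. indicator A (?T p) \<partial>?P)"
    by (rule nn_integral_distr) measurable
  also have "\<dots> = (\<integral>\<^sup>+p. (case p of (x, t) \<Rightarrow> indicator (slab e) x * indicator A (x + t *\<^sub>R e)) \<partial>(lborel \<Otimes>\<^sub>M lborel))"
    by (subst nn_integral_density) (auto intro!: nn_integral_cong simp: split_beta')
  also have "\<dots> = (\<integral>\<^sup>+t. \<integral>\<^sup>+x. indicator (slab e) x * indicator A (x + t *\<^sub>R e) \<partial>lborel \<partial>lborel)"
    by (subst lborel_pair.nn_integral_snd[symmetric]) auto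
  also have "\<dots> = (\<integral>\<^sup>+t. \<integral>\<^sup>+x. indicator (slab e) (x - t *\<^sub>R e) * indicator A x \<partial>lborel \<partial>lborel)"
  proof (rule nn_integral_cong)
    fix t :: real
    have "(\<integral>\<^sup>+x. indicator (slab e) (x - t *\<^sub>R e) * indicator A x \<partial>distr lborel borel ((+) (t *\<^sub>R e)))
       = (\<integral>\<^sup>+x. indicator (slab e) (t *\<^sub>R e + x - t *\<^sub>R e) * indicator A (t *\<^sub>R e + x) \<partial>lborel)"
      by (rule nn_integral_distr) auto
    thus "(\<integral>\<^sup>+x. indicator (slab e) x * indicator A (x + t *\<^sub>R e) \<partial>lborel)
       = (\<integral>\<^sup>+x. indicator (slab e) (x - t *\<^sub>R e) * indicator A x \<partial>lborel)"
      by (simp add: lborel_distr_plus add.commute)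
  qed
  also have "\<dots> = (\<integral>\<^sup>+x. \<integral>\<^sup>+t. indicator (slab e) (x - t *\<^sub>R e) * indicator A x \<partial>lborel \<partial>lborel)"
    by (rule lborel_pair.Fubini') (auto simp: split_beta')
  also have "\<dots> = (\<integral>\<^sup>+x. indicator A x \<partial>lborel)"
  proof (rule nn_integral_cong)
    fix x :: "real^'n"
    have "e \<bullet> e = 1" using e by (simp add: norm_eq_1)
    hence "indicator (slab e) (x - t *\<^sub>R e) * indicator A x = indicator A x * (indicator {x \<bullet> e - 1..x \<bullet> e} t :: ennreal)" for t
      by (auto simp: indicator_def inner_diff_left)
    thus "(\<integral>\<^sup>+t. indicator (slab e) (x - t *\<^sub>R e) * indicator A x \<partial>lborel) = indicator A x"
      by (simp add: nn_integral_cmult)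
  qed
  finally show "emeasure (distr ?P borel ?T) A = emeasure lborel A" by simp
qed simp

lemma
  fixes f :: "real^'n \<Rightarrow> real"
  assumes e: "norm e = 1" and f: "integrable lborel f"
  shows integral_slab_times_line:
      "(LINT x|lborel. f x) = (LINT x|lborel. indicator (slab e) x * (LINT t|lborel. f (x + t *\<^sub>R e)))"
    and integrable_slab_times_line:
      "integrable lborel (\<lambda>x. indicator (slab e) x * (LINT t|lborel. f (x + t *\<^sub>R e)))"
proof -
  let ?g = "\<lambda>(x, t). indicator (slab e) x * f (x + t *\<^sub>R e)"
  let ?P = "density (lborel \<Otimes>\<^sub>M lborel) (\<lambda>(x, t). ennreal (indicator (slab e) x))"
  have [measurable]: "f \<in> borel_measurable borel" using f by auto
  have eq: "distr ?P borel (\<lambda>(x, t). x + t *\<^sub>R e) = lborel"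
    using lborel_eq_slab_times_line[OF e] by (simp add: ennreal_indicator)
  have "integrable (distr ?P borel (\<lambda>(x, t). x + t *\<^sub>R e)) f" unfolding eq by (rule f)
  hence "integrable ?P (\<lambda>p. f (case p of (x, t) \<Rightarrow> x + t *\<^sub>R e))"
    by (subst (asm) integrable_distr_eq) auto
  hence int: "integrable (lborel \<Otimes>\<^sub>M lborel) ?g"
    unfolding split_beta' by (subst (asm) integrable_density) (auto simp: split_beta')
  have "(LINT x|lborel. f x) = (LINT x|distr ?P borel (\<lambda>(x, t). x + t *\<^sub>R e). f x)" unfolding eq ..
  also have "\<dots> = (LINT p|?P. f (case p of (x, t) \<Rightarrow> x + t *\<^sub>R e))"
    by (rule integral_distr) auto
  also have "\<dots> = (LINT p|(lborel \<Otimes>\<^sub>M lborel). ?g p)"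
    unfolding split_beta' by (subst integral_density) (auto simp: split_beta')
  also have "\<dots> = (LINT x|lborel. LINT t|lborel. indicator (slab e) x * f (x + t *\<^sub>R e))"
    using lborel_pair.integral_fst'[OF int] by simp
  finally show "(LINT x|lborel. f x) = (LINT x|lborel. indicator (slab e) x * (LINT t|lborel. f (x + t *\<^sub>R e)))"
    by simp
  show "integrable lborel (\<lambda>x. indicator (slab e) x * (LINT t|lborel. f (x + t *\<^sub>R e)))"
    using lborel_pair.integrable_fst'[OF int] by simp
qed

text \<open>If \<open>v \<noteq> w\<close>, then the direction \<open>v - w\<close> makes an acute angle with \<open>v\<close> and an obtuse one with \<open>w\<close>, so a short
  step along it would have to leave \<open>S\<close> and to stay in \<open>S\<close>.\<close>

lemma is_outward_normal_unique:
  assumes "is_outward_normal S x v" "is_outward_normal S x w"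
  shows "v = w"
proof (rule ccontr)
  assume "v \<noteq> w"
  have nv: "norm v = 1" "norm w = 1" using assms by (auto simp: is_outward_normal_def)
  hence vv: "v \<bullet> v = 1" "w \<bullet> w = 1" by (auto simp: norm_eq_1)
  define y where "y = v - w"
  define \<epsilon> where "\<epsilon> = norm y / 4"
  have ny: "norm y > 0" using \<open>v \<noteq> w\<close> by (simp add: y_def)
  have yy: "(norm y)\<^sup>2 = 2 - 2 * (v \<bullet> w)" unfolding y_def power2_norm_eq_inner
    by (simp add: inner_diff vv inner_commute)
  have yv: "y \<bullet> v = (norm y)\<^sup>2 / 2" and yw: "y \<bullet> w = - (norm y)\<^sup>2 / 2"
    unfolding yy by (simp_all add: y_def inner_diff vv inner_commute)
  obtain \<delta> where \<delta>: "\<delta> > 0" "\<And>z. z \<in> ball x \<delta> \<Longrightarrow> (z - x) \<bullet> v > \<epsilon> * norm (z - x) \<Longrightarrow> z \<notin> S"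
    using assms(1) ny unfolding is_outward_normal_def \<epsilon>_def by (metis divide_pos_pos zero_less_numeral)
  obtain \<delta>' where \<delta>': "\<delta>' > 0" "\<And>z. z \<in> ball x \<delta>' \<Longrightarrow> (z - x) \<bullet> w < - \<epsilon> * norm (z - x) \<Longrightarrow> z \<in> S"
    using assms(2) ny unfolding is_outward_normal_def \<epsilon>_def by (metis divide_pos_pos zero_less_numeral)
  define t where "t = min \<delta> \<delta>' / (2 * norm y)"
  have t: "t > 0" using \<delta> \<delta>' ny by (simp add: t_def)
  have tn: "norm (t *\<^sub>R y) < \<delta>" "norm (t *\<^sub>R y) < \<delta>'" using t ny \<delta> \<delta>' by (auto simp: t_def)
  let ?z = "x + t *\<^sub>R y"
  have "?z \<in> ball x \<delta>" "?z \<in> ball x \<delta>'" using tn by (auto simp: dist_norm)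
  moreover have "(?z - x) \<bullet> v > \<epsilon> * norm (?z - x)"
  proof -
    have "(?z - x) \<bullet> v = t * (norm y)\<^sup>2 / 2" by (simp add: yv)
    moreover have "\<epsilon> * norm (?z - x) = t * (norm y)\<^sup>2 / 4" using t by (simp add: \<epsilon>_def power2_eq_square)
    moreover have "t * (norm y)\<^sup>2 > 0" using t ny by simp
    ultimately show ?thesis by linarith
  qed
  moreover have "(?z - x) \<bullet> w < - \<epsilon> * norm (?z - x)"
  proof -
    have "(?z - x) \<bullet> w = - (t * (norm y)\<^sup>2 / 2)" by (simp add: yw)
    moreover have "- \<epsilon> * norm (?z - x) = - (t * (norm y)\<^sup>2 / 4)" using t by (simp add: \<epsilon>_def power2_eq_square)
    moreover have "t * (norm y)\<^sup>2 > 0" using t ny by simp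
    ultimately show ?thesis by linarith
  qed
  ultimately show False using \<delta>(2)[of ?z] \<delta>'(2)[of ?z] by metis
qed

lemma outward_normal_eqI: "is_outward_normal S x v \<Longrightarrow> outward_normal S x = v"
  unfolding outward_normal_def by (rule the_equality) (auto intro: is_outward_normal_unique)

lemma local_graph_mem:
  assumes "local_graph S x0 r e \<gamma>" "y \<in> ball x0 r"
  shows "y \<in> S \<longleftrightarrow> \<gamma> y < y \<bullet> e"
proof -
  have "S \<inter> ball x0 r = {x \<in> ball x0 r. \<gamma> x < x \<bullet> e}" using assms(1) by (simp add: local_graph_def)
  hence "y \<in> S \<inter> ball x0 r \<longleftrightarrow> y \<in> {x \<in> ball x0 r. \<gamma> x < x \<bullet> e}" by (rule arg_cong)
  thus ?thesis using assms(2) by simp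
qed

text \<open>Moving along \<open>e\<close> does not change \<open>\<gamma>\<close>, so a point of the graph is approached from above by points of
  \<open>S\<close>; points strictly below the graph have a neighbourhood outside \<open>S\<close>.\<close>

lemma local_graph_frontier:
  assumes chart: "local_graph S x0 r e \<gamma>" and S: "open S" and cont: "continuous_on UNIV \<gamma>" and x: "x \<in> ball x0 r"
  shows "x \<in> frontier S \<longleftrightarrow> \<gamma> x = x \<bullet> e"
proof -
  have e: "norm e = 1" and inv: "\<And>x t. \<gamma> (x + t *\<^sub>R e) = \<gamma> x" using chart by (auto simp: local_graph_def)
  have mem: "y \<in> S \<longleftrightarrow> \<gamma> y < y \<bullet> e" if "y \<in> ball x0 r" for y by (rule local_graph_mem[OF chart that])
  have fr: "x \<in> frontier S \<longleftrightarrow> x \<in> closure S \<and> x \<notin> S" using S by (simp add: frontier_def interior_open)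
  show ?thesis
  proof
    assume "x \<in> frontier S"
    hence "x \<in> closure S" "x \<notin> S" using fr by auto
    have "open ({y. y \<bullet> e < \<gamma> y} \<inter> ball x0 r)"
      by (intro open_Int open_Collect_less continuous_intros cont) simp
    moreover have "({y. y \<bullet> e < \<gamma> y} \<inter> ball x0 r) \<inter> S = {}" using mem by force
    ultimately have "({y. y \<bullet> e < \<gamma> y} \<inter> ball x0 r) \<inter> closure S = {}" by (simp add: open_Int_closure_eq_empty)
    hence "\<not> x \<bullet> e < \<gamma> x" using x \<open>x \<in> closure S\<close> by auto
    moreover have "\<not> \<gamma> x < x \<bullet> e" using mem[OF x] \<open>x \<notin> S\<close> by simp
    ultimately show "\<gamma> x = x \<bullet> e" by simp
  next
    assume g: "\<gamma> x = x \<bullet> e"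
    hence "x \<notin> S" using mem[OF x] by simp
    moreover have "x \<in> closure S"
    proof -
      have "\<exists>y\<in>S. dist y x < \<epsilon>" if "\<epsilon> > 0" for \<epsilon>
      proof -
        define t where "t = min \<epsilon> (r - dist x0 x) / 2"
        have t: "t > 0" "t < \<epsilon>" "t < r - dist x0 x" using that x by (auto simp: t_def)
        have "dist x (x + t *\<^sub>R e) = t" using t e by (simp add: dist_norm)
        hence "x + t *\<^sub>R e \<in> ball x0 r" using t dist_triangle[of x0 "x + t *\<^sub>R e" x] by simp
        moreover have "\<gamma> (x + t *\<^sub>R e) < (x + t *\<^sub>R e) \<bullet> e"
          using e t by (simp add: inv g inner_add_left norm_eq_1)
        ultimately have "x + t *\<^sub>R e \<in> S" using mem by simp
        moreover have "dist (x + t *\<^sub>R e) x < \<epsilon>" using e t by (simp add: dist_norm)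
        ultimately show ?thesis by blast
      qed
      thus ?thesis by (simp add: closure_approachable)
    qed
    ultimately show "x \<in> frontier S" using fr by simp
  qed
qed

lemma C1_on_UNIV_continuous:
  assumes "C1_on UNIV \<gamma>"
  shows "continuous_on UNIV \<gamma>"
  using assms by (auto simp: C1_on_def continuous_on_eq_continuous_at intro: differentiable_imp_continuous_within)

lemma frechet_derivative_eq_inner_grad:
  fixes \<gamma> :: "real^'n \<Rightarrow> real"
  assumes "\<gamma> differentiable (at x)"
  shows "frechet_derivative \<gamma> (at x) v = grad \<gamma> x \<bullet> v"
  unfolding frechet_derivative_eq_grad[OF assms] by (simp add: inner_vec_def mult.commute)

text \<open>The outward unit normal of \<open>{x. \<gamma> x < x \<bullet> e}\<close>; since \<open>\<gamma>\<close> does not vary along \<open>e\<close>, its gradient is orthogonal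
  to \<open>e\<close>, which explains the normalising factor.\<close>

definition graph_normal :: "real^'n \<Rightarrow> (real^'n \<Rightarrow> real) \<Rightarrow> real^'n \<Rightarrow> real^'n" where
  "graph_normal e \<gamma> x = (grad \<gamma> x - e) /\<^sub>R sqrt (1 + (norm (grad \<gamma> x))\<^sup>2)"

text \<open>Both facts express that \<open>\<gamma>\<close> is constant along \<open>e\<close>.\<close>

lemma chart_grad:
  fixes \<gamma> :: "real^'n \<Rightarrow> real"
  assumes inv: "\<And>x t. \<gamma> (x + t *\<^sub>R e) = \<gamma> x" and d: "\<And>x. \<gamma> differentiable (at x)"
  shows "grad \<gamma> x \<bullet> e = 0" and "grad \<gamma> (x + t *\<^sub>R e) = grad \<gamma> x"
proof -
  have "((\<lambda>t. (\<gamma> (x + t *\<^sub>R e) - \<gamma> x) /\<^sub>R t) \<longlongrightarrow> grad \<gamma> x \<bullet> e) (at 0)"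
    using directional_difference_quotient[OF d] by (simp only: frechet_derivative_eq_inner_grad[OF d])
  hence "((\<lambda>t::real. 0) \<longlongrightarrow> grad \<gamma> x \<bullet> e) (at 0)" by (simp add: inv)
  thus "grad \<gamma> x \<bullet> e = 0" using tendsto_unique[OF _ _ tendsto_const] by (metis at_neq_bot)
  have "((\<lambda>y. \<gamma> (y + t *\<^sub>R e)) has_derivative frechet_derivative \<gamma> (at (x + t *\<^sub>R e))) (at x)"
    by (rule has_derivative_compose[where f = "\<lambda>y. y + t *\<^sub>R e" and f' = "\<lambda>h. h", unfolded o_def])
       (auto intro!: derivative_eq_intros d[unfolded frechet_derivative_works])
  hence "(\<gamma> has_derivative frechet_derivative \<gamma> (at (x + t *\<^sub>R e))) (at x)" by (simp add: inv)
  hence "grad \<gamma> x $ i = grad \<gamma> (x + t *\<^sub>R e) $ i" for i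
    by (simp add: grad_component) (simp add: grad_def)
  thus "grad \<gamma> (x + t *\<^sub>R e) = grad \<gamma> x" by (simp add: vec_eq_iff)
qed

text \<open>Membership in \<open>S\<close> is decided by the sign of \<open>\<gamma> y - y \<bullet> e\<close>, which vanishes at \<open>x\<close> and has gradient
  \<open>\<nabla>\<gamma> - e\<close> there; outside any cone around the tangent hyperplane the linear part dominates the remainder.\<close>

lemma is_outward_normal_graph_normal:
  assumes chart: "local_graph S x0 r e \<gamma>" and C1: "C1_on UNIV \<gamma>" and S: "open S"
    and x: "x \<in> ball x0 r" "x \<in> frontier S"
  shows "is_outward_normal S x (graph_normal e \<gamma> x)"
proof -
  have e: "norm e = 1" and inv: "\<And>x t. \<gamma> (x + t *\<^sub>R e) = \<gamma> x" using chart by (auto simp: local_graph_def)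
  have d: "\<And>x. \<gamma> differentiable (at x)" using C1 by (auto simp: C1_on_def)
  have mem: "y \<in> S \<longleftrightarrow> \<gamma> y < y \<bullet> e" if "y \<in> ball x0 r" for y by (rule local_graph_mem[OF chart that])
  have gx: "\<gamma> x = x \<bullet> e" using local_graph_frontier[OF chart S C1_on_UNIV_continuous[OF C1] x(1)] x(2) by simp
  let ?J = "sqrt (1 + (norm (grad \<gamma> x))\<^sup>2)"
  have J: "?J \<ge> 1" by simp
  have "(norm (grad \<gamma> x - e))\<^sup>2 = 1 + (norm (grad \<gamma> x))\<^sup>2"
    using chart_grad(1)[OF inv d, of x] e unfolding power2_norm_eq_inner norm_eq_1
    by (simp add: inner_diff inner_commute)
  hence nJ: "norm (grad \<gamma> x - e) = ?J" by (metis norm_ge_zero real_sqrt_unique)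
  show "is_outward_normal S x (graph_normal e \<gamma> x)"
    unfolding is_outward_normal_def
  proof (intro conjI allI impI)
    have "?J \<noteq> 0" using J by linarith
    thus "norm (graph_normal e \<gamma> x) = 1" by (simp add: graph_normal_def nJ)
    fix \<epsilon> :: real assume \<epsilon>: "\<epsilon> > 0"
    have "(\<gamma> has_derivative (\<lambda>v. grad \<gamma> x \<bullet> v)) (at x)"
      using d[of x] unfolding frechet_derivative_works by (simp add: frechet_derivative_eq_inner_grad[OF d, abs_def])
    then obtain \<delta>1 where \<delta>1: "\<delta>1 > 0"
       "\<And>y. norm (y - x) < \<delta>1 \<Longrightarrow> norm (\<gamma> y - \<gamma> x - grad \<gamma> x \<bullet> (y - x)) \<le> \<epsilon> * norm (y - x)"
      using \<epsilon> unfolding has_derivative_at_alt by blast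
    define \<delta> where "\<delta> = min \<delta>1 (r - dist x0 x)"
    have "\<delta> > 0" using \<delta>1 x by (simp add: \<delta>_def)
    moreover have "((y - x) \<bullet> graph_normal e \<gamma> x < - \<epsilon> * norm (y - x) \<longrightarrow> y \<in> S) \<and>
       (\<epsilon> * norm (y - x) < (y - x) \<bullet> graph_normal e \<gamma> x \<longrightarrow> y \<notin> S)" if y: "y \<in> ball x \<delta>" for y
    proof -
      have yb: "y \<in> ball x0 r" using y dist_triangle[of x0 y x] by (simp add: \<delta>_def)
      have "norm (y - x) < \<delta>1" using y by (simp add: \<delta>_def dist_norm norm_minus_commute)
      from \<delta>1(2)[OF this] have est: "\<bar>\<gamma> y - \<gamma> x - grad \<gamma> x \<bullet> (y - x)\<bar> \<le> \<epsilon> * norm (y - x)" by simp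
      define s where "s = (y - x) \<bullet> graph_normal e \<gamma> x"
      have s: "?J * s = grad \<gamma> x \<bullet> (y - x) - (y - x) \<bullet> e"
        using \<open>?J \<noteq> 0\<close> by (simp add: s_def graph_normal_def inner_diff inner_commute)
      hence est': "\<bar>\<gamma> y - y \<bullet> e - ?J * s\<bar> \<le> \<epsilon> * norm (y - x)"
        using est gx by (simp add: inner_diff_left algebra_simps)
      have nn: "0 \<le> \<epsilon> * norm (y - x)" using \<epsilon> by simp
      have "y \<in> S" if "s < - \<epsilon> * norm (y - x)"
      proof -
        have "s < 0" using that nn by linarith
        hence "?J * s \<le> 1 * s" using J by (intro mult_right_mono_neg) auto
        thus ?thesis using est' that mem[OF yb] by auto
      qed
      moreover have "y \<notin> S" if "\<epsilon> * norm (y - x) < s"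
      proof -
        have "0 < s" using that nn by linarith
        hence "1 * s \<le> ?J * s" using J by (intro mult_right_mono) auto
        thus ?thesis using est' that mem[OF yb] by auto
      qed
      ultimately show ?thesis unfolding s_def by blast
    qed
    ultimately show "\<exists>\<delta>>0. \<forall>y\<in>ball x \<delta>. ((y - x) \<bullet> graph_normal e \<gamma> x < - \<epsilon> * norm (y - x) \<longrightarrow> y \<in> S) \<and>
       (\<epsilon> * norm (y - x) < (y - x) \<bullet> graph_normal e \<gamma> x \<longrightarrow> y \<notin> S)" by blast
  qed
qed

lemmas outward_normal_eq_graph_normal = outward_normal_eqI[OF is_outward_normal_graph_normal]

section \<open>The surface measure and the Gauss-Green formula\<close>

text \<open>A line in direction \<open>e\<close> that starts in the slab and meets a ball starts in a bounded region.\<close>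

lemma norm_le_of_slab:
  assumes "norm e = 1" "x \<in> slab e"
  shows "norm x \<le> 2 * norm (x + t *\<^sub>R e) + 1"
proof -
  have "t = (x + t *\<^sub>R e) \<bullet> e - x \<bullet> e" using assms(1) by (simp add: inner_add_left norm_eq_1)
  moreover have "\<bar>(x + t *\<^sub>R e) \<bullet> e\<bar> \<le> norm (x + t *\<^sub>R e)"
    using Cauchy_Schwarz_ineq2[of "x + t *\<^sub>R e" e] assms(1) by simp
  ultimately have "\<bar>t\<bar> \<le> norm (x + t *\<^sub>R e) + 1" using assms(2) by auto
  moreover have "norm x \<le> norm (x + t *\<^sub>R e) + norm (t *\<^sub>R e)"
    using norm_triangle_ineq4[of "x + t *\<^sub>R e" "t *\<^sub>R e"] by simp
  ultimately show ?thesis using assms(1) by simp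
qed

text \<open>In a chart, \<open>proj\<close> moves a point along \<open>e\<close> to the graph, and \<open>jac\<close> is the surface element.\<close>

locale boundary_chart =
  fixes S :: "(real^'n) set" and x0 :: "real^'n" and r :: real and e :: "real^'n" and \<gamma> :: "real^'n \<Rightarrow> real"
  assumes chart: "local_graph S x0 r e \<gamma>" and C1: "C1_on UNIV \<gamma>" and open_S: "open S"
begin

abbreviation proj :: "real^'n \<Rightarrow> real^'n" where "proj x \<equiv> x + (\<gamma> x - x \<bullet> e) *\<^sub>R e"
abbreviation jac :: "real^'n \<Rightarrow> real" where "jac x \<equiv> sqrt (1 + (norm (grad \<gamma> x))\<^sup>2)"

lemma norm_e: "norm e = 1" and r_pos: "r > 0" and \<gamma>_shift: "\<gamma> (x + t *\<^sub>R e) = \<gamma> x"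
  using chart by (auto simp: local_graph_def)

lemma \<gamma>_differentiable: "\<gamma> differentiable (at x)" using C1 by (auto simp: C1_on_def)

lemma grad_\<gamma>_shift: "grad \<gamma> (x + t *\<^sub>R e) = grad \<gamma> x"
  by (rule chart_grad(2)[OF \<gamma>_shift \<gamma>_differentiable])

lemma continuous_on_\<gamma>: "continuous_on A \<gamma>"
  using C1_on_UNIV_continuous[OF C1] continuous_on_subset by blast

lemma continuous_on_grad_\<gamma>: "continuous_on A (grad \<gamma>)"
  using C1 continuous_on_subset unfolding C1_on_def by blast

lemma continuous_on_jac: "continuous_on A jac"
  by (intro continuous_intros continuous_on_grad_\<gamma>)

lemma continuous_on_proj: "continuous_on A proj"
  by (intro continuous_intros continuous_on_\<gamma>)

lemma jac_pos: "jac x > 0" by (simp add: add_pos_nonneg)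

lemma continuous_on_graph_normal: "continuous_on A (graph_normal e \<gamma>)"
  unfolding graph_normal_def[abs_def]
  using jac_pos by (intro continuous_intros continuous_on_grad_\<gamma> ballI) (metis less_irrefl)

lemma measurable_jac [measurable]: "jac \<in> borel_measurable borel"
  by (rule borel_measurable_continuous_onI[OF continuous_on_jac])

lemma measurable_proj [measurable]: "proj \<in> borel_measurable borel"
  by (rule borel_measurable_continuous_onI[OF continuous_on_proj])

text \<open>The formula that characterises the surface measure speaks of Borel sets.  Read as an identity of
  measures it transfers to integrals, as the next lemma does.\<close>

lemma surface_measure_chart_eq:
  assumes \<sigma>: "is_surface_measure S \<sigma>"
  shows "density \<sigma> (\<lambda>x. ennreal (indicator (frontier S \<inter> ball x0 r) x))
     = density (distr (density lborel (\<lambda>x. ennreal (indicator (slab e) x * jac x))) borel proj)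
         (\<lambda>x. ennreal (indicator (ball x0 r) x))" (is "?M1 = density (distr ?D borel proj) _")
proof (rule measure_eqI)
  have sets: "sets \<sigma> = sets borel" using \<sigma> by (simp add: is_surface_measure_def)
  show "sets ?M1 = sets (density (distr ?D borel proj) (\<lambda>x. ennreal (indicator (ball x0 r) x)))"
    using sets by simp
  fix A assume "A \<in> sets ?M1"
  hence A[measurable]: "A \<in> sets borel" using sets by simp
  have fr[measurable]: "frontier S \<in> sets borel" by simp
  have [measurable]: "(\<lambda>x. indicator (ball x0 r \<inter> A) (proj x) :: ennreal) \<in> borel_measurable borel"
    by (intro measurable_compose[OF measurable_proj] borel_measurable_indicator sets.Int A) simp
  have "emeasure ?M1 A = emeasure \<sigma> ((A \<inter> ball x0 r) \<inter> frontier S)"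
    unfolding ennreal_indicator
    by (subst emeasure_restricted) (auto simp: sets intro: arg_cong[where f = "emeasure \<sigma>"])
  also have "\<dots> = (\<integral>\<^sup>+x. indicator (slab e) x * indicator (A \<inter> ball x0 r) (proj x) * ennreal (jac x) \<partial>lborel)"
    using \<sigma> chart C1 A unfolding is_surface_measure_def by (auto simp del: indicator_inter_arith)
  also have "\<dots> = (\<integral>\<^sup>+x. ennreal (indicator (slab e) x * jac x) * indicator (ball x0 r \<inter> A) (proj x) \<partial>lborel)"
    by (intro nn_integral_cong) (auto simp: indicator_def)
  also have "\<dots> = (\<integral>\<^sup>+x. indicator (ball x0 r \<inter> A) (proj x) \<partial>?D)"
    by (subst nn_integral_density) auto
  also have "\<dots> = (\<integral>\<^sup>+x. indicator (ball x0 r \<inter> A) x \<partial>distr ?D borel proj)"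
    by (subst nn_integral_distr) (auto intro!: borel_measurable_indicator sets.Int A)
  also have "\<dots> = emeasure (distr ?D borel proj) (ball x0 r \<inter> A)" by simp
  also have "\<dots> = emeasure (density (distr ?D borel proj) (\<lambda>x. ennreal (indicator (ball x0 r) x))) A"
    unfolding ennreal_indicator by (subst emeasure_restricted) auto
  finally show "emeasure ?M1 A = emeasure (density (distr ?D borel proj) (\<lambda>x. ennreal (indicator (ball x0 r) x))) A" .
qed

lemma surface_integral_chart:
  fixes f :: "real^'n \<Rightarrow> real"
  assumes \<sigma>: "is_surface_measure S \<sigma>" and f: "f \<in> borel_measurable borel" and supp: "\<And>x. x \<notin> ball x0 r \<Longrightarrow> f x = 0"
  shows "(LINT z:frontier S|\<sigma>. f z) = (LINT x|lborel. indicator (slab e) x * jac x * f (proj x))"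
proof -
  have sets[measurable_cong]: "sets \<sigma> = sets borel" using \<sigma> by (simp add: is_surface_measure_def)
  note [measurable] = f
  have [measurable]: "frontier S \<inter> ball x0 r \<in> sets borel" "ball x0 r \<in> sets borel" by simp_all
  let ?D = "density lborel (\<lambda>x. ennreal (indicator (slab e) x * jac x))"
  have "(LINT z:frontier S|\<sigma>. f z) = (LINT z|\<sigma>. indicator (frontier S \<inter> ball x0 r) z *\<^sub>R f z)"
    unfolding set_lebesgue_integral_def
    by (intro Bochner_Integration.integral_cong) (use supp in \<open>auto simp: indicator_def\<close>)
  also have "\<dots> = (LINT z|density \<sigma> (\<lambda>x. ennreal (indicator (frontier S \<inter> ball x0 r) x)). f z)"
    by (rule integral_density[symmetric]) auto
  also have "\<dots> = (LINT z|distr ?D borel proj. indicator (ball x0 r) z *\<^sub>R f z)"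
    unfolding surface_measure_chart_eq[OF \<sigma>] by (rule integral_density) auto
  also have "\<dots> = (LINT z|distr ?D borel proj. f z)"
    by (intro Bochner_Integration.integral_cong) (use supp in \<open>auto simp: indicator_def\<close>)
  also have "\<dots> = (LINT x|?D. f (proj x))"
    by (rule integral_distr) auto
  also have "\<dots> = (LINT x|lborel. (indicator (slab e) x * jac x) *\<^sub>R f (proj x))"
    by (rule integral_density) (auto simp: jac_pos less_imp_le)
  finally show ?thesis by simp
qed

lemma surface_measure_chart_finite:
  assumes \<sigma>: "is_surface_measure S \<sigma>"
  shows "emeasure \<sigma> (ball x0 r \<inter> frontier S) < \<infinity>"
proof -
  define R where "R = 2 * (norm x0 + r) + 1"
  obtain C where C: "\<And>x. x \<in> cball 0 R \<Longrightarrow> norm (jac x) \<le> C"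
    using compact_imp_bounded[OF compact_continuous_image[OF continuous_on_jac compact_cball[of 0 R]]]
    unfolding bounded_iff by (metis image_eqI)
  have "emeasure \<sigma> (ball x0 r \<inter> frontier S)
      = (\<integral>\<^sup>+x. indicator (slab e) x * indicator (ball x0 r) (proj x) * ennreal (jac x) \<partial>lborel)"
    using \<sigma> chart C1 unfolding is_surface_measure_def by auto
  also have "\<dots> \<le> (\<integral>\<^sup>+x. ennreal C * indicator (cball 0 R) (x::real^'n) \<partial>lborel)"
  proof (rule nn_integral_mono)
    fix x :: "real^'n"
    show "indicator (slab e) x * indicator (ball x0 r) (proj x) * ennreal (jac x) \<le> ennreal C * indicator (cball 0 R) x"
    proof (cases "x \<in> slab e \<and> proj x \<in> ball x0 r")
      case True
      have "norm (proj x) \<le> norm x0 + r"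
        using True norm_triangle_ineq[of x0 "proj x - x0"] by (simp add: dist_norm norm_minus_commute)
      hence "x \<in> cball 0 R"
        using norm_le_of_slab[OF norm_e, of x "\<gamma> x - x \<bullet> e"] True by (simp add: R_def)
      thus ?thesis using True C[of x] by (simp add: ennreal_leI)
    qed auto
  qed
  also have "\<dots> = ennreal C * emeasure lborel (cball (0::real^'n) R)"
    by (rule nn_integral_cmult_indicator) simp
  also have "\<dots> < \<infinity>" using emeasure_bounded_finite[OF bounded_cball[of "0::real^'n" R]]
    by (simp add: ennreal_mult_less_top)
  finally show ?thesis .
qed

lemma \<gamma>_locally_Lipschitz:
  obtains L where "L \<ge> 0" "\<And>x y. norm x \<le> R \<Longrightarrow> norm y \<le> R \<Longrightarrow> \<bar>\<gamma> x - \<gamma> y\<bar> \<le> L * norm (x - y)"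
proof -
  obtain C where C: "\<And>x. x \<in> cball 0 R \<Longrightarrow> norm (grad \<gamma> x) \<le> C"
    using compact_imp_bounded[OF compact_continuous_image[OF continuous_on_grad_\<gamma> compact_cball[of 0 R]]]
    unfolding bounded_iff by (metis image_eqI)
  have "\<bar>\<gamma> x - \<gamma> y\<bar> \<le> max C 0 * norm (x - y)" if "norm x \<le> R" "norm y \<le> R" for x y
  proof -
    have "norm (\<gamma> x - \<gamma> y) \<le> max C 0 * norm (x - y)"
    proof (rule differentiable_bound[where S = "cball 0 R" and f' = "\<lambda>x v. grad \<gamma> x \<bullet> v"])
      show "(\<gamma> has_derivative (\<lambda>v. grad \<gamma> x \<bullet> v)) (at x within cball 0 R)" for x
      proof -
        have "frechet_derivative \<gamma> (at x) = (\<lambda>v. grad \<gamma> x \<bullet> v)"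
          by (rule ext) (rule frechet_derivative_eq_inner_grad[OF \<gamma>_differentiable])
        thus ?thesis using \<gamma>_differentiable[of x] unfolding frechet_derivative_works
          by (simp add: has_derivative_at_withinI)
      qed
      show "onorm (\<lambda>v. grad \<gamma> x \<bullet> v) \<le> max C 0" if "x \<in> cball 0 R" for x
      proof (rule onorm_le)
        fix v
        have "norm (grad \<gamma> x \<bullet> v) \<le> norm (grad \<gamma> x) * norm v" by (simp add: Cauchy_Schwarz_ineq2)
        also have "\<dots> \<le> max C 0 * norm v" using C[OF that] by (intro mult_right_mono) auto
        finally show "norm (grad \<gamma> x \<bullet> v) \<le> max C 0 * norm v" .
      qed
    qed (use that in auto)
    thus ?thesis by simp
  qed
  thus ?thesis using that[of "max C 0"] by simp
qed

text \<open>The Gauss-Green formula for the set above a graph, in a form that differentiates the set instead of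
  the function: the difference quotients of the indicator of \<open>S\<close> converge weakly to the normal component
  of the surface measure.  On each line in direction \<open>e\<close> the set and its translate are half-lines, with end points that differ by
  \<open>h (v \<bullet> e - \<nabla>\<gamma> \<bullet> v) + o(h)\<close>, so \<open>interval_average_tendsto\<close> gives the limit on the line; integrating
  over the slab is justified by a local Lipschitz bound for \<open>\<gamma>\<close>.\<close>

lemma gauss_green_chart:
  fixes \<phi> :: "real^'n \<Rightarrow> real"
  assumes \<sigma>: "is_surface_measure S \<sigma>" and \<phi>: "continuous_on UNIV \<phi>" and r': "r' < r"
    and supp: "\<And>x. x \<notin> cball x0 r' \<Longrightarrow> \<phi> x = 0"
    and h: "\<And>m. h m > 0" "\<And>m. h m \<le> 1" "h \<longlonglongrightarrow> 0"
  shows "(\<lambda>m. (LINT x|lborel. \<phi> x * (indicator S (x - h m *\<^sub>R v) - indicator S x)) / h m)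
    \<longlonglongrightarrow> (LINT z:frontier S|\<sigma>. \<phi> z * (outward_normal S z \<bullet> v))"
proof -
  \<comment> \<open>\<open>\<alpha> m x\<close> is where the line through \<open>x\<close> crosses the translated graph, \<open>\<beta> x\<close> its velocity.\<close>
  define \<alpha> where "\<alpha> m x = \<gamma> (x - h m *\<^sub>R v) + h m * (v \<bullet> e) - x \<bullet> e" for m x
  define \<beta> where "\<beta> x = v \<bullet> e - grad \<gamma> x \<bullet> v" for x
  let ?U = "{x. \<gamma> x < x \<bullet> e}"
  let ?f = "\<lambda>m x. \<phi> x * (indicator ?U (x - h m *\<^sub>R v) - indicator ?U x)"
  let ?I = "\<lambda>m x. LINT t|lborel. \<phi> (x + t *\<^sub>R e) * (indicator {\<alpha> m x<..} t - indicator {\<gamma> x - x \<bullet> e<..} t)"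
  \<comment> \<open>Lines that start in the slab outside this radius miss the support of \<open>\<phi>\<close>.\<close>
  define R where "R = 2 * (norm x0 + r) + 1"
  obtain B where B: "B \<ge> 0" "\<And>x. norm (\<phi> x) \<le> B"
    by (rule continuous_compact_support_bounded[OF \<phi> compact_cball[of x0 r']], erule supp, rule that)
  obtain L where L: "L \<ge> 0" "\<And>x y. norm x \<le> R + norm v \<Longrightarrow> norm y \<le> R + norm v \<Longrightarrow> \<bar>\<gamma> x - \<gamma> y\<bar> \<le> L * norm (x - y)"
    by (rule \<gamma>_locally_Lipschitz[of "R + norm v"]) (rule that)
  have \<phi>0: "\<phi> (x + t *\<^sub>R e) = 0" if "x \<in> slab e" "norm x > R" for x t
  proof (rule supp, rule notI)
    assume "x + t *\<^sub>R e \<in> cball x0 r'"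
    hence "norm (x + t *\<^sub>R e) \<le> norm x0 + r"
      using norm_triangle_ineq[of x0 "x + t *\<^sub>R e - x0"] r' by (simp add: dist_norm norm_minus_commute)
    thus False using norm_le_of_slab[OF norm_e that(1), of t] that(2) by (simp add: R_def)
  qed
  have \<phi>line: "continuous_on UNIV (\<lambda>t. \<phi> (x + t *\<^sub>R e))" for x
    by (intro continuous_on_compose2[OF \<phi>] continuous_intros) simp
  have \<alpha>_lim: "(\<lambda>m. (\<alpha> m x - (\<gamma> x - x \<bullet> e)) / h m) \<longlonglongrightarrow> \<beta> x" for x
  proof -
    have "filterlim h (at 0) sequentially" using h(1) h(3) by (auto simp: filterlim_at less_imp_neq[symmetric])
    from filterlim_compose[OF directional_difference_quotient[OF \<gamma>_differentiable, of x "- v"] this]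
    have "(\<lambda>m. (\<gamma> (x - h m *\<^sub>R v) - \<gamma> x) / h m) \<longlonglongrightarrow> - (grad \<gamma> x \<bullet> v)"
      by (simp add: frechet_derivative_eq_inner_grad[OF \<gamma>_differentiable] divide_inverse mult.commute)
    hence "(\<lambda>m. (\<gamma> (x - h m *\<^sub>R v) - \<gamma> x) / h m + v \<bullet> e) \<longlonglongrightarrow> - (grad \<gamma> x \<bullet> v) + v \<bullet> e"
      by (intro tendsto_intros)
    moreover have "(\<gamma> (x - h m *\<^sub>R v) - \<gamma> x) / h m + v \<bullet> e = (\<alpha> m x - (\<gamma> x - x \<bullet> e)) / h m" for m
      using h(1)[of m] by (simp add: \<alpha>_def field_simps)
    ultimately show ?thesis by (simp add: \<beta>_def add.commute)
  qed
  have bdd: "\<bar>\<phi> (x + t *\<^sub>R e)\<bar> \<le> B" for x t using B(2)[of "x + t *\<^sub>R e"] by simp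
  note avg = interval_average_tendsto[OF \<phi>line bdd h(1) h(3) \<alpha>_lim]
  have U: "open ?U" by (intro open_Collect_less continuous_on_\<gamma> continuous_intros)
  have int\<phi>: "integrable lborel \<phi>"
    by (rule integrable_lborel_continuous_compact_support[OF \<phi> compact_cball supp])
  have intf: "integrable lborel (?f m)" for m
  proof -
    have "open {x. x - h m *\<^sub>R v \<in> ?U}"
      unfolding mem_Collect_eq
      by (intro open_Collect_less continuous_on_compose2[OF continuous_on_\<gamma>[of UNIV]] continuous_intros) simp_all
    hence "{x. x - h m *\<^sub>R v \<in> ?U} \<in> sets lborel" by simp
    moreover have "indicator ?U (x - h m *\<^sub>R v) = (indicator {x. x - h m *\<^sub>R v \<in> ?U} x :: real)" for x
      by (simp add: indicator_def)
    ultimately show ?thesis unfolding right_diff_distrib using U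
      by (simp only:) (intro Bochner_Integration.integrable_diff integrable_real_mult_indicator int\<phi>, auto)
  qed
  have line: "?f m (x + t *\<^sub>R e) = \<phi> (x + t *\<^sub>R e) * (indicator {\<alpha> m x<..} t - indicator {\<gamma> x - x \<bullet> e<..} t)" for m x t
  proof -
    have ee: "e \<bullet> e = 1" using norm_e by (simp add: norm_eq_1)
    have "x + t *\<^sub>R e - h m *\<^sub>R v = (x - h m *\<^sub>R v) + t *\<^sub>R e" by simp
    hence "\<gamma> (x + t *\<^sub>R e - h m *\<^sub>R v) = \<gamma> (x - h m *\<^sub>R v)" by (simp only: \<gamma>_shift)
    hence "x + t *\<^sub>R e - h m *\<^sub>R v \<in> ?U \<longleftrightarrow> t \<in> {\<alpha> m x<..}" "x + t *\<^sub>R e \<in> ?U \<longleftrightarrow> t \<in> {\<gamma> x - x \<bullet> e<..}"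
      by (auto simp: \<alpha>_def \<gamma>_shift inner_diff_left inner_add_left ee)
    thus ?thesis by (simp only: indicator_def)
  qed
  have slabI: "(LINT x|lborel. ?f m x) = (LINT x|lborel. indicator (slab e) x * ?I m x)"
    and intI: "integrable lborel (\<lambda>x. indicator (slab e) x * ?I m x)" for m
    using integral_slab_times_line[OF norm_e intf[of m]] integrable_slab_times_line[OF norm_e intf[of m]]
    unfolding line by blast+
  have "(\<lambda>m. LINT x|lborel. indicator (slab e) x * ?I m x / h m)
     \<longlonglongrightarrow> (LINT x|lborel. indicator (slab e) x * (- \<phi> (proj x) * \<beta> x))"
  proof (rule integral_dominated_convergence[where w = "\<lambda>x. B * (L * norm v + norm v) * indicator (cball 0 R) x"])
    have \<beta>c: "continuous_on UNIV \<beta>" unfolding \<beta>_def[abs_def] by (intro continuous_intros continuous_on_grad_\<gamma>)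
    have "continuous_on UNIV (\<lambda>x. - \<phi> (proj x) * \<beta> x)"
      by (intro continuous_on_mult \<beta>c continuous_on_minus continuous_on_compose2[OF \<phi> continuous_on_proj]) simp
    hence "(\<lambda>x. - \<phi> (proj x) * \<beta> x) \<in> borel_measurable borel" by (rule borel_measurable_continuous_onI)
    thus "(\<lambda>x. indicator (slab e) x * (- \<phi> (proj x) * \<beta> x)) \<in> borel_measurable lborel" by simp
    show "(\<lambda>x. indicator (slab e) x * ?I m x / h m) \<in> borel_measurable lborel" for m
      using borel_measurable_integrable[OF intI[of m]] by simp
    show "integrable lborel (\<lambda>x::real^'n. B * (L * norm v + norm v) * indicator (cball 0 R) x)"
      by (intro integrable_mult_right integrable_real_indicator emeasure_lborel_cball_finite) auto
    show "AE x in lborel. (\<lambda>m. indicator (slab e) x * ?I m x / h m) \<longlonglongrightarrow> indicator (slab e) x * (- \<phi> (proj x) * \<beta> x)"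
    proof (rule AE_I2)
      fix x
      have "(\<lambda>m. indicator (slab e) x * (?I m x / h m)) \<longlonglongrightarrow> indicator (slab e) x * (- \<phi> (proj x) * \<beta> x)"
        by (intro tendsto_mult tendsto_const avg(1))
      thus "(\<lambda>m. indicator (slab e) x * ?I m x / h m) \<longlonglongrightarrow> indicator (slab e) x * (- \<phi> (proj x) * \<beta> x)" by simp
    qed
    show "AE x in lborel. norm (indicator (slab e) x * ?I m x / h m) \<le> B * (L * norm v + norm v) * indicator (cball 0 R) x" for m
    proof (rule AE_I2)
      fix x
      show "norm (indicator (slab e) x * ?I m x / h m) \<le> B * (L * norm v + norm v) * indicator (cball 0 R) x"
      proof (cases "x \<in> slab e")
        case slab: True
        show ?thesis
        proof (cases "norm x \<le> R")
          case True
          have hv: "norm (h m *\<^sub>R v) = h m * norm v" "h m * norm v \<le> norm v"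
            using h(1,2)[of m] by (auto simp: mult_left_le_one_le)
          have "norm (x - h m *\<^sub>R v) \<le> R + norm v"
            using norm_triangle_ineq4[of x "h m *\<^sub>R v"] True hv by linarith
          hence "\<bar>\<gamma> (x - h m *\<^sub>R v) - \<gamma> x\<bar> \<le> L * norm (x - h m *\<^sub>R v - x)"
            using True by (intro L(2)) (auto intro: order_trans)
          hence g: "\<bar>\<gamma> (x - h m *\<^sub>R v) - \<gamma> x\<bar> \<le> L * (h m * norm v)" using h(1)[of m] by simp
          have "\<bar>v \<bullet> e\<bar> \<le> norm v" using Cauchy_Schwarz_ineq2[of v e] norm_e by simp
          hence "\<bar>h m * (v \<bullet> e)\<bar> \<le> h m * norm v" using h(1)[of m] by (simp add: abs_mult)
          hence "\<bar>\<alpha> m x - (\<gamma> x - x \<bullet> e)\<bar> \<le> h m * (L * norm v + norm v)"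
            using g unfolding \<alpha>_def by (simp add: algebra_simps)
          hence "\<bar>?I m x\<bar> \<le> B * (h m * (L * norm v + norm v))"
            using avg(2)[of x m] mult_left_mono[OF _ B(1)] order_trans by blast
          hence "\<bar>?I m x\<bar> / h m \<le> B * (L * norm v + norm v)"
            using h(1)[of m] by (simp add: divide_le_eq mult_ac)
          thus ?thesis using True slab h(1)[of m] by simp
        next
          case False
          thus ?thesis using slab \<phi>0[OF slab] by simp
        qed
      qed (use B(1) L(1) in simp)
    qed
  qed
  moreover have "(LINT x|lborel. indicator (slab e) x * ?I m x / h m) = (LINT x|lborel. ?f m x) / h m" for m
    unfolding slabI by simp
  ultimately have lim: "(\<lambda>m. (LINT x|lborel. ?f m x) / h m)
     \<longlonglongrightarrow> (LINT x|lborel. indicator (slab e) x * (- \<phi> (proj x) * \<beta> x))" by (simp only:)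
  have surf: "(LINT x|lborel. indicator (slab e) x * (- \<phi> (proj x) * \<beta> x))
     = (LINT z:frontier S|\<sigma>. \<phi> z * (outward_normal S z \<bullet> v))"
  proof -
    have gn: "graph_normal e \<gamma> (proj x) \<bullet> v * jac x = - \<beta> x" for x
      using jac_pos[of x] unfolding graph_normal_def grad_\<gamma>_shift
      by (simp add: \<beta>_def inner_diff_left inner_diff_right inner_commute)
    have "(LINT z:frontier S|\<sigma>. \<phi> z * (outward_normal S z \<bullet> v)) = (LINT z:frontier S|\<sigma>. \<phi> z * (graph_normal e \<gamma> z \<bullet> v))"
    proof (rule set_lebesgue_integral_cong)
      show "frontier S \<in> sets \<sigma>" using \<sigma> by (simp add: is_surface_measure_def)
      show "\<forall>z. z \<in> frontier S \<longrightarrow> \<phi> z * (outward_normal S z \<bullet> v) = \<phi> z * (graph_normal e \<gamma> z \<bullet> v)"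
      proof (intro allI impI)
        fix z assume z: "z \<in> frontier S"
        show "\<phi> z * (outward_normal S z \<bullet> v) = \<phi> z * (graph_normal e \<gamma> z \<bullet> v)"
        proof (cases "z \<in> ball x0 r")
          case True
          thus ?thesis using outward_normal_eq_graph_normal[OF chart C1 open_S True z] by simp
        next
          case False
          hence "\<phi> z = 0" using r' by (intro supp) auto
          thus ?thesis by simp
        qed
      qed
    qed
    also have "\<dots> = (LINT x|lborel. indicator (slab e) x * jac x * (\<phi> (proj x) * (graph_normal e \<gamma> (proj x) \<bullet> v)))"
    proof (rule surface_integral_chart[OF \<sigma>])
      show "(\<lambda>z. \<phi> z * (graph_normal e \<gamma> z \<bullet> v)) \<in> borel_measurable borel"
        by (intro borel_measurable_continuous_onI continuous_intros \<phi> continuous_on_graph_normal)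
      show "\<phi> x * (graph_normal e \<gamma> x \<bullet> v) = 0" if "x \<notin> ball x0 r" for x
        using that r' supp[of x] by simp
    qed
    also have "\<dots> = (LINT x|lborel. indicator (slab e) x * (- \<phi> (proj x) * \<beta> x))"
    proof (rule Bochner_Integration.integral_cong[OF refl])
      fix x
      have "jac x * (\<phi> (proj x) * (graph_normal e \<gamma> (proj x) \<bullet> v)) = \<phi> (proj x) * (graph_normal e \<gamma> (proj x) \<bullet> v * jac x)"
        by (simp only: mult_ac)
      also have "\<dots> = - \<phi> (proj x) * \<beta> x" unfolding gn by simp
      finally show "indicator (slab e) x * jac x * (\<phi> (proj x) * (graph_normal e \<gamma> (proj x) \<bullet> v))
         = indicator (slab e) x * (- \<phi> (proj x) * \<beta> x)" by (simp only: mult.assoc)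
    qed
    finally show ?thesis by simp
  qed
  have "\<forall>\<^sub>F m in sequentially. (LINT x|lborel. ?f m x) / h m
      = (LINT x|lborel. \<phi> x * (indicator S (x - h m *\<^sub>R v) - indicator S x)) / h m"
  proof -
    have "(\<lambda>m. h m * norm v) \<longlonglongrightarrow> 0 * norm v" by (intro tendsto_intros h(3))
    hence "\<forall>\<^sub>F m in sequentially. h m * norm v < r - r'" using r' by (intro order_tendstoD) auto
    thus ?thesis
    proof eventually_elim
      case (elim m)
      have "?f m x = \<phi> x * (indicator S (x - h m *\<^sub>R v) - indicator S x)" for x
      proof (cases "x \<in> cball x0 r'")
        case True
        have "dist (x - h m *\<^sub>R v) x = h m * norm v" using h(1)[of m] by (simp add: dist_norm)
        hence "x - h m *\<^sub>R v \<in> ball x0 r" "x \<in> ball x0 r"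
          using True r' elim dist_triangle[of x0 "x - h m *\<^sub>R v" x] by (auto simp: dist_commute)
        from this[THEN local_graph_mem[OF chart]] show ?thesis by (simp add: indicator_def)
      qed (simp add: supp)
      thus ?case by (simp only:)
    qed
  qed
  from Lim_transform_eventually[OF lim this] show ?thesis unfolding surf .
qed

end

locale C1_boundary =
  fixes S :: "(real^'n) set" and \<sigma> :: "(real^'n) measure"
  assumes domain: "bounded_C1_domain S" and \<sigma>: "is_surface_measure S \<sigma>"
begin

lemma open_S: "open S" and bounded_S: "bounded S"
  using domain by (auto simp: bounded_C1_domain_def)

lemma sets_\<sigma> [measurable_cong]: "sets \<sigma> = sets borel" using \<sigma> by (simp add: is_surface_measure_def)

lemma compact_frontier: "compact (frontier S)"
  using bounded_S by (rule compact_frontier_bounded)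

lemma exists_chart:
  assumes "x0 \<in> frontier S"
  obtains r e \<gamma> where "boundary_chart S x0 r e \<gamma>"
  using assms domain that unfolding bounded_C1_domain_def boundary_chart_def by blast

lemma chart_family:
  obtains r e \<gamma> where "\<And>x0. x0 \<in> frontier S \<Longrightarrow> boundary_chart S x0 (r x0) (e x0) (\<gamma> x0)"
proof -
  have "\<forall>x0\<in>frontier S. \<exists>r e \<gamma>. boundary_chart S x0 r e \<gamma>" using exists_chart by metis
  then obtain r where "\<forall>x0\<in>frontier S. \<exists>e \<gamma>. boundary_chart S x0 (r x0) e \<gamma>" by (rule bchoice[THEN exE])
  then obtain e where "\<forall>x0\<in>frontier S. \<exists>\<gamma>. boundary_chart S x0 (r x0) (e x0) \<gamma>" by (rule bchoice[THEN exE])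
  then obtain \<gamma> where "\<forall>x0\<in>frontier S. boundary_chart S x0 (r x0) (e x0) (\<gamma> x0)" by (rule bchoice[THEN exE])
  thus ?thesis using that[of r e \<gamma>] by simp
qed

text \<open>Compactness reduces statements about the whole boundary to finitely many charts.\<close>

lemma finite_boundary_cover:
  assumes "\<And>x. x \<in> frontier S \<Longrightarrow> \<rho> x > 0"
  obtains Z where "finite Z" "Z \<subseteq> frontier S" "frontier S \<subseteq> (\<Union>x\<in>Z. ball x (\<rho> x))"
proof -
  have "frontier S \<subseteq> (\<Union>x\<in>frontier S. ball x (\<rho> x))" using assms by auto
  then obtain Z where "Z \<subseteq> frontier S" "finite Z" "frontier S \<subseteq> (\<Union>x\<in>Z. ball x (\<rho> x))"
    by (rule compactE_image[OF compact_frontier, rotated]) (rule that, assumption+, simp)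
  thus ?thesis using that[of Z] by simp
qed

lemma continuous_on_outward_normal: "continuous_on (frontier S) (outward_normal S)"
  unfolding continuous_on_eq_continuous_within
proof
  fix x0 assume x0: "x0 \<in> frontier S"
  obtain r e \<gamma> where "boundary_chart S x0 r e \<gamma>" by (rule exists_chart[OF x0])
  then interpret boundary_chart S x0 r e \<gamma> .
  have c: "continuous (at x0 within frontier S) (graph_normal e \<gamma>)"
    using continuous_on_graph_normal[of UNIV] by (simp add: continuous_on_eq_continuous_at continuous_at_imp_continuous_at_within)
  show "continuous (at x0 within frontier S) (outward_normal S)"
  proof (rule continuous_transform_within[OF c r_pos x0])
    show "graph_normal e \<gamma> x = outward_normal S x" if "x \<in> frontier S" "dist x x0 < r" for x
      using that outward_normal_eq_graph_normal[OF chart C1 open_S] by (simp add: dist_commute)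
  qed
qed

lemma norm_outward_normal: "x \<in> frontier S \<Longrightarrow> norm (outward_normal S x) = 1"
proof -
  assume x0: "x \<in> frontier S"
  obtain r e \<gamma> where "boundary_chart S x r e \<gamma>" by (rule exists_chart[OF x0])
  then interpret boundary_chart S x r e \<gamma> .
  have "is_outward_normal S x (graph_normal e \<gamma> x)"
    using is_outward_normal_graph_normal[OF chart C1 open_S _ x0] r_pos by simp
  thus ?thesis using outward_normal_eqI[of S x] by (simp add: is_outward_normal_def)
qed

lemma surface_measure_finite: "emeasure \<sigma> (frontier S) < \<infinity>"
proof -
  obtain r e \<gamma> where ch: "\<And>x0. x0 \<in> frontier S \<Longrightarrow> boundary_chart S x0 (r x0) (e x0) (\<gamma> x0)"
    by (rule chart_family) (rule that)
  obtain Z where Z: "finite Z" "Z \<subseteq> frontier S" "frontier S \<subseteq> (\<Union>x\<in>Z. ball x (r x))"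
  proof (rule finite_boundary_cover)
    show "r x > 0" if "x \<in> frontier S" for x
      using boundary_chart.r_pos[OF ch[OF that]] .
  qed
  have "frontier S = (\<Union>x\<in>Z. ball x (r x) \<inter> frontier S)" using Z(3) by auto
  moreover have "emeasure \<sigma> (\<Union>x\<in>Z. ball x (r x) \<inter> frontier S) \<le> (\<Sum>x\<in>Z. emeasure \<sigma> (ball x (r x) \<inter> frontier S))"
    by (rule emeasure_subadditive_finite[OF Z(1)]) (auto simp: sets_\<sigma>)
  ultimately have "emeasure \<sigma> (frontier S) \<le> (\<Sum>x\<in>Z. emeasure \<sigma> (ball x (r x) \<inter> frontier S))"
    by (simp only:)
  also have "\<dots> < \<infinity>"
    using boundary_chart.surface_measure_chart_finite[OF ch \<sigma>] Z by (auto simp: less_top[symmetric])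
  finally show ?thesis .
qed

lemma set_integrable_surface:
  fixes f :: "real^'n \<Rightarrow> 'a::euclidean_space"
  assumes "continuous_on (frontier S) f"
  shows "set_integrable \<sigma> (frontier S) f"
proof -
  obtain B where B: "\<And>x. x \<in> frontier S \<Longrightarrow> norm (f x) \<le> B"
    using compact_imp_bounded[OF compact_continuous_image[OF assms compact_frontier]]
    unfolding bounded_iff by (metis image_eqI)
  show ?thesis unfolding set_integrable_def
  proof (rule Bochner_Integration.integrable_bound[where f = "\<lambda>x. B * indicator (frontier S) x"])
    show "integrable \<sigma> (\<lambda>x. B * indicator (frontier S) x)"
      using surface_measure_finite sets_\<sigma> by (intro integrable_mult_right integrable_real_indicator) auto
    have "(\<lambda>x. indicator (frontier S) x *\<^sub>R f x) \<in> borel_measurable borel"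
      by (rule borel_measurable_continuous_on_indicator[OF _ assms]) simp
    thus "(\<lambda>x. indicator (frontier S) x *\<^sub>R f x) \<in> borel_measurable \<sigma>"
      using sets_\<sigma> by (simp cong: measurable_cong_sets)
    show "AE x in \<sigma>. norm (indicator (frontier S) x *\<^sub>R f x) \<le> norm (B * indicator (frontier S) x)"
      using B by (intro AE_I2) (auto simp: indicator_def intro: order_trans[OF _ abs_ge_self])
  qed
qed

text \<open>A continuous partition of unity near the boundary.  The tents \<open>b z\<close> have a sum \<open>B\<close> that is at least
  \<open>2 \<delta>\<close> on the compact boundary; dividing by \<open>max B \<delta>\<close> keeps the quotients continuous everywhere and does not
  disturb them near the boundary, where \<open>B \<ge> \<delta>\<close>.\<close>

lemma boundary_partition:
  assumes "\<And>x. x \<in> frontier S \<Longrightarrow> \<rho> x > 0"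
  obtains Z \<theta> \<eta> where "finite Z" "Z \<subseteq> frontier S"
    "\<And>z. continuous_on UNIV (\<theta> z :: real^'n \<Rightarrow> real)" "\<And>z x. x \<notin> cball z (\<rho> z) \<Longrightarrow> \<theta> z x = 0"
    "\<eta> > 0" "\<And>x y. y \<in> frontier S \<Longrightarrow> dist x y < \<eta> \<Longrightarrow> (\<Sum>z\<in>Z. \<theta> z x) = 1"
proof -
  obtain Z where Z: "finite Z" "Z \<subseteq> frontier S" "frontier S \<subseteq> (\<Union>x\<in>Z. ball x (\<rho> x))"
    by (rule finite_boundary_cover[OF assms])
  define b where "b z x = max 0 (\<rho> z - dist z x)" for z x :: "real^'n"
  define B where "B x = (\<Sum>z\<in>Z. b z x)" for x
  have bc: "continuous_on UNIV (b z)" for z unfolding b_def[abs_def] by (intro continuous_intros)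
  have Bc: "continuous_on A B" for A unfolding B_def[abs_def]
    by (intro continuous_on_sum continuous_on_subset[OF bc]) simp
  have b0: "b z x \<ge> 0" for z x by (simp add: b_def)
  have Bpos: "B x > 0" if x: "x \<in> frontier S" for x
  proof -
    obtain z where "z \<in> Z" "x \<in> ball z (\<rho> z)" using x Z(3) by auto
    thus ?thesis unfolding B_def using Z(1) b0 by (intro sum_pos2[of _ z]) (auto simp: b_def)
  qed
  obtain \<delta> where \<delta>: "\<delta> > 0" "\<And>x. x \<in> frontier S \<Longrightarrow> 2 * \<delta> \<le> B x"
  proof (cases "frontier S = {}")
    case True
    thus ?thesis using that[of 1] by simp
  next
    case False
    obtain y where "y \<in> frontier S" "\<And>x. x \<in> frontier S \<Longrightarrow> B y \<le> B x"
      using continuous_attains_inf[OF compact_frontier False Bc] by metis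
    thus ?thesis using that[of "B y / 2"] Bpos by simp
  qed
  \<comment> \<open>\<open>B\<close> is Lipschitz with constant \<open>card Z\<close>, so it loses at most \<open>\<delta>\<close> within distance \<open>\<eta>\<close>.\<close>
  define \<eta> where "\<eta> = \<delta> / (real (card Z) + 1)"
  have \<eta>: "\<eta> > 0" using \<delta> by (simp add: \<eta>_def)
  have "(\<Sum>z\<in>Z. b z x / max (B x) \<delta>) = 1" if y: "y \<in> frontier S" "dist x y < \<eta>" for x y
  proof -
    have "b z y - dist x y \<le> b z x" for z 
      using dist_triangle[of z x y] zero_le_dist[of x y] unfolding b_def dist_commute[of y x] by linarith
    hence "(\<Sum>z\<in>Z. b z y - dist x y) \<le> B x" unfolding B_def by (rule sum_mono)
    hence "B y - real (card Z) * dist x y \<le> B x" by (simp add: sum_subtractf B_def)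
    moreover have "real (card Z) * dist x y \<le> \<delta>"
    proof -
      have "real (card Z) * dist x y \<le> (real (card Z) + 1) * \<eta>" using y(2) by (intro mult_mono) auto
      also have "\<dots> = \<delta>" by (simp add: \<eta>_def)
      finally show ?thesis .
    qed
    ultimately have "\<delta> \<le> B x" using \<delta>(2)[OF y(1)] by linarith
    thus ?thesis using \<delta>(1) by (simp add: sum_divide_distrib[symmetric] B_def[symmetric])
  qed
  moreover have "continuous_on UNIV (\<lambda>x. b z x / max (B x) \<delta>)" for z
    using \<delta>(1) by (intro continuous_intros bc Bc) (auto simp: max_def)
  moreover have "b z x / max (B x) \<delta> = 0" if "x \<notin> cball z (\<rho> z)" for z x
    using that by (simp add: b_def)
  ultimately show ?thesis using that[of Z "\<lambda>z x. b z x / max (B x) \<delta>" \<eta>] Z(1,2) \<eta> by blast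
qed

text \<open>The pieces of \<open>\<phi>\<close> cut out by the partition of unity live in single charts.  The remaining piece \<open>\<psi>0\<close>
  vanishes near the boundary, where alone the indicator of \<open>S\<close> and of a small translate differ: a segment
  from a point of \<open>S\<close> to a point outside meets the boundary.\<close>

theorem gauss_green:
  fixes \<phi> :: "real^'n \<Rightarrow> real"
  assumes \<phi>: "continuous_on UNIV \<phi>"
    and h: "\<And>m. h m > 0" "\<And>m. h m \<le> 1" "h \<longlonglongrightarrow> 0"
  shows "(\<lambda>m. (LINT x|lborel. \<phi> x * (indicator S (x - h m *\<^sub>R v) - indicator S x)) / h m)
    \<longlonglongrightarrow> (LINT z:frontier S|\<sigma>. \<phi> z * (outward_normal S z \<bullet> v))"
proof -
  define D where "D \<psi> m = (LINT x|lborel. \<psi> x * (indicator S (x - h m *\<^sub>R v) - indicator S x)) / h m"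
    for \<psi> :: "real^'n \<Rightarrow> real" and m
  define T where "T \<psi> = (LINT z:frontier S|\<sigma>. \<psi> z * (outward_normal S z \<bullet> v))" for \<psi>
  obtain r e \<gamma> where ch: "\<And>x0. x0 \<in> frontier S \<Longrightarrow> boundary_chart S x0 (r x0) (e x0) (\<gamma> x0)"
    by (rule chart_family) (rule that)
  have rpos: "r x > 0" if "x \<in> frontier S" for x using boundary_chart.r_pos[OF ch[OF that]] .
  obtain Z \<theta> \<eta> where Z: "finite Z" "Z \<subseteq> frontier S"
    and \<theta>: "\<And>z. continuous_on UNIV (\<theta> z :: real^'n \<Rightarrow> real)" "\<And>z x. x \<notin> cball z (r z / 2) \<Longrightarrow> \<theta> z x = 0"
    and \<eta>: "\<eta> > 0" "\<And>x y. y \<in> frontier S \<Longrightarrow> dist x y < \<eta> \<Longrightarrow> (\<Sum>z\<in>Z. \<theta> z x) = 1"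
    by (rule boundary_partition[of "\<lambda>z. r z / 2"]) (use rpos in simp, rule that)
  define \<psi> where "\<psi> z x = \<phi> x * \<theta> z x" for z x
  define \<psi>0 where "\<psi>0 x = \<phi> x - (\<Sum>z\<in>Z. \<psi> z x)" for x
  have \<psi>c: "continuous_on UNIV (\<psi> z)" for z unfolding \<psi>_def[abs_def] by (intro continuous_intros \<phi> \<theta>(1))
  have \<psi>0c: "continuous_on UNIV \<psi>0" unfolding \<psi>0_def[abs_def] by (intro continuous_intros \<phi> \<psi>c)
  have \<psi>0z: "\<psi>0 x = 0" if "y \<in> frontier S" "dist x y < \<eta>" for x y
    using \<eta>(2)[OF that] by (simp add: \<psi>0_def \<psi>_def sum_distrib_left[symmetric])
  have lim_\<psi>: "D (\<psi> z) \<longlonglongrightarrow> T (\<psi> z)" if z: "z \<in> Z" for z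
  proof -
    have zf: "z \<in> frontier S" using z Z(2) by auto
    show ?thesis unfolding D_def T_def
    proof (rule boundary_chart.gauss_green_chart[OF ch[OF zf] \<sigma> \<psi>c _ _ h])
      show "r z / 2 < r z" using rpos[OF zf] by simp
      show "\<psi> z x = 0" if "x \<notin> cball z (r z / 2)" for x using \<theta>(2)[OF that] by (simp add: \<psi>_def)
    qed
  qed
  have lim_0: "D \<psi>0 \<longlonglongrightarrow> T \<psi>0"
  proof -
    have "T \<psi>0 = (LINT z:frontier S|\<sigma>. 0)"
      unfolding T_def
      by (rule set_lebesgue_integral_cong) (use \<psi>0z \<eta>(1) sets_\<sigma> in auto)
    hence T0: "T \<psi>0 = 0" by (simp add: set_lebesgue_integral_def)
    have "(\<lambda>m. h m * norm v) \<longlonglongrightarrow> 0 * norm v" by (intro tendsto_intros h(3))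
    hence "\<forall>\<^sub>F m in sequentially. h m * norm v < \<eta>" using \<eta>(1) by (intro order_tendstoD) auto
    hence "\<forall>\<^sub>F m in sequentially. D \<psi>0 m = 0"
    proof eventually_elim
      case (elim m)
      have "\<psi>0 x * (indicator S (x - h m *\<^sub>R v) - indicator S x) = 0" for x
      proof (cases "x - h m *\<^sub>R v \<in> S \<longleftrightarrow> x \<in> S")
        case False
        have "closed_segment x (x - h m *\<^sub>R v) \<inter> frontier S \<noteq> {}"
          using False by (intro connected_Int_frontier connected_segment) auto
        then obtain y where y: "y \<in> closed_segment x (x - h m *\<^sub>R v)" "y \<in> frontier S" by blast
        have "dist x y \<le> h m * norm v"
          using segment_bound(1)[OF y(1)] h(1)[of m] by (simp add: dist_norm norm_minus_commute)
        hence "\<psi>0 x = 0" using elim by (intro \<psi>0z[OF y(2)]) simp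
        thus ?thesis by simp
      qed (simp add: indicator_def)
      thus ?case unfolding D_def by (simp only: Bochner_Integration.integral_zero div_0)
    qed
    thus ?thesis unfolding T0 by (rule tendsto_eventually)
  qed
  have intD: "integrable lborel (\<lambda>x. f x * (indicator S (x - h m *\<^sub>R v) - indicator S x))"
    if f: "continuous_on UNIV f" for f :: "real^'n \<Rightarrow> real" and m
  proof -
    have i: "integrable lborel (\<lambda>x. f x * indicator A x)" if "open A" "bounded A" for A :: "(real^'n) set"
    proof -
      have "compact (closure A)" using that by simp
      hence "set_integrable lborel (closure A) f"
        unfolding set_integrable_def by (intro borel_integrable_compact continuous_on_subset[OF f]) auto
      hence "set_integrable lborel A f" by (rule set_integrable_subset) (use that closure_subset in auto)
      thus ?thesis by (simp add: set_integrable_def mult.commute)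
    qed
    let ?S' = "(+) (h m *\<^sub>R v) ` S"
    have "indicator S (x - h m *\<^sub>R v) = (indicator ?S' x :: real)" for x
    proof -
      have "x - h m *\<^sub>R v \<in> S \<longleftrightarrow> x \<in> ?S'" by (auto simp: image_iff intro: bexI[of _ "x - h m *\<^sub>R v"])
      thus ?thesis by (simp add: indicator_def)
    qed
    moreover have "open ?S'" using open_S by (rule open_translation)
    moreover have "bounded ?S'" using bounded_S by (rule bounded_translation)
    ultimately show ?thesis using i[of ?S'] i[OF open_S bounded_S] by (simp add: right_diff_distrib)
  qed
  have intT: "set_integrable \<sigma> (frontier S) (\<lambda>z. f z * (outward_normal S z \<bullet> v))"
    if f: "continuous_on UNIV f" for f :: "real^'n \<Rightarrow> real"
    by (intro set_integrable_surface continuous_intros continuous_on_outward_normal continuous_on_subset[OF f]) simp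
  have \<phi>_eq: "\<phi> x = \<psi>0 x + (\<Sum>z\<in>Z. \<psi> z x)" for x by (simp add: \<psi>0_def)
  have "D \<phi> = (\<lambda>m. D \<psi>0 m + (\<Sum>z\<in>Z. D (\<psi> z) m))"
    unfolding fun_eq_iff D_def \<phi>_eq distrib_right sum_distrib_right
    using intD[OF \<psi>0c] intD[OF \<psi>c]
    by (subst Bochner_Integration.integral_add) (auto simp: add_divide_distrib sum_divide_distrib)
  moreover have "T \<phi> = T \<psi>0 + (\<Sum>z\<in>Z. T (\<psi> z))"
    unfolding T_def \<phi>_eq distrib_right sum_distrib_right
    using intT[OF \<psi>0c] intT[OF \<psi>c]
    unfolding set_lebesgue_integral_def set_integrable_def scaleR_add_right scaleR_sum_right
    by (subst Bochner_Integration.integral_add) (auto simp del: real_scaleR_def)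
  moreover have "(\<lambda>m. D \<psi>0 m + (\<Sum>z\<in>Z. D (\<psi> z) m)) \<longlonglongrightarrow> T \<psi>0 + (\<Sum>z\<in>Z. T (\<psi> z))"
    by (intro tendsto_add tendsto_sum lim_0 lim_\<psi>)
  ultimately have "D \<phi> \<longlonglongrightarrow> T \<phi>" by (simp only:)
  thus ?thesis unfolding D_def T_def .
qed

text \<open>Translating the integration variable moves the difference quotient from the mollifier to the
  indicator of \<open>S\<close>, where the Gauss-Green formula applies.  The sign comes from the translation going
  in the opposite direction.\<close>

lemma grad_smoothed_indicator:
  assumes \<epsilon>: "\<epsilon> > 0"
  shows "grad (smoothed_indicator \<epsilon> S) x $ i
     = - of_real (LINT z:frontier S|\<sigma>. mollifier \<epsilon> (x - z) * outward_normal S z $ i)"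
proof -
  let ?e = "axis i (1::real) :: real^'n" and ?\<chi> = "smoothed_indicator \<epsilon> S"
  let ?h = "\<lambda>m. inverse (real (Suc m))"
  have Sb: "S \<in> sets borel" using open_S by simp
  have h: "?h m > 0" "?h m \<le> 1" "?h \<longlonglongrightarrow> 0" for m
    using LIMSEQ_inverse_real_of_nat by (auto simp: field_simps)
  have \<rho>: "continuous_on UNIV (\<lambda>y. mollifier \<epsilon> (a - y))" for a :: "real^'n"
    by (intro continuous_on_compose2[OF continuous_on_mollifier[of UNIV]] continuous_intros) simp
  have "?\<chi> differentiable (at x)"
    using test_functionD(1)[OF test_function_smoothed_indicator[OF \<epsilon> bounded_S Sb], of "Suc 0"] by simp
  from directional_difference_quotient[OF this, of ?e]
  have "((\<lambda>t. (?\<chi> (x + t *\<^sub>R ?e) - ?\<chi> x) /\<^sub>R t) \<longlongrightarrow> grad ?\<chi> x $ i) (at 0)"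
    by (simp add: grad_def)
  moreover have "filterlim ?h (at 0) sequentially"
    using h(3) by (simp add: filterlim_at)
  ultimately have 1: "(\<lambda>m. (?\<chi> (x + ?h m *\<^sub>R ?e) - ?\<chi> x) /\<^sub>R ?h m) \<longlonglongrightarrow> grad ?\<chi> x $ i"
    by (rule filterlim_compose)
  have val: "?\<chi> a = of_real (LINT y|lborel. indicator S y * mollifier \<epsilon> (a - y))"
    and int: "integrable lborel (\<lambda>y. indicator S y * mollifier \<epsilon> (a - y))" for a
  proof -
    show i: "integrable lborel (\<lambda>y. indicator S y * mollifier \<epsilon> (a - y))"
      using set_integrable_translated[OF bounded_S Sb continuous_on_mollifier, of \<epsilon> a]
      by (simp add: set_integrable_def)
    have "?\<chi> a = (LINT y|lborel. of_real (indicator S y * mollifier \<epsilon> (a - y)))"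
      unfolding smoothed_indicator_def convolve_def set_lebesgue_integral_def
      by (intro Bochner_Integration.integral_cong) (simp_all add: scaleR_conv_of_real)
    thus "?\<chi> a = of_real (LINT y|lborel. indicator S y * mollifier \<epsilon> (a - y))"
      unfolding integral_of_real[OF i] .
  qed
  have shift: "(LINT y|lborel. indicator S y * mollifier \<epsilon> (x + w - y))
       = (LINT y|lborel. indicator S (y + w) * mollifier \<epsilon> (x - y))"
      "integrable lborel (\<lambda>y. indicator S (y + w) * mollifier \<epsilon> (x - y))" for w
    using lborel_integral_shift[OF borel_measurable_integrable[OF int[of "x + w"], simplified], of w]
      integrable_lborel_shift[OF int[of "x + w"], of w] by (simp_all add: algebra_simps)
  have "(?\<chi> (x + ?h m *\<^sub>R ?e) - ?\<chi> x) /\<^sub>R ?h m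
     = of_real ((LINT y|lborel. mollifier \<epsilon> (x - y) * (indicator S (y - ?h m *\<^sub>R (- ?e)) - indicator S y)) / ?h m)" for m
  proof -
    have "(LINT y|lborel. mollifier \<epsilon> (x - y) * (indicator S (y - ?h m *\<^sub>R (- ?e)) - indicator S y))
       = (LINT y|lborel. indicator S (y + ?h m *\<^sub>R ?e) * mollifier \<epsilon> (x - y) - indicator S y * mollifier \<epsilon> (x - y))"
      by (intro Bochner_Integration.integral_cong) (simp_all add: algebra_simps)
    also have "\<dots> = (LINT y|lborel. indicator S y * mollifier \<epsilon> (x + ?h m *\<^sub>R ?e - y)) - (LINT y|lborel. indicator S y * mollifier \<epsilon> (x - y))"
      unfolding shift(1) by (rule Bochner_Integration.integral_diff[OF shift(2) int])
    finally show ?thesis unfolding val by (simp add: scaleR_conv_of_real divide_inverse mult.commute)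
  qed
  moreover have "(\<lambda>m. complex_of_real ((LINT y|lborel. mollifier \<epsilon> (x - y) * (indicator S (y - ?h m *\<^sub>R (- ?e)) - indicator S y)) / ?h m))
     \<longlonglongrightarrow> of_real (LINT z:frontier S|\<sigma>. mollifier \<epsilon> (x - z) * (outward_normal S z \<bullet> (- ?e)))"
    by (intro tendsto_of_real gauss_green \<rho> h)
  ultimately have "grad ?\<chi> x $ i = of_real (LINT z:frontier S|\<sigma>. mollifier \<epsilon> (x - z) * (outward_normal S z \<bullet> (- ?e)))"
    using LIMSEQ_unique[OF 1] by simp
  also have "(LINT z:frontier S|\<sigma>. mollifier \<epsilon> (x - z) * (outward_normal S z \<bullet> (- ?e)))
     = - (LINT z:frontier S|\<sigma>. mollifier \<epsilon> (x - z) * outward_normal S z $ i)"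
    by (simp add: inner_axis set_lebesgue_integral_def)
  finally show ?thesis by simp
qed

end

section \<open>Flux of a continuous field through the boundary\<close>

text \<open>The usual approximation of the identity at a point of continuity, with the uniform bound that makes
  it usable under an integral.\<close>

lemma mollifier_average_tendsto:
  fixes g :: "real^'n \<Rightarrow> complex"
  assumes g: "g \<in> borel_measurable borel" and bdd: "\<And>x. norm (g x) \<le> B" and cont: "isCont g z"
    and \<epsilon>: "\<And>m. \<epsilon> m > 0" "\<epsilon> \<longlonglongrightarrow> 0"
  shows "norm (LINT x|lborel. of_real (mollifier (\<epsilon> m) (x - z)) * g x) \<le> B"
    and "(\<lambda>m. LINT x|lborel. of_real (mollifier (\<epsilon> m) (x - z)) * g x) \<longlonglongrightarrow> g z"
proof -
  have int1: "integrable lborel (\<lambda>x. mollifier \<epsilon>' (x - z))" "(LINT x|lborel. mollifier \<epsilon>' (x - z)) = 1" if "\<epsilon>' > 0" for \<epsilon>'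
    using integrable_lborel_shift[OF integrable_mollifier[OF that], of "- z"]
      lborel_integral_shift[OF borel_measurable_continuous_onI[OF continuous_on_mollifier], of \<epsilon>' "- z"]
      integral_mollifier[OF that, where ?'n = 'n] by simp_all
  have nn: "mollifier \<epsilon>' (x - z) \<ge> 0" if "\<epsilon>' > 0" for \<epsilon>' x using mollifier_nonneg[OF that] .
  have int: "integrable lborel (\<lambda>x. of_real (mollifier \<epsilon>' (x - z)) * f x)"
    and est: "norm (LINT x|lborel. of_real (mollifier \<epsilon>' (x - z)) * f x) \<le> C"
    if \<epsilon>': "\<epsilon>' > 0" and f: "f \<in> borel_measurable borel" and b: "\<And>x. norm (f x) \<le> B'"
       and C: "\<And>x. norm (x - z) < \<epsilon>' \<Longrightarrow> norm (f x) \<le> C" for \<epsilon>' C B' and f :: "real^'n \<Rightarrow> complex"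
  proof -
    have bound: "norm (of_real (mollifier \<epsilon>' (x - z)) * f x) \<le> C * mollifier \<epsilon>' (x - z)" for x
    proof (cases "norm (x - z) < \<epsilon>'")
      case True
      thus ?thesis using mult_left_mono[OF C[OF True] nn[OF \<epsilon>', of x]] nn[OF \<epsilon>', of x] by (simp add: norm_mult mult.commute)
    qed (simp add: mollifier_eq_0[OF \<epsilon>'])
    have m: "(\<lambda>x. complex_of_real (mollifier \<epsilon>' (x - z))) \<in> borel_measurable borel"
      using borel_measurable_integrable[OF int1(1)[OF \<epsilon>']] by simp
    show i: "integrable lborel (\<lambda>x. of_real (mollifier \<epsilon>' (x - z)) * f x)"
    proof (rule Bochner_Integration.integrable_bound[where f = "\<lambda>x. C * mollifier \<epsilon>' (x - z)"])
      show "integrable lborel (\<lambda>x. C * mollifier \<epsilon>' (x - z))" using int1(1)[OF \<epsilon>'] by simp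
      show "(\<lambda>x. of_real (mollifier \<epsilon>' (x - z)) * f x) \<in> borel_measurable lborel"
        using borel_measurable_times[OF m f] by simp
      show "AE x in lborel. norm (of_real (mollifier \<epsilon>' (x - z)) * f x) \<le> norm (C * mollifier \<epsilon>' (x - z))"
        using bound by (intro AE_I2) (auto intro: order_trans[OF _ abs_ge_self])
    qed
    have "norm (LINT x|lborel. of_real (mollifier \<epsilon>' (x - z)) * f x) \<le> (LINT x|lborel. norm (of_real (mollifier \<epsilon>' (x - z)) * f x))"
      by (rule integral_norm_bound)
    also have "\<dots> \<le> (LINT x|lborel. C * mollifier \<epsilon>' (x - z))"
      using i int1(1)[OF \<epsilon>'] bound by (intro integral_mono integrable_norm) auto
    also have "\<dots> = C" using int1(2)[OF \<epsilon>'] by simp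
    finally show "norm (LINT x|lborel. of_real (mollifier \<epsilon>' (x - z)) * f x) \<le> C" .
  qed
  have i1: "integrable lborel (\<lambda>x. of_real (mollifier \<epsilon>' (x - z)) * g x)" if "\<epsilon>' > 0" for \<epsilon>'
    by (rule int[OF that g bdd bdd])
  show "norm (LINT x|lborel. of_real (mollifier (\<epsilon> m) (x - z)) * g x) \<le> B"
    by (rule est[OF \<epsilon>(1) g bdd bdd])
  let ?d = "\<lambda>m. norm ((LINT x|lborel. of_real (mollifier (\<epsilon> m) (x - z)) * g x) - g z)"
  have "?d \<longlonglongrightarrow> 0"
  proof (rule tendsto_zeroI_eps)
    fix \<eta> :: real assume \<eta>: "\<eta> > 0"
    obtain \<delta> where \<delta>: "\<delta> > 0" "\<And>x. norm (x - z) < \<delta> \<Longrightarrow> norm (g x - g z) < \<eta>"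
      using cont \<eta> unfolding continuous_at_eps_delta dist_norm by blast
    have "\<forall>\<^sub>F m in sequentially. \<epsilon> m < \<delta>" using \<epsilon>(2) \<delta>(1) by (rule order_tendstoD)
    thus "\<forall>\<^sub>F m in sequentially. \<bar>?d m\<bar> \<le> \<eta>"
    proof eventually_elim
      case (elim m)
      have "(LINT x|lborel. of_real (mollifier (\<epsilon> m) (x - z)) * (g x - g z))
         = (LINT x|lborel. of_real (mollifier (\<epsilon> m) (x - z)) * g x) - (LINT x|lborel. of_real (mollifier (\<epsilon> m) (x - z)) * g z)"
        unfolding right_diff_distrib
        using int1(1)[OF \<epsilon>(1)] by (intro Bochner_Integration.integral_diff i1 \<epsilon>(1)) simp
      also have "(LINT x|lborel. of_real (mollifier (\<epsilon> m) (x - z)) * g z) = g z"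
        using int1[OF \<epsilon>(1)[of m]] by simp
      finally have "(LINT x|lborel. of_real (mollifier (\<epsilon> m) (x - z)) * g x) - g z
         = (LINT x|lborel. of_real (mollifier (\<epsilon> m) (x - z)) * (g x - g z))" by simp
      moreover have "norm (LINT x|lborel. of_real (mollifier (\<epsilon> m) (x - z)) * (g x - g z)) \<le> \<eta>"
      proof (rule est[OF \<epsilon>(1)])
        show "(\<lambda>x. g x - g z) \<in> borel_measurable borel" using g by simp
        show "norm (g x - g z) \<le> 2 * B" for x using norm_triangle_ineq4[of "g x" "g z"] bdd[of x] bdd[of z] by simp
        show "norm (g x - g z) \<le> \<eta>" if "norm (x - z) < \<epsilon> m" for x using \<delta>(2)[of x] that elim by simp
      qed
      ultimately show ?case by simp
    qed
  qed
  thus "(\<lambda>m. LINT x|lborel. of_real (mollifier (\<epsilon> m) (x - z)) * g x) \<longlonglongrightarrow> g z"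
    by (simp only: tendsto_norm_zero_iff LIM_zero_iff)
qed

lemma compact_Union_cball:
  fixes K :: "'a::euclidean_space set"
  assumes "compact K"
  shows "compact (\<Union>z\<in>K. cball z d)"
proof -
  have "cball z d = (\<Union>y\<in>cball 0 d. {z + y})" for z :: 'a
  proof -
    have "x \<in> cball z d \<longleftrightarrow> x \<in> (\<Union>y\<in>cball 0 d. {z + y})" for x
    proof -
      have "x \<in> (\<Union>y\<in>cball 0 d. {z + y}) \<longleftrightarrow> (\<exists>y. norm y \<le> d \<and> x = z + y)" by auto
      also have "\<dots> \<longleftrightarrow> norm (x - z) \<le> d" by (metis add_diff_cancel_left' add.commute diff_add_cancel)
      finally show ?thesis by (simp add: dist_norm norm_minus_commute)
    qed
    thus ?thesis by (rule set_eqI)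
  qed
  hence "(\<Union>z\<in>K. cball z d) = (\<Union>z\<in>K. \<Union>y\<in>cball 0 d. {z + y})" by (rule SUP_cong[OF refl])
  thus ?thesis using compact_sums'[OF assms compact_cball[of 0 d]] by (simp only:)
qed

context C1_boundary begin

lemma smoothed_indicator_grad_eq_0:
  assumes \<epsilon>: "\<epsilon> > 0" and x: "\<And>z. z \<in> frontier S \<Longrightarrow> dist x z \<ge> \<epsilon>"
  shows "grad (smoothed_indicator \<epsilon> S) x $ i = 0"
proof -
  have "(LINT z:frontier S|\<sigma>. mollifier \<epsilon> (x - z) * outward_normal S z $ i) = (LINT z:frontier S|\<sigma>. 0)"
    by (rule set_lebesgue_integral_cong) (use x mollifier_eq_0[OF \<epsilon>] sets_\<sigma> in \<open>auto simp: dist_norm\<close>)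
  thus ?thesis unfolding grad_smoothed_indicator[OF \<epsilon>] by (simp add: set_lebesgue_integral_def)
qed

text \<open>By the formula for the gradient of the smoothed indicator and Fubini's theorem, the left-hand side
  is minus the boundary integral of a normal component times a mollification of \<open>V\<close>, and the
  mollifications converge to \<open>V\<close> at every boundary point.\<close>

theorem smoothed_indicator_flux:
  fixes V :: "real^'n \<Rightarrow> complex"
  assumes U: "open U" "frontier S \<subseteq> U" and V: "continuous_on U V"
    and \<epsilon>: "\<And>m. \<epsilon> m > 0" "\<epsilon> \<longlonglongrightarrow> 0"
  shows "(\<lambda>m. LINT x|lborel. grad (smoothed_indicator (\<epsilon> m) S) x $ i * V x)
    \<longlonglongrightarrow> - (LINT z:frontier S|\<sigma>. of_real (outward_normal S z $ i) * V z)"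
proof -
  obtain d where d: "d > 0" "(\<Union>z\<in>frontier S. cball z d) \<subseteq> U"
    using compact_subset_open_imp_cball_epsilon_subset[OF compact_frontier U] by metis
  \<comment> \<open>\<open>V\<close> may be arbitrary away from the boundary; for small widths only its values on \<open>A\<close> matter.\<close>
  define A where "A = (\<Union>z\<in>frontier S. cball z d)"
  have A: "compact A" unfolding A_def by (rule compact_Union_cball[OF compact_frontier])
  have AU: "A \<subseteq> U" using d(2) by (simp add: A_def)
  have frA: "ball z d \<subseteq> A" if "z \<in> frontier S" for z using that unfolding A_def by (force simp: mem_ball)
  define g where "g x = indicator A x *\<^sub>R V x" for x
  obtain B where B: "\<And>x. x \<in> A \<Longrightarrow> norm (V x) \<le> B"
    using compact_imp_bounded[OF compact_continuous_image[OF continuous_on_subset[OF V AU] A]]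
    unfolding bounded_iff by (metis image_eqI)
  have gB: "norm (g x) \<le> max B 0" for x using B[of x] by (auto simp: g_def indicator_def)
  have gm: "g \<in> borel_measurable borel" unfolding g_def[abs_def]
    using A by (intro borel_measurable_continuous_on_indicator continuous_on_subset[OF V AU]) (simp add: compact_imp_closed)
  have gc: "isCont g z" and gz: "g z = V z" if z: "z \<in> frontier S" for z
  proof -
    have "continuous_on (ball z d) V" using frA[OF z] AU by (intro continuous_on_subset[OF V]) auto
    hence "isCont V z" using d(1) by (simp add: continuous_on_eq_continuous_at)
    moreover have "\<forall>\<^sub>F x in nhds z. V x = g x"
    proof (rule eventually_mono)
      show "\<forall>\<^sub>F x in nhds z. x \<in> ball z d" using d(1) by (intro eventually_nhds_in_open) auto
      show "V x = g x" if "x \<in> ball z d" for x using frA[OF z] that by (auto simp: g_def)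
    qed
    ultimately show "isCont g z" using isCont_cong by metis
    have "z \<in> A" using subsetD[OF frA[OF z], of z] d(1) by simp
    thus "g z = V z" by (simp add: g_def)
  qed
  \<comment> \<open>A finite measure is required for Fubini's theorem; restricting \<open>\<sigma>\<close> to the compact boundary provides one.\<close>
  let ?M = "density \<sigma> (\<lambda>z. ennreal (indicator (frontier S) z))"
  interpret M: finite_measure ?M
  proof
    show "emeasure ?M (space ?M) \<noteq> \<infinity>"
      unfolding ennreal_indicator using surface_measure_finite sets_\<sigma>
      by (simp add: emeasure_restricted sets_eq_imp_space_eq[OF sets_\<sigma>])
  qed
  have Mint: "(LINT z:frontier S|\<sigma>. f z) = (LINT z|?M. f z)" if "f \<in> borel_measurable borel" for f :: "real^'n \<Rightarrow> complex"
    unfolding set_lebesgue_integral_def using sets_\<sigma> that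
    by (subst integral_density) (auto cong: measurable_cong_sets)
  define n where "n z = indicator (frontier S) z * outward_normal S z $ i" for z
  have nm: "n \<in> borel_measurable borel"
  proof -
    have "continuous_on (frontier S) (\<lambda>z. outward_normal S z $ i)"
      by (intro continuous_intros continuous_on_outward_normal)
    from borel_measurable_continuous_on_indicator[OF _ this] show ?thesis
      by (simp add: n_def[abs_def])
  qed
  have nmc: "(\<lambda>z. complex_of_real (n z)) \<in> borel_measurable borel"
    by (rule measurable_compose[OF nm]) (intro borel_measurable_continuous_onI continuous_intros)
  have nb: "\<bar>n z\<bar> \<le> 1" for z
    using norm_outward_normal[of z] component_le_norm_cart[of "outward_normal S z" i] by (auto simp: n_def indicator_def)
  have n_eq: "(LINT z:frontier S|\<sigma>. f z * of_real (outward_normal S z $ i)) = (LINT z|?M. f z * of_real (n z))"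
    if "f \<in> borel_measurable borel" for f :: "real^'n \<Rightarrow> complex"
  proof -
    have "(LINT z:frontier S|\<sigma>. f z * of_real (outward_normal S z $ i)) = (LINT z:frontier S|\<sigma>. f z * of_real (n z))"
      by (rule set_lebesgue_integral_cong) (simp_all add: sets_\<sigma> n_def)
    also have "\<dots> = (LINT z|?M. f z * of_real (n z))" using that nmc by (intro Mint borel_measurable_times)
    finally show ?thesis .
  qed
  have \<rho>m: "(\<lambda>p::(real^'n) \<times> (real^'n). mollifier \<epsilon>' (fst p - snd p)) \<in> borel_measurable (borel \<Otimes>\<^sub>M borel)" for \<epsilon>'
  proof -
    have "(\<lambda>p::(real^'n) \<times> (real^'n). mollifier \<epsilon>' (fst p - snd p)) \<in> borel_measurable borel"
      by (intro borel_measurable_continuous_onI continuous_on_compose2[OF continuous_on_mollifier[of UNIV]] continuous_intros) simp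
    thus ?thesis by (simp add: borel_prod)
  qed
  define I where "I m z = (LINT x|lborel. of_real (mollifier (\<epsilon> m) (x - z)) * g x)" for m z
  have step: "(LINT x|lborel. grad (smoothed_indicator (\<epsilon> m) S) x $ i * V x) = - (LINT z|?M. of_real (n z) * I m z)"
    if m: "\<epsilon> m \<le> d" for m
  proof -
    let ?F = "\<lambda>x z. of_real (mollifier (\<epsilon> m) (x - z)) * of_real (n z) * g x"
    have sM: "sets ?M = sets borel" using sets_\<sigma> by simp
    interpret P: pair_sigma_finite lborel ?M ..
    have "continuous_on UNIV (mollifier (\<epsilon> m) :: real^'n \<Rightarrow> real)" by (rule continuous_on_mollifier)
    from continuous_compact_support_bounded[OF this compact_cball[of 0 "\<epsilon> m"]] mollifier_eq_0[OF \<epsilon>(1)[of m]]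
    obtain C where C: "C \<ge> 0" "\<And>x::real^'n. norm (mollifier (\<epsilon> m) x) \<le> C"
      by (metis dist_0_norm mem_cball not_le less_imp_le)
    have int: "integrable (lborel \<Otimes>\<^sub>M ?M) (\<lambda>(x, z). ?F x z)"
    proof (rule Bochner_Integration.integrable_bound[where f = "\<lambda>(x, z). C * max B 0 * indicator A x"])
      have "integrable lborel (indicator A :: _ \<Rightarrow> real)"
        using A by (intro integrable_real_indicator emeasure_bounded_finite compact_imp_bounded) (auto simp: compact_imp_closed)
      hence "integrable lborel (\<lambda>x. C * max B 0 * indicator A x)" by simp
      thus "integrable (lborel \<Otimes>\<^sub>M ?M) (\<lambda>(x, z). C * max B 0 * indicator A x)"
      proof (intro P.Fubini_integrable)
        show "(\<lambda>(x, z). C * max B 0 * indicator A x) \<in> borel_measurable (lborel \<Otimes>\<^sub>M ?M)"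
          unfolding split_beta' using A
          by (intro borel_measurable_times borel_measurable_const measurable_compose[OF measurable_fst] borel_measurable_indicator)
             (simp add: compact_imp_closed)
      qed (auto simp: integrable_mult_left)
      have "(\<lambda>(x, z). ?F x z) \<in> borel_measurable (borel \<Otimes>\<^sub>M borel)"
        unfolding split_beta'
        by (intro borel_measurable_times measurable_compose[OF measurable_snd nmc] measurable_compose[OF measurable_fst gm]
             measurable_compose[OF \<rho>m borel_measurable_of_real])
      thus "(\<lambda>(x, z). ?F x z) \<in> borel_measurable (lborel \<Otimes>\<^sub>M ?M)"
        using sM by (simp cong: measurable_cong_sets sets_pair_measure_cong)
      show "AE p in lborel \<Otimes>\<^sub>M ?M. norm (case p of (x, z) \<Rightarrow> ?F x z) \<le> norm (case p of (x, z) \<Rightarrow> C * max B 0 * indicator A x)"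
      proof (rule AE_I2, clarify)
        fix x z
        have "norm (?F x z) = norm (mollifier (\<epsilon> m) (x - z)) * \<bar>n z\<bar> * norm (g x)" by (simp add: norm_mult)
        also have "\<dots> \<le> C * 1 * (max B 0 * indicator A x)"
        proof (intro mult_mono C nb)
          show "norm (g x) \<le> max B 0 * indicator A x" using gB[of x] by (cases "x \<in> A") (auto simp: g_def)
        qed (use C(1) in auto)
        finally show "norm (?F x z) \<le> norm (C * max B 0 * indicator A x)" using C(1) by (simp add: mult.assoc)
      qed
    qed
    have "(LINT x|lborel. grad (smoothed_indicator (\<epsilon> m) S) x $ i * V x)
       = (LINT x|lborel. - (LINT z|?M. ?F x z))"
    proof (rule Bochner_Integration.integral_cong[OF refl])
      fix x :: "real^'n"
      have mm: "(\<lambda>z. complex_of_real (mollifier (\<epsilon> m) (x - z))) \<in> borel_measurable borel"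
        by (intro borel_measurable_continuous_onI continuous_intros continuous_on_compose2[OF continuous_on_mollifier[of UNIV]]) simp
      have si: "set_integrable \<sigma> (frontier S) (\<lambda>z. mollifier (\<epsilon> m) (x - z) * outward_normal S z $ i)"
        by (intro set_integrable_surface continuous_intros continuous_on_outward_normal
              continuous_on_compose2[OF continuous_on_mollifier[of UNIV]]) simp
      have "grad (smoothed_indicator (\<epsilon> m) S) x $ i
         = - (LINT z:frontier S|\<sigma>. of_real (mollifier (\<epsilon> m) (x - z)) * of_real (outward_normal S z $ i))"
        unfolding grad_smoothed_indicator[OF \<epsilon>(1)] set_lebesgue_integral_def
        using si[unfolded set_integrable_def]
        by (subst integral_of_real[symmetric]) (auto simp: scaleR_conv_of_real)
      also have "\<dots> = - (LINT z|?M. of_real (mollifier (\<epsilon> m) (x - z)) * of_real (n z))" by (subst n_eq[OF mm]) simp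
      finally have gr: "grad (smoothed_indicator (\<epsilon> m) S) x $ i = - (LINT z|?M. of_real (mollifier (\<epsilon> m) (x - z)) * of_real (n z))" .
      show "grad (smoothed_indicator (\<epsilon> m) S) x $ i * V x = - (LINT z|?M. ?F x z)"
      proof (cases "x \<in> A")
        case True
        thus ?thesis unfolding gr by (simp add: g_def)
      next
        case False
        have "grad (smoothed_indicator (\<epsilon> m) S) x $ i = 0"
        proof (rule smoothed_indicator_grad_eq_0[OF \<epsilon>(1)])
          fix z assume "z \<in> frontier S"
          hence "x \<notin> ball z d" using frA False by blast
          thus "\<epsilon> m \<le> dist x z" using m by (simp add: dist_commute)
        qed
        thus ?thesis using False by (simp add: g_def)
      qed
    qed
    also have "\<dots> = - (LINT x|lborel. LINT z|?M. ?F x z)" by simp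
    also have "(LINT x|lborel. LINT z|?M. ?F x z) = (LINT z|?M. LINT x|lborel. ?F x z)"
      using P.Fubini_integral[OF int] by simp
    also have "\<dots> = (LINT z|?M. of_real (n z) * I m z)"
      unfolding I_def by (intro Bochner_Integration.integral_cong[OF refl]) (simp add: mult_ac flip: integral_mult_right_zero)
    finally show ?thesis .
  qed
  have "(\<lambda>m. LINT z|?M. of_real (n z) * I m z) \<longlonglongrightarrow> (LINT z|?M. of_real (n z) * g z)"
  proof (rule integral_dominated_convergence[where w = "\<lambda>_. max B 0"])
    show "(\<lambda>z. of_real (n z) * g z) \<in> borel_measurable ?M"
      using borel_measurable_times[OF nmc gm] sets_\<sigma> by (simp cong: measurable_cong_sets)
    show "(\<lambda>z. of_real (n z) * I m z) \<in> borel_measurable ?M" for m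
    proof -
      have "(\<lambda>(z, x). of_real (mollifier (\<epsilon> m) (x - z)) * g x) \<in> borel_measurable (borel \<Otimes>\<^sub>M lborel)"
      proof -
        have "(\<lambda>p::(real^'n) \<times> (real^'n). mollifier (\<epsilon> m) (snd p - fst p)) \<in> borel_measurable borel"
          by (intro borel_measurable_continuous_onI continuous_on_compose2[OF continuous_on_mollifier[of UNIV]] continuous_intros) simp
        hence "(\<lambda>p::(real^'n) \<times> (real^'n). mollifier (\<epsilon> m) (snd p - fst p)) \<in> borel_measurable (borel \<Otimes>\<^sub>M borel)"
          by (simp add: borel_prod)
        hence "(\<lambda>(z, x). of_real (mollifier (\<epsilon> m) (x - z)) * g x) \<in> borel_measurable (borel \<Otimes>\<^sub>M borel)"
          unfolding split_beta'
          by (intro borel_measurable_times measurable_compose[OF measurable_snd gm]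
               measurable_compose[OF _ borel_measurable_of_real])
        thus ?thesis by (simp cong: measurable_cong_sets sets_pair_measure_cong)
      qed
      hence "I m \<in> borel_measurable borel"
        unfolding I_def[abs_def] by (rule lborel.borel_measurable_lebesgue_integral)
      from borel_measurable_times[OF nmc this] show ?thesis using sets_\<sigma> by (simp cong: measurable_cong_sets)
    qed
    show "integrable ?M (\<lambda>_. max B 0)" by simp
    show "AE z in ?M. (\<lambda>m. of_real (n z) * I m z) \<longlonglongrightarrow> of_real (n z) * g z"
    proof (rule AE_I2)
      fix z
      show "(\<lambda>m. of_real (n z) * I m z) \<longlonglongrightarrow> of_real (n z) * g z"
      proof (cases "z \<in> frontier S")
        case True
        show ?thesis unfolding I_def
          by (intro tendsto_mult tendsto_const mollifier_average_tendsto(2)[OF gm gB gc[OF True] \<epsilon>])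
      qed (simp add: n_def)
    qed
    show "AE z in ?M. norm (of_real (n z) * I m z) \<le> max B 0" for m
    proof (rule AE_I2)
      fix z
      show "norm (of_real (n z) * I m z) \<le> max B 0"
      proof (cases "z \<in> frontier S")
        case True
        have "norm (I m z) \<le> max B 0" unfolding I_def by (rule mollifier_average_tendsto(1)[OF gm gB gc[OF True] \<epsilon>])
        hence "\<bar>n z\<bar> * norm (I m z) \<le> 1 * max B 0" by (intro mult_mono nb) auto
        thus ?thesis by (simp add: norm_mult)
      qed (simp add: n_def)
    qed
  qed
  hence "(\<lambda>m. - (LINT z|?M. of_real (n z) * I m z)) \<longlonglongrightarrow> - (LINT z|?M. of_real (n z) * g z)"
    by (rule tendsto_minus)
  moreover have "\<forall>\<^sub>F m in sequentially. - (LINT z|?M. of_real (n z) * I m z) = (LINT x|lborel. grad (smoothed_indicator (\<epsilon> m) S) x $ i * V x)"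
  proof -
    have "\<forall>\<^sub>F m in sequentially. \<epsilon> m < d" using \<epsilon>(2) d(1) by (rule order_tendstoD)
    thus ?thesis by eventually_elim (simp add: step)
  qed
  ultimately have "(\<lambda>m. LINT x|lborel. grad (smoothed_indicator (\<epsilon> m) S) x $ i * V x) \<longlonglongrightarrow> - (LINT z|?M. of_real (n z) * g z)"
    by (rule Lim_transform_eventually)
  moreover have "(LINT z|?M. of_real (n z) * g z) = (LINT z:frontier S|\<sigma>. of_real (outward_normal S z $ i) * V z)"
  proof -
    have "(LINT z:frontier S|\<sigma>. of_real (outward_normal S z $ i) * V z) = (LINT z:frontier S|\<sigma>. g z * of_real (outward_normal S z $ i))"
      by (rule set_lebesgue_integral_cong) (simp_all add: sets_\<sigma> gz mult.commute)
    also have "\<dots> = (LINT z|?M. g z * of_real (n z))" by (rule n_eq[OF gm])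
    finally show ?thesis by (simp add: mult.commute)
  qed
  ultimately show ?thesis by simp
qed

end

section \<open>The weak formulation tested with a cut-off standing wave\<close>

lemma measurable_lebesgueI:
  fixes f :: "'a::euclidean_space \<Rightarrow> 'b::topological_space"
  assumes "continuous_on UNIV f"
  shows "f \<in> borel_measurable lebesgue"
  by (intro measurable_completion) (simp add: borel_measurable_continuous_onI[OF assms])

text \<open>On bounded sets \<open>|G|\<close> is dominated by the integrable function \<open>1 + |G|\<^sup>2\<close>.\<close>

lemma L2_loc_dominates_integrable:
  fixes G :: "real^'n \<Rightarrow> 'a::euclidean_space" and f :: "real^'n \<Rightarrow> 'b::euclidean_space"
  assumes G: "L2_loc G" and f: "f \<in> borel_measurable lebesgue" and le: "\<And>x. norm (f x) \<le> C * norm (G x)"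
    and S: "bounded S" "S \<in> sets lebesgue"
  shows "set_integrable lebesgue S f"
proof -
  have fin: "emeasure lebesgue (closure S) < \<infinity>"
    using emeasure_bounded_finite[of "closure S"] S(1) by (simp add: bounded_closure)
  have "compact (closure S)" using S(1) by simp
  hence "set_integrable lebesgue (closure S) (\<lambda>x. (norm (G x))\<^sup>2)" using G by (simp add: L2_loc_def)
  hence i: "integrable lebesgue (\<lambda>x. \<bar>C\<bar> * (indicator (closure S) x + indicator (closure S) x *\<^sub>R (norm (G x))\<^sup>2))"
    unfolding set_integrable_def
    by (intro integrable_mult_right Bochner_Integration.integrable_add integrable_real_indicator fin) auto
  show ?thesis unfolding set_integrable_def
  proof (rule Bochner_Integration.integrable_bound[OF i])
    show "(\<lambda>x. indicator S x *\<^sub>R f x) \<in> borel_measurable lebesgue"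
      using f S(2) by (intro borel_measurable_scaleR borel_measurable_indicator)
    show "AE x in lebesgue. norm (indicator S x *\<^sub>R f x) \<le> norm (\<bar>C\<bar> * (indicator (closure S) x + indicator (closure S) x *\<^sub>R (norm (G x))\<^sup>2))"
    proof (rule AE_I2)
      fix x
      show "norm (indicator S x *\<^sub>R f x) \<le> norm (\<bar>C\<bar> * (indicator (closure S) x + indicator (closure S) x *\<^sub>R (norm (G x))\<^sup>2))"
      proof (cases "x \<in> S")
        case True
        hence "x \<in> closure S" using closure_subset by blast
        have "norm (G x) \<le> 1 + (norm (G x))\<^sup>2"
          using zero_le_power2[of "norm (G x) - 1/2"] by (simp add: power2_diff) (simp add: power2_eq_square)
        hence "\<bar>C\<bar> * norm (G x) \<le> \<bar>C\<bar> * (1 + (norm (G x))\<^sup>2)" by (intro mult_left_mono) auto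
        moreover have "C * norm (G x) \<le> \<bar>C\<bar> * norm (G x)" by (intro mult_right_mono) auto
        ultimately show ?thesis using True \<open>x \<in> closure S\<close> le[of x] by (simp add: abs_mult)
      qed simp
    qed
  qed
qed

lemma test_function_bounded:
  assumes "test_function g"
  obtains B where "B \<ge> 0" "\<And>x. norm (g x) \<le> B"
proof (rule continuous_compact_support_bounded[OF Ck_imp_continuous_on[OF test_functionD(1)[OF assms]] test_functionD(2)[OF assms]])
  show "g x = 0" if "x \<notin> closure {x. g x \<noteq> 0}" for x
    using that closure_subset[of "{x. g x \<noteq> 0}"] by blast
qed (rule that)

lemma L2_loc_times_test_function:
  fixes G :: "real^'n \<Rightarrow> 'a::euclidean_space" and f :: "real^'n \<Rightarrow> complex"
  assumes G: "L2_loc G" and f: "f \<in> borel_measurable lebesgue" and le: "\<And>x. norm (f x) \<le> C * norm (G x)"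
    and g: "test_function g"
  shows "integrable lebesgue (\<lambda>x. f x * g x)"
proof -
  let ?K = "closure {x. g x \<noteq> 0}"
  obtain B where B: "B \<ge> 0" "\<And>x. norm (g x) \<le> B" by (rule test_function_bounded[OF g]) (rule that)
  have "set_integrable lebesgue ?K f"
    by (rule L2_loc_dominates_integrable[OF G f le]) (use compact_imp_bounded[OF test_functionD(2)[OF g]] in auto)
  hence i: "integrable lebesgue (\<lambda>x. B * norm (indicator ?K x *\<^sub>R f x))"
    unfolding set_integrable_def by (intro integrable_mult_right integrable_norm)
  show ?thesis
  proof (rule Bochner_Integration.integrable_bound[OF i])
    show "(\<lambda>x. f x * g x) \<in> borel_measurable lebesgue"
      by (intro borel_measurable_times f measurable_lebesgueI Ck_imp_continuous_on[OF test_functionD(1)[OF g]])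
    show "AE x in lebesgue. norm (f x * g x) \<le> norm (B * norm (indicator ?K x *\<^sub>R f x))"
    proof (rule AE_I2)
      fix x
      show "norm (f x * g x) \<le> norm (B * norm (indicator ?K x *\<^sub>R f x))"
      proof (cases "x \<in> ?K")
        case True
        thus ?thesis using mult_right_mono[OF B(2)[of x] norm_ge_zero[of "f x"]] B(1)
          by (simp add: norm_mult mult.commute)
      next
        case False
        hence "g x = 0" using closure_subset[of "{x. g x \<noteq> 0}"] by blast
        thus ?thesis by simp
      qed
    qed
  qed
qed

lemma continuous_on_mult_supported:
  fixes f g :: "real^'n \<Rightarrow> complex"
  assumes "open U" "continuous_on U f" "continuous_on UNIV g" "closed K" "K \<subseteq> U" "\<And>x. x \<notin> K \<Longrightarrow> g x = 0"
  shows "continuous_on UNIV (\<lambda>x. f x * g x)"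
proof -
  have "continuous_on U (\<lambda>x. f x * g x)"
    by (intro continuous_on_mult assms(2) continuous_on_subset[OF assms(3)]) simp
  moreover have "continuous_on (- K) (\<lambda>x. f x * g x)"
  proof (rule continuous_on_eq[OF continuous_on_const])
    show "0 = f x * g x" if "x \<in> - K" for x using assms(6)[of x] that by simp
  qed
  ultimately have "continuous_on (U \<union> - K) (\<lambda>x. f x * g x)"
    using assms(1,4) by (intro continuous_on_open_Un) auto
  moreover have "U \<union> - K = UNIV" using assms(5) by blast
  ultimately show ?thesis by simp
qed

text \<open>The product of \<open>f\<close> and \<open>\<psi>\<close>, extended by zero, is a compactly supported \<open>C\<^sup>1\<close> function on the whole space.
  Hence, tested against functions supported where \<open>f\<close> is \<open>C\<^sup>1\<close>, the weak gradient of \<open>f\<close> acts like the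
  classical one.\<close>

lemma
  fixes f \<psi> :: "real^'n \<Rightarrow> complex"
  assumes U: "open U" and f: "C1_on U f" and \<psi>: "test_function \<psi>" and supp: "closure {x. \<psi> x \<noteq> 0} \<subseteq> U"
  shows C1_on_times_test_function_integrable:
      "integrable lborel (\<lambda>x. f x * \<psi> x)" "(\<lambda>x. f x * \<psi> x) \<in> borel_measurable borel"
    and C1_on_integration_by_parts:
      "(LINT x|lborel. f x * grad \<psi> x $ i) = - (LINT x|lborel. grad f x $ i * \<psi> x)"
      "integrable lborel (\<lambda>x. grad f x $ i * \<psi> x)"
proof -
  let ?K = "closure {x. \<psi> x \<noteq> 0}"
  let ?F = "\<lambda>x. f x * \<psi> x"
  have K: "compact ?K" by (rule test_functionD(2)[OF \<psi>])
  have z: "\<psi> x = 0" if "x \<notin> ?K" for x using that closure_subset[of "{x. \<psi> x \<noteq> 0}"] by blast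
  have zg: "grad \<psi> x $ i = 0" if "x \<notin> ?K" for x i using grad_eq_zero_outside_support[OF that] by simp
  have fd: "f differentiable (at x)" if "x \<in> U" for x using f that by (auto simp: C1_on_def)
  have \<psi>d: "\<psi> differentiable (at x)" for x using test_functionD(1)[OF \<psi>, of "Suc 0"] by simp
  have fc: "continuous_on U f" using fd by (intro differentiable_imp_continuous_on) (auto simp: differentiable_on_def differentiable_at_withinI)
  have gc: "continuous_on U (\<lambda>x. grad f x $ i)" for i using f by (auto simp: C1_on_def intro: continuous_intros)
  have c1: "continuous_on UNIV ?F"
    by (rule continuous_on_mult_supported[OF U fc Ck_imp_continuous_on[OF test_functionD(1)[OF \<psi>]] closed_closure supp z])
  have c2: "continuous_on UNIV (\<lambda>x. f x * grad \<psi> x $ i)" for i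
    by (rule continuous_on_mult_supported[OF U fc Ck_imp_continuous_on[OF test_functionD(1)[OF test_function_grad[OF \<psi>]]] closed_closure supp zg])
  have c3: "continuous_on UNIV (\<lambda>x. grad f x $ i * \<psi> x)" for i
    by (rule continuous_on_mult_supported[OF U gc Ck_imp_continuous_on[OF test_functionD(1)[OF \<psi>]] closed_closure supp z])
  show "integrable lborel ?F" by (rule integrable_lborel_continuous_compact_support[OF c1 K]) (drule z, simp)
  show "?F \<in> borel_measurable borel" by (rule borel_measurable_continuous_onI[OF c1])
  have i2: "integrable lborel (\<lambda>x. f x * grad \<psi> x $ i)"
    by (rule integrable_lborel_continuous_compact_support[OF c2 K]) (drule zg, erule ssubst, simp)
  show i3: "integrable lborel (\<lambda>x. grad f x $ i * \<psi> x)"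
    by (rule integrable_lborel_continuous_compact_support[OF c3 K]) (drule z, simp)
  have FK: "closure {x. ?F x \<noteq> 0} \<subseteq> ?K" by (rule closure_mono) auto
  have g: "grad ?F x $ i = f x * grad \<psi> x $ i + grad f x $ i * \<psi> x" for x i
  proof (cases "x \<in> U")
    case True
    thus ?thesis by (intro grad_mult fd \<psi>d)
  next
    case False
    hence x: "x \<notin> ?K" using supp by blast
    hence "x \<notin> closure {x. ?F x \<noteq> 0}" using FK by blast
    hence "grad ?F x = 0" by (rule grad_eq_zero_outside_support)
    hence "grad ?F x $ i = 0" by simp
    thus ?thesis using z[OF x] zg[OF x] by simp
  qed
  have d: "?F differentiable (at x)" for x
  proof (cases "x \<in> U")
    case True
    thus ?thesis by (intro differentiable_mult fd \<psi>d)
  next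
    case False
    hence x: "x \<in> - ?K" using supp by blast
    have "(?F has_derivative (\<lambda>h. 0)) (at x)"
    proof (rule has_derivative_transform_within_open[OF has_derivative_const _ x])
      show "0 = ?F y" if "y \<in> - ?K" for y using z[OF ComplD[OF that]] by simp
    qed (rule open_Compl[OF closed_closure])
    thus ?thesis unfolding differentiable_def by blast
  qed
  have "Ck 1 ?F" unfolding Ck_one_iff g by (intro conjI allI d continuous_on_add c2 c3)
  moreover have "compact (closure {x. ?F x \<noteq> 0})"
    using compact_Int_closed[OF K closed_closure[of "{x. ?F x \<noteq> 0}"]] FK by (simp add: inf.absorb2)
  ultimately have "(LINT x|lborel. grad ?F x $ i) = 0" by (rule integral_grad_eq_0)
  thus "(LINT x|lborel. f x * grad \<psi> x $ i) = - (LINT x|lborel. grad f x $ i * \<psi> x)"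
    unfolding g using i2 i3 by (simp add: eq_neg_iff_add_eq_0)
qed

lemma weak_gradient_props:
  assumes "H1_loc u"
  shows "L2_loc (weak_gradient u)" "is_weak_gradient u (weak_gradient u)"
  using someI_ex[of "\<lambda>G. L2_loc G \<and> is_weak_gradient u G"] assms
  unfolding H1_loc_def weak_gradient_def by blast+

lemma measurable_vec_nth_lebesgue:
  fixes G :: "real^'n \<Rightarrow> 'a::euclidean_space^'m"
  assumes "G \<in> borel_measurable lebesgue"
  shows "(\<lambda>x. G x $ i) \<in> borel_measurable lebesgue"
  by (rule measurable_compose[OF assms]) (intro borel_measurable_continuous_onI continuous_intros)

lemma matrix_vector_norm_bound:
  fixes A :: "complex^'n^'n"
  shows "norm ((A *v x) $ l) \<le> real CARD('n) * norm A * norm x"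
proof -
  have "norm ((A *v x) $ l) \<le> (\<Sum>j\<in>UNIV. norm (A $ l $ j * x $ j))"
    unfolding matrix_vector_mult_def by (simp add: norm_sum)
  also have "\<dots> \<le> (\<Sum>j\<in>(UNIV :: 'n set). norm A * norm x)"
    unfolding norm_mult
    by (intro sum_mono mult_mono) (auto intro: order_trans[OF Finite_Cartesian_Product.norm_nth_le] Finite_Cartesian_Product.norm_nth_le)
  finally show ?thesis by simp
qed

lemma bounded_matrix_field:
  fixes Q :: "'a \<Rightarrow> complex^'n^'n"
  assumes "bounded (range Q)"
  obtains C where "\<And>x v l. norm ((Q x *v v) $ l) \<le> C * norm v"
proof -
  obtain C where C: "\<And>x. norm (Q x) \<le> C" using assms by (auto simp: bounded_iff)
  have "norm ((Q x *v v) $ l) \<le> (real CARD('n) * C) * norm v" for x v l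
    using matrix_vector_norm_bound[of "Q x" v l]
      mult_right_mono[OF mult_left_mono[OF C[of x]], of "real CARD('n)" "norm v"]
    by (simp add: order_trans)
  thus ?thesis using that by blast
qed

lemma measurable_matrix_vector:
  fixes Q :: "real^'n \<Rightarrow> complex^'n^'n"
  assumes "Q \<in> borel_measurable lebesgue" "G \<in> borel_measurable lebesgue"
  shows "(\<lambda>x. (Q x *v G x) $ l) \<in> borel_measurable lebesgue"
proof -
  have "(\<lambda>x. \<Sum>j\<in>UNIV. Q x $ l $ j * G x $ j) \<in> borel_measurable lebesgue"
    by (intro borel_measurable_sum borel_measurable_times measurable_vec_nth_lebesgue assms)
  thus ?thesis by (simp add: matrix_vector_mult_def)
qed

context
  fixes k :: real and Q :: "real^'n \<Rightarrow> complex^'n^'n" and u W \<eta> :: "real^'n \<Rightarrow> complex"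
  assumes weak: "weak_Helmholtz_solution k Q u"
    and Q_meas: "Q \<in> borel_measurable lebesgue" and Q_bounded: "bounded (range Q)"
    and \<eta>: "test_function \<eta>" and W: "\<And>m. Ck m W"
    and laplacian_W: "\<And>x. (\<Sum>i\<in>UNIV. grad (\<lambda>x. grad W x $ i) x $ i) = - (of_real k)\<^sup>2 * W x"
begin

text \<open>The weak formulation is tested with \<open>\<eta> W\<close> and the definition of the weak gradient with \<open>\<eta> \<nabla>W\<close>.  As \<open>W\<close> solves
  the Helmholtz equation, the terms without derivatives of \<open>\<eta>\<close> cancel, except for the one that
  contains \<open>Q\<close>.\<close>

lemma weak_form_cutoff:
  "(\<Sum>i\<in>UNIV. (LINT x|lebesgue. weak_gradient u x $ i * (grad \<eta> x $ i * W x))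
       - (LINT x|lebesgue. u x * (grad \<eta> x $ i * grad W x $ i)))
   = - (LINT x|lebesgue. (Q x *v weak_gradient u x) \<odot> grad (\<lambda>x. \<eta> x * W x) x)"
proof -
  let ?G = "weak_gradient u"
  have H1: "H1_loc u" using weak by (simp add: weak_Helmholtz_solution_def)
  note G = weak_gradient_props[OF H1]
  have Gm: "?G \<in> borel_measurable lebesgue" using G(1) by (simp add: L2_loc_def)
  have u: "L2_loc u" using H1 by (simp add: H1_loc_def)
  have um: "u \<in> borel_measurable lebesgue" using u by (simp add: L2_loc_def)
  have intG: "integrable lebesgue (\<lambda>x. ?G x $ i * g x)" if "test_function g" for g i
    by (rule L2_loc_times_test_function[where C = 1, OF G(1) measurable_vec_nth_lebesgue[OF Gm] _ that])
       (simp add: Finite_Cartesian_Product.norm_nth_le)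
  have intu: "integrable lebesgue (\<lambda>x. u x * g x)" if "test_function g" for g
    by (rule L2_loc_times_test_function[where C = 1, OF u um _ that]) simp
  obtain C where C: "\<And>x l. norm ((Q x *v ?G x) $ l) \<le> C * norm (?G x)"
    by (rule bounded_matrix_field[OF Q_bounded]) (rule that)
  have intQ: "integrable lebesgue (\<lambda>x. (Q x *v ?G x) $ l * g x)" if "test_function g" for g l
    by (rule L2_loc_times_test_function[OF G(1) measurable_matrix_vector[OF Q_meas Gm] C that])
  have Wd: "W differentiable (at x)" for x using W[of "Suc 0"] by simp
  have W1: "Ck m (\<lambda>x. grad W x $ i)" for m i using W[of "Suc m"] by simp
  have W1d: "(\<lambda>x. grad W x $ i) differentiable (at x)" for x i using W1[of "Suc 0"] by simp
  have \<eta>d: "\<eta> differentiable (at x)" for x using test_functionD(1)[OF \<eta>, of "Suc 0"] by simp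
  have t: "test_function (\<lambda>x. \<eta> x * W x)" "test_function (\<lambda>x. \<eta> x * grad W x $ i)"
      "test_function (\<lambda>x. grad \<eta> x $ i * W x)" "test_function (\<lambda>x. grad \<eta> x $ i * grad W x $ i)"
      "test_function (\<lambda>x. \<eta> x * grad (\<lambda>x. grad W x $ i) x $ i)" for i
    using W1[of "Suc _"] by (auto intro!: test_function_mult \<eta> test_function_grad W W1)
  let ?\<phi> = "\<lambda>x. \<eta> x * W x"
  have g\<phi>: "grad ?\<phi> x $ i = \<eta> x * grad W x $ i + grad \<eta> x $ i * W x" for x i
    by (rule grad_mult[OF \<eta>d Wd])
  \<comment> \<open>The weak form reads \<open>\<Sum> (a + b) + q - k\<^sup>2 w = 0\<close>, the weak gradient gives \<open>a = - c - d\<close>, and the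
    Helmholtz equation for \<open>W\<close> gives \<open>\<Sum> d = - k\<^sup>2 w\<close>.\<close>
  let ?a = "\<lambda>i. LINT x|lebesgue. ?G x $ i * (\<eta> x * grad W x $ i)"
  let ?b = "\<lambda>i. LINT x|lebesgue. ?G x $ i * (grad \<eta> x $ i * W x)"
  let ?c = "\<lambda>i. LINT x|lebesgue. u x * (grad \<eta> x $ i * grad W x $ i)"
  let ?d = "\<lambda>i. LINT x|lebesgue. u x * (\<eta> x * grad (\<lambda>x. grad W x $ i) x $ i)"
  let ?q = "LINT x|lebesgue. (Q x *v ?G x) \<odot> grad ?\<phi> x"
  let ?w = "LINT x|lebesgue. u x * ?\<phi> x"
  have intQ\<phi>: "integrable lebesgue (\<lambda>x. (Q x *v ?G x) \<odot> grad ?\<phi> x)"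
    unfolding cdot_def by (intro Bochner_Integration.integrable_sum intQ test_function_grad t)
  have intG\<phi>: "integrable lebesgue (\<lambda>x. ?G x $ i * grad ?\<phi> x $ i)" for i
    by (intro intG test_function_grad t)
  have pointwise: "((mat 1 + Q x) *v ?G x) \<odot> grad ?\<phi> x - (of_real k)\<^sup>2 * u x * ?\<phi> x
     = (\<Sum>i\<in>UNIV. ?G x $ i * grad ?\<phi> x $ i) + (Q x *v ?G x) \<odot> grad ?\<phi> x - (of_real k)\<^sup>2 * (u x * ?\<phi> x)" for x
    by (simp add: matrix_vector_mult_add_rdistrib cdot_def distrib_right sum.distrib)
  have "0 = (LINT x|lebesgue. ((mat 1 + Q x) *v ?G x) \<odot> grad ?\<phi> x - (of_real k)\<^sup>2 * u x * ?\<phi> x)"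
    using weak t(1) unfolding weak_Helmholtz_solution_def by simp
  also have "\<dots> = (LINT x|lebesgue. (\<Sum>i\<in>UNIV. ?G x $ i * grad ?\<phi> x $ i) + (Q x *v ?G x) \<odot> grad ?\<phi> x - (of_real k)\<^sup>2 * (u x * ?\<phi> x))"
    by (rule Bochner_Integration.integral_cong[OF refl pointwise])
  also have "\<dots> = (LINT x|lebesgue. (\<Sum>i\<in>UNIV. ?G x $ i * grad ?\<phi> x $ i)) + ?q - (of_real k)\<^sup>2 * ?w"
    using intQ\<phi> intG\<phi> intu[OF t(1)]
    by (subst Bochner_Integration.integral_diff) (auto intro!: Bochner_Integration.integrable_add Bochner_Integration.integrable_sum)
  also have "(LINT x|lebesgue. (\<Sum>i\<in>UNIV. ?G x $ i * grad ?\<phi> x $ i)) = (\<Sum>i\<in>UNIV. (LINT x|lebesgue. ?G x $ i * grad ?\<phi> x $ i))"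
    using intG\<phi> by (intro Bochner_Integration.integral_sum)
  also have "\<dots> = (\<Sum>i\<in>UNIV. ?a i + ?b i)"
    unfolding g\<phi> distrib_left using intG[OF t(2)] intG[OF t(3)]
    by (intro sum.cong refl Bochner_Integration.integral_add)
  finally have e1: "(\<Sum>i\<in>UNIV. ?a i + ?b i) + ?q - (of_real k)\<^sup>2 * ?w = 0" by simp
  have e2: "?a i = - ?c i - ?d i" for i
  proof -
    have w: "(LINT x|lebesgue. u x * grad (\<lambda>x. \<eta> x * grad W x $ i) x $ i) = - ?a i"
      using G(2) t(2)[of i] unfolding is_weak_gradient_def by blast
    have "grad (\<lambda>x. \<eta> x * grad W x $ i) x $ i = \<eta> x * grad (\<lambda>x. grad W x $ i) x $ i + grad \<eta> x $ i * grad W x $ i" for x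
      by (rule grad_mult[OF \<eta>d W1d])
    hence "(LINT x|lebesgue. u x * grad (\<lambda>x. \<eta> x * grad W x $ i) x $ i) = ?d i + ?c i"
      using intu[OF t(4)] intu[OF t(5)] by (simp add: distrib_left)
    hence "- ?a i = ?d i + ?c i" unfolding w .
    hence "- (- ?a i) = - (?d i + ?c i)" by (rule arg_cong)
    thus ?thesis by simp
  qed
  have e3: "(\<Sum>i\<in>UNIV. ?d i) = - (of_real k)\<^sup>2 * ?w"
  proof -
    have "(\<Sum>i\<in>UNIV. ?d i) = (LINT x|lebesgue. (\<Sum>i\<in>UNIV. u x * (\<eta> x * grad (\<lambda>x. grad W x $ i) x $ i)))"
      using intu[OF t(5)] by (intro Bochner_Integration.integral_sum[symmetric])
    also have "\<dots> = (LINT x|lebesgue. - (of_real k)\<^sup>2 * (u x * ?\<phi> x))"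
      by (intro Bochner_Integration.integral_cong refl)
         (simp add: sum_distrib_left[symmetric] laplacian_W mult_ac)
    finally show ?thesis by simp
  qed
  have "(\<Sum>i\<in>UNIV. ?b i - ?c i) = (\<Sum>i\<in>UNIV. ?a i + ?b i) + (\<Sum>i\<in>UNIV. ?d i)"
    unfolding sum.distrib[symmetric] by (intro sum.cong refl) (simp add: e2)
  also have "\<dots> = - ?q" unfolding e3 using e1 by (simp add: algebra_simps)
  finally show ?thesis .
qed

end

text \<open>Green's second identity for two entire solutions of the Helmholtz equation: the field
  \<open>W \<nabla>p - p \<nabla>W\<close> is divergence free.\<close>

lemma incident_wave_flux_eq_0:
  fixes W \<eta> :: "real^'n \<Rightarrow> complex"
  assumes \<eta>: "test_function \<eta>" and W: "\<And>m. Ck m W" and \<theta>: "norm \<theta> = 1"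
    and laplacian_W: "\<And>x. (\<Sum>i\<in>UNIV. grad (\<lambda>x. grad W x $ i) x $ i) = - (of_real k)\<^sup>2 * W x"
  shows "(\<Sum>i\<in>UNIV. LINT x|lborel. grad \<eta> x $ i * (W x * grad (plane_wave k \<theta>) x $ i - plane_wave k \<theta> x * grad W x $ i)) = 0"
proof -
  let ?p = "plane_wave k \<theta>"
  let ?V = "\<lambda>i x. W x * grad ?p x $ i - ?p x * grad W x $ i"
  let ?V' = "\<lambda>i x. W x * grad (\<lambda>x. grad ?p x $ i) x $ i - ?p x * grad (\<lambda>x. grad W x $ i) x $ i"
  have p1: "Ck m (\<lambda>x. grad ?p x $ i)" for m i using Ck_plane_wave[of "Suc m" k \<theta>] by simp
  have W1: "Ck m (\<lambda>x. grad W x $ i)" for m i using W[of "Suc m"] by simp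
  have dd: "f differentiable (at x)" if "\<And>m. Ck m f" for f :: "real^'n \<Rightarrow> complex" and x
    using that[of "Suc 0"] by simp
  have V: "Ck m (?V i)" for m i by (intro Ck_diff Ck_mult W W1 p1 Ck_plane_wave)
  have p2: "Ck m (\<lambda>x. grad (\<lambda>x. grad ?p x $ i) x $ i)" and W2: "Ck m (\<lambda>x. grad (\<lambda>x. grad W x $ i) x $ i)" for m i
    using p1[of "Suc m"] W1[of "Suc m"] by simp_all
  have V': "Ck m (?V' i)" for m i by (intro Ck_diff Ck_mult W W2 p2 Ck_plane_wave)
  have gV: "grad (?V i) x $ i = ?V' i x" for i x
    by (subst grad_diff) (auto simp: grad_mult dd W W1 p1 Ck_plane_wave intro!: differentiable_mult)
  have lap: "(\<Sum>i\<in>UNIV. ?V' i x) = 0" for x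
  proof -
    have "(\<lambda>x. grad ?p x $ i) = (\<lambda>x. (\<i> * of_real k * of_real (\<theta> $ i)) * ?p x)" for i
      by (simp add: grad_plane_wave)
    hence "grad (\<lambda>x. grad ?p x $ i) x $ i = (\<i> * of_real k * of_real (\<theta> $ i)) * grad ?p x $ i" for i
      using grad_mult[where f = "\<lambda>_. \<i> * of_real k * of_real (\<theta> $ i)" and g = ?p and x = x and i = i,
          OF differentiable_const dd[OF Ck_plane_wave]]
      by (simp add: grad_component[OF has_derivative_const])
    hence "grad (\<lambda>x. grad ?p x $ i) x $ i = - (of_real k)\<^sup>2 * ?p x * of_real (\<theta> $ i * \<theta> $ i)" for i
      by (simp add: grad_plane_wave power2_eq_square mult_ac)
    hence "(\<Sum>i\<in>UNIV. grad (\<lambda>x. grad ?p x $ i) x $ i) = - (of_real k)\<^sup>2 * ?p x * of_real (\<Sum>i\<in>UNIV. \<theta> $ i * \<theta> $ i)"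
      by (simp add: sum_distrib_left)
    also have "(\<Sum>i\<in>UNIV. \<theta> $ i * \<theta> $ i) = 1" using \<theta> by (simp add: norm_eq_1 inner_vec_def)
    finally have "(\<Sum>i\<in>UNIV. grad (\<lambda>x. grad ?p x $ i) x $ i) = - (of_real k)\<^sup>2 * ?p x" by simp
    thus ?thesis by (simp add: sum_subtractf sum_distrib_left[symmetric] laplacian_W)
  qed
  have t: "test_function (\<lambda>x. \<eta> x * ?V i x)" "test_function (\<lambda>x. grad \<eta> x $ i * ?V i x)" "test_function (\<lambda>x. \<eta> x * ?V' i x)" for i
    by (intro test_function_mult \<eta> test_function_grad V V')+
  have "(LINT x|lborel. grad \<eta> x $ i * ?V i x) = - (LINT x|lborel. \<eta> x * ?V' i x)" for i
  proof -
    have "Ck 1 (\<lambda>x. \<eta> x * ?V i x)" by (rule test_functionD(1)[OF t(1)])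
    hence "0 = (LINT x|lborel. grad (\<lambda>x. \<eta> x * ?V i x) x $ i)"
      by (rule integral_grad_eq_0[OF _ test_functionD(2)[OF t(1)], symmetric])
    also have "\<dots> = (LINT x|lborel. \<eta> x * ?V' i x + grad \<eta> x $ i * ?V i x)"
      by (subst grad_mult[OF dd[OF test_functionD(1)[OF \<eta>]] dd[OF V]]) (simp only: gV)
    also have "\<dots> = (LINT x|lborel. \<eta> x * ?V' i x) + (LINT x|lborel. grad \<eta> x $ i * ?V i x)"
      by (intro Bochner_Integration.integral_add test_function_integrable t)
    finally show ?thesis by (simp add: eq_neg_iff_add_eq_0 add.commute)
  qed
  hence "(\<Sum>i\<in>UNIV. LINT x|lborel. grad \<eta> x $ i * ?V i x) = - (\<Sum>i\<in>UNIV. LINT x|lborel. \<eta> x * ?V' i x)"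
    by (simp add: sum_negf)
  also have "(\<Sum>i\<in>UNIV. LINT x|lborel. \<eta> x * ?V' i x) = (LINT x|lborel. (\<Sum>i\<in>UNIV. \<eta> x * ?V' i x))"
    by (intro Bochner_Integration.integral_sum[symmetric] test_function_integrable t)
  also have "\<dots> = 0" by (simp add: sum_distrib_left[symmetric] lap)
  finally show ?thesis by simp
qed

text \<open>Where \<open>\<nabla>\<eta>\<close> is supported, the total field is \<open>C\<^sup>1\<close>, so its weak gradient may be replaced by the classical
  one and split into a scattered and an incident part, of which the latter contributes nothing.  On the
  closure of \<open>D\<close>, where \<open>Q\<close> lives, \<open>\<eta> W\<close> coincides with \<open>W\<close>.\<close>

theorem scattered_field_flux:
  fixes us u W \<eta> :: "real^'n \<Rightarrow> complex"
  assumes weak: "weak_Helmholtz_solution k Q u"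
    and Q_meas: "Q \<in> borel_measurable lebesgue" and Q_bounded: "bounded (range Q)"
    and u: "\<And>x. u x = us x + plane_wave k \<theta> x" and us: "C1_on (- closure D) us" and \<theta>: "norm \<theta> = 1"
    and \<eta>: "test_function \<eta>" and V: "open V" "closure D \<subseteq> V" and \<eta>V: "\<And>x. x \<in> V \<Longrightarrow> \<eta> x = 1"
    and Q0: "\<And>x. x \<notin> closure D \<Longrightarrow> Q x = 0"
    and W: "\<And>m. Ck m W"
    and laplacian_W: "\<And>x. (\<Sum>i\<in>UNIV. grad (\<lambda>x. grad W x $ i) x $ i) = - (of_real k)\<^sup>2 * W x"
  shows "(\<Sum>i\<in>UNIV. LINT x|lborel. grad \<eta> x $ i * (W x * grad us x $ i - us x * grad W x $ i))
     = - (LINT x:closure D|lebesgue. grad W x \<odot> (Q x *v weak_gradient u x))"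
proof -
  let ?G = "weak_gradient u" and ?p = "plane_wave k \<theta>"
  have H1: "H1_loc u" using weak by (simp add: weak_Helmholtz_solution_def)
  note G = weak_gradient_props[OF H1]
  have W1: "Ck m (\<lambda>x. grad W x $ i)" for m i using W[of "Suc m"] by simp
  have Wd: "W differentiable (at x)" for x using W[of "Suc 0"] by simp
  have \<eta>d: "\<eta> differentiable (at x)" for x using test_functionD(1)[OF \<eta>, of "Suc 0"] by simp
  have gV: "grad \<eta> x $ i = 0" if "x \<in> V" for x i
  proof -
    have "(\<eta> has_derivative (\<lambda>h. 0)) (at x)"
    proof (rule has_derivative_transform_within_open[OF has_derivative_const V(1) that])
      show "1 = \<eta> y" if "y \<in> V" for y using \<eta>V[OF that] by simp
    qed
    thus ?thesis by (simp add: grad_component)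
  qed
  have supp: "closure {x. grad \<eta> x $ i * f x \<noteq> 0} \<subseteq> - closure D" for i and f :: "real^'n \<Rightarrow> complex"
  proof -
    have "{x. grad \<eta> x $ i * f x \<noteq> 0} \<subseteq> - V" using gV by auto
    hence "closure {x. grad \<eta> x $ i * f x \<noteq> 0} \<subseteq> - V" using V(1) by (intro closure_minimal) auto
    thus ?thesis using V(2) by blast
  qed
  have t: "test_function (\<lambda>x. grad \<eta> x $ i * W x)" "test_function (\<lambda>x. grad \<eta> x $ i * grad W x $ i)" for i
    by (intro test_function_mult test_function_grad \<eta> W W1)+
  have pC1: "C1_on (- closure D) ?p"
  proof -
    have d: "?p differentiable (at x)" for x using Ck_plane_wave[of "Suc 0" k \<theta>] by simp
    have "continuous_on UNIV (\<lambda>x. grad ?p x $ i)" for i using Ck_plane_wave[of "Suc 0" k \<theta>] by simp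
    hence "continuous_on UNIV (grad ?p)" using continuous_on_vec_lambda[of UNIV "\<lambda>i x. grad ?p x $ i"] by simp
    thus ?thesis unfolding C1_on_def using d continuous_on_subset by blast
  qed
  have op: "open (- closure D)" by (simp add: open_Compl)
  note ibp_us = C1_on_integration_by_parts[OF op us] C1_on_times_test_function_integrable[OF op us]
  note ibp_p = C1_on_integration_by_parts[OF op pC1] C1_on_times_test_function_integrable[OF op pC1]
  have split: "(LINT x|lebesgue. u x * g x) = (LINT x|lborel. us x * g x) + (LINT x|lborel. ?p x * g x)"
    if g: "test_function g" and s: "closure {x. g x \<noteq> 0} \<subseteq> - closure D" for g
  proof -
    have "(\<lambda>x. us x * g x + ?p x * g x) \<in> borel_measurable lborel"
      using ibp_us(4)[OF g s] ibp_p(4)[OF g s] by simp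
    hence "(LINT x|lebesgue. us x * g x + ?p x * g x) = (LINT x|lborel. us x * g x + ?p x * g x)"
      by (rule integral_completion)
    also have "\<dots> = (LINT x|lborel. us x * g x) + (LINT x|lborel. ?p x * g x)"
      by (rule Bochner_Integration.integral_add[OF ibp_us(3)[OF g s] ibp_p(3)[OF g s]])
    finally show ?thesis by (simp add: u distrib_right)
  qed
  have flux: "(LINT x|lebesgue. ?G x $ i * (grad \<eta> x $ i * W x)) - (LINT x|lebesgue. u x * (grad \<eta> x $ i * grad W x $ i))
     = (LINT x|lborel. grad \<eta> x $ i * (W x * grad us x $ i - us x * grad W x $ i))
     + (LINT x|lborel. grad \<eta> x $ i * (W x * grad ?p x $ i - ?p x * grad W x $ i))" for i
  proof -
    let ?\<psi> = "\<lambda>x. grad \<eta> x $ i * W x" and ?\<psi>' = "\<lambda>x. grad \<eta> x $ i * grad W x $ i"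
    note s = supp[of i W] and s' = supp[of i "\<lambda>x. grad W x $ i"]
    have sg: "closure {x. grad ?\<psi> x $ i \<noteq> 0} \<subseteq> - closure D"
    proof -
      have "{x. grad ?\<psi> x $ i \<noteq> 0} \<subseteq> closure {x. ?\<psi> x \<noteq> 0}"
      proof
        fix x assume "x \<in> {x. grad ?\<psi> x $ i \<noteq> 0}"
        thus "x \<in> closure {x. ?\<psi> x \<noteq> 0}" using grad_eq_zero_outside_support[of x ?\<psi>] by force
      qed
      hence "closure {x. grad ?\<psi> x $ i \<noteq> 0} \<subseteq> closure {x. ?\<psi> x \<noteq> 0}" by (intro closure_minimal) auto
      thus ?thesis using s by blast
    qed
    have "(LINT x|lebesgue. ?G x $ i * ?\<psi> x) = - (LINT x|lebesgue. u x * grad ?\<psi> x $ i)"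
      using G(2) t(1)[of i] unfolding is_weak_gradient_def by simp
    also have "\<dots> = - (LINT x|lborel. us x * grad ?\<psi> x $ i) - (LINT x|lborel. ?p x * grad ?\<psi> x $ i)"
      unfolding split[OF test_function_grad[OF t(1)] sg] by simp
    also have "\<dots> = (LINT x|lborel. grad us x $ i * ?\<psi> x) + (LINT x|lborel. grad ?p x $ i * ?\<psi> x)"
      unfolding ibp_us(1)[OF t(1) s] ibp_p(1)[OF t(1) s] by simp
    finally have "(LINT x|lebesgue. ?G x $ i * ?\<psi> x) - (LINT x|lebesgue. u x * ?\<psi>' x)
       = ((LINT x|lborel. grad us x $ i * ?\<psi> x) - (LINT x|lborel. us x * ?\<psi>' x))
       + ((LINT x|lborel. grad ?p x $ i * ?\<psi> x) - (LINT x|lborel. ?p x * ?\<psi>' x))"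
      unfolding split[OF t(2) s'] by simp
    also have "(LINT x|lborel. grad us x $ i * ?\<psi> x) - (LINT x|lborel. us x * ?\<psi>' x)
       = (LINT x|lborel. grad us x $ i * ?\<psi> x - us x * ?\<psi>' x)"
      by (rule Bochner_Integration.integral_diff[OF ibp_us(2)[OF t(1) s] ibp_us(3)[OF t(2) s'], symmetric])
    also have "\<dots> = (LINT x|lborel. grad \<eta> x $ i * (W x * grad us x $ i - us x * grad W x $ i))"
      by (intro Bochner_Integration.integral_cong refl) (simp add: algebra_simps)
    also have "(LINT x|lborel. grad ?p x $ i * ?\<psi> x) - (LINT x|lborel. ?p x * ?\<psi>' x)
       = (LINT x|lborel. grad ?p x $ i * ?\<psi> x - ?p x * ?\<psi>' x)"
      by (rule Bochner_Integration.integral_diff[OF ibp_p(2)[OF t(1) s] ibp_p(3)[OF t(2) s'], symmetric])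
    also have "\<dots> = (LINT x|lborel. grad \<eta> x $ i * (W x * grad ?p x $ i - ?p x * grad W x $ i))"
      by (intro Bochner_Integration.integral_cong refl) (simp add: algebra_simps)
    finally show ?thesis .
  qed
  have "(\<Sum>i\<in>UNIV. LINT x|lborel. grad \<eta> x $ i * (W x * grad us x $ i - us x * grad W x $ i))
      = - (LINT x|lebesgue. (Q x *v ?G x) \<odot> grad (\<lambda>x. \<eta> x * W x) x)"
    using weak_form_cutoff[OF weak Q_meas Q_bounded \<eta> W laplacian_W]
      incident_wave_flux_eq_0[OF \<eta> W \<theta> laplacian_W]
    unfolding flux sum.distrib by simp
  also have "(LINT x|lebesgue. (Q x *v ?G x) \<odot> grad (\<lambda>x. \<eta> x * W x) x) = (LINT x:closure D|lebesgue. grad W x \<odot> (Q x *v ?G x))"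
    unfolding set_lebesgue_integral_def
  proof (intro Bochner_Integration.integral_cong refl)
    fix x
    show "(Q x *v ?G x) \<odot> grad (\<lambda>x. \<eta> x * W x) x = indicator (closure D) x *\<^sub>R (grad W x \<odot> (Q x *v ?G x))"
    proof (cases "x \<in> closure D")
      case True
      hence "x \<in> V" using V(2) by blast
      hence "grad (\<lambda>x. \<eta> x * W x) x $ i = grad W x $ i" for i
        using grad_mult[OF \<eta>d Wd, of x i] gV \<eta>V by simp
      thus ?thesis using True by (simp add: cdot_def mult.commute)
    next
      case False
      hence "Q x *v ?G x = 0" by (simp add: Q0)
      thus ?thesis using False by (simp add: cdot_def)
    qed
  qed
  finally show ?thesis .
qed

section \<open>The boundary of a Lipschitz domain is a null set\<close>

text \<open>A line in direction \<open>e\<close> meets the graph in one point.\<close>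

lemma negligible_graph:
  fixes \<gamma> :: "real^'n \<Rightarrow> real"
  assumes e: "norm e = 1" and inv: "\<And>x t. \<gamma> (x + t *\<^sub>R e) = \<gamma> x" and cont: "continuous_on UNIV \<gamma>"
  shows "negligible ({x. \<gamma> x = x \<bullet> e} \<inter> cball 0 R)" (is "negligible ?A")
proof -
  have ee: "e \<bullet> e = 1" using e by (simp add: norm_eq_1)
  have "closed {x. \<gamma> x = x \<bullet> e}" by (intro closed_Collect_eq cont continuous_intros)
  hence A: "?A \<in> sets lborel" by (simp add: closed_Int)
  have fin: "emeasure lborel ?A < \<infinity>" by (intro emeasure_bounded_finite) (simp add: bounded_Int)
  have int: "integrable lborel (indicator ?A :: _ \<Rightarrow> real)" by (rule integrable_real_indicator[OF A fin])
  have "(LINT t|lborel. indicator ?A (x + t *\<^sub>R e)) = (0::real)" for x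
  proof (rule integral_eq_zero_AE)
    have "AE t in lborel. t \<noteq> \<gamma> x - x \<bullet> e" by (rule AE_lborel_singleton)
    thus "AE t in lborel. indicator ?A (x + t *\<^sub>R e) = (0::real)"
      by eventually_elim (auto simp: indicator_def inv inner_add_left ee)
  qed
  hence "(LINT x|lborel. indicator ?A x) = (0::real)"
    unfolding integral_slab_times_line[OF e int] by simp
  hence "measure lborel ?A = 0" using A by simp
  hence "emeasure lborel ?A = 0" using fin by (simp add: emeasure_eq_ennreal_measure less_top)
  hence "?A \<in> null_sets lborel" using A by (simp add: null_sets_def)
  thus ?thesis by (simp add: negligible_iff_null_sets null_sets_completionI)
qed

lemma negligible_frontier_Lipschitz_domain:
  assumes D: "bounded_Lipschitz_domain (D :: (real^'n) set)"
  shows "negligible (frontier D)"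
proof (rule locally_negligible_alt[THEN iffD2], rule ballI)
  fix x0 assume x0: "x0 \<in> frontier D"
  obtain r e \<gamma> L where \<gamma>: "L-lipschitz_on UNIV \<gamma>" and chart: "local_graph D x0 r e \<gamma>"
    using D x0 unfolding bounded_Lipschitz_domain_def by blast
  have D': "open D" using D by (simp add: bounded_Lipschitz_domain_def)
  have cont: "continuous_on UNIV \<gamma>" by (rule lipschitz_on_continuous_on[OF \<gamma>])
  have r: "r > 0" and e: "norm e = 1" and inv: "\<And>x t. \<gamma> (x + t *\<^sub>R e) = \<gamma> x"
    using chart by (auto simp: local_graph_def)
  have "x \<in> {x. \<gamma> x = x \<bullet> e} \<inter> cball 0 (norm x0 + r)" if x: "x \<in> frontier D \<inter> ball x0 r" for x
  proof -
    have "norm x \<le> norm x0 + norm (x - x0)" using norm_triangle_ineq[of x0 "x - x0"] by simp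
    hence "norm x \<le> norm x0 + r" using x by (simp add: dist_norm norm_minus_commute)
    thus ?thesis using local_graph_frontier[OF chart D' cont, of x] x by simp
  qed
  hence "negligible (frontier D \<inter> ball x0 r)"
    by (intro negligible_subset[OF negligible_graph[OF e inv cont, of "norm x0 + r"]] subsetI)
  moreover have "openin (top_of_set (frontier D)) (frontier D \<inter> ball x0 r)" by (simp add: openin_open_Int)
  ultimately show "\<exists>U. openin (top_of_set (frontier D)) U \<and> x0 \<in> U \<and> negligible U"
    using x0 r by (intro exI[of _ "frontier D \<inter> ball x0 r"]) simp
qed

section \<open>The imaging functional\<close>

lemma normal_deriv_eq_sum:
  assumes "f differentiable (at x)"
  shows "normal_deriv S f x = (\<Sum>i\<in>UNIV. outward_normal S x $ i *\<^sub>R grad f x $ i)"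
  unfolding normal_deriv_def by (rule frechet_derivative_eq_grad[OF assms])

text \<open>The real part recovers the real function, so differentiability passes down from its complex version.\<close>

lemma of_real_normal_deriv:
  fixes f :: "real^'n \<Rightarrow> real"
  assumes d: "(\<lambda>y. complex_of_real (f y)) differentiable (at x)"
  shows "complex_of_real (normal_deriv S f x) = normal_deriv S (\<lambda>y. complex_of_real (f y)) x"
proof -
  let ?F = "frechet_derivative (\<lambda>y. complex_of_real (f y)) (at x)"
  have F: "((\<lambda>y. complex_of_real (f y)) has_derivative ?F) (at x)"
    using d by (simp add: frechet_derivative_works)
  have "((\<lambda>y. Re (complex_of_real (f y))) has_derivative (\<lambda>h. Re (?F h))) (at x)"
    by (rule bounded_linear.has_derivative[OF bounded_linear_Re F])
  hence f: "(f has_derivative (\<lambda>h. Re (?F h))) (at x)" by simp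
  hence "((\<lambda>y. complex_of_real (f y)) has_derivative (\<lambda>h. complex_of_real (Re (?F h)))) (at x)"
    by (rule has_derivative_of_real)
  hence "?F = (\<lambda>h. complex_of_real (Re (?F h)))" by (rule has_derivative_unique[OF F])
  moreover have "frechet_derivative f (at x) = (\<lambda>h. Re (?F h))"
    by (rule frechet_derivative_at[OF f, symmetric])
  ultimately show ?thesis unfolding normal_deriv_def by metis
qed

text \<open>For every width of the mollifier below the distance from \<open>D\<close> to the boundary of \<open>\<Omega>\<close>, the smoothed
  indicator of \<open>\<Omega>\<close> is an admissible cut-off, and the volume integral does not depend on it.  Letting the
  width tend to zero turns the flux through the cut-off layer into the boundary integral.\<close>

lemma imaging_integral_eq:
  fixes Q :: "real^'n \<Rightarrow> complex^'n^'n" and u us :: "real^'n \<Rightarrow> complex"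
  assumes dim: "CARD('n) = 2 \<or> CARD('n) = 3" and k: "k > 0"
    and D: "bounded_Lipschitz_domain D"
    and Q_meas: "Q \<in> borel_measurable lebesgue" and Q_bounded: "bounded (range Q)"
    and Q_supp: "\<forall>x. x \<notin> closure D \<longrightarrow> Q x = 0"
    and sol: "scattering_solution k D Q \<theta> u us" and \<theta>: "norm \<theta> = 1"
    and \<Omega>: "bounded_C1_domain \<Omega>" "closure D \<subseteq> \<Omega>" and \<sigma>: "is_surface_measure \<Omega> \<sigma>"
  shows "(LINT x:frontier \<Omega>|\<sigma>. us x * of_real (normal_deriv \<Omega> (\<lambda>y. Im_Phi k y z) x)
            - normal_deriv \<Omega> us x * of_real (Im_Phi k x z))
     = - (LINT y:D|lebesgue. kernel_K k y z \<odot> (Q y *v weak_gradient u y))"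
proof -
  interpret C1_boundary \<Omega> \<sigma> using \<Omega>(1) \<sigma> by unfold_locales
  let ?W = "standing_wave k z" and ?G = "weak_gradient u"
  define V where "V i x = ?W x * grad us x $ i - us x * grad ?W x $ i" for i x
  have weak: "weak_Helmholtz_solution k Q u" and u: "\<And>x. u x = us x + plane_wave k \<theta> x"
    and us: "C1_on (- closure D) us" using sol by (auto simp: scattering_solution_def)
  have W: "Ck m ?W" for m by (rule Ck_standing_wave[OF dim k])
  have Wd: "?W differentiable (at x)" for x using W[of "Suc 0"] by simp
  have W1: "continuous_on A (\<lambda>x. grad ?W x $ i)" for A i
    using W[of "Suc 0"] continuous_on_subset by (metis Ck.simps(1) Ck.simps(2) top_greatest)
  have usd: "us differentiable (at x)" if "x \<in> - closure D" for x using us that by (auto simp: C1_on_def)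
  have usc: "continuous_on (- closure D) us"
    using usd by (intro differentiable_imp_continuous_on) (auto simp: differentiable_on_def differentiable_at_withinI)
  have Vc: "continuous_on (- closure D) (V i)" for i
    unfolding V_def[abs_def] using us
    by (intro continuous_intros usc W1 Ck_imp_continuous_on[OF W]) (auto simp: C1_on_def)
  have fr: "frontier \<Omega> \<subseteq> - closure D" using \<Omega>(2) open_S by (auto simp: frontier_def interior_open)
  have bD: "bounded D" using D by (simp add: bounded_Lipschitz_domain_def)
  hence "compact (closure D)" by simp
  then obtain d where d: "d > 0" "(\<Union>x\<in>closure D. cball x d) \<subseteq> \<Omega>"
    using compact_subset_open_imp_cball_epsilon_subset[OF _ open_S \<Omega>(2)] by metis
  define \<epsilon> where "\<epsilon> m = d / 2 * inverse (real (Suc m))" for m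
  have \<epsilon>: "\<epsilon> m > 0" "\<epsilon> m \<le> d / 2" for m using d(1) by (auto simp: \<epsilon>_def field_simps)
  have "\<epsilon> \<longlonglongrightarrow> d / 2 * 0" unfolding \<epsilon>_def[abs_def] by (intro tendsto_intros LIMSEQ_inverse_real_of_nat)
  hence \<epsilon>0: "\<epsilon> \<longlonglongrightarrow> 0" by simp
  define c where "c = (LINT x:closure D|lebesgue. grad ?W x \<odot> (Q x *v ?G x))"
  have flux: "(\<Sum>i\<in>UNIV. LINT x|lborel. grad (smoothed_indicator (\<epsilon> m) \<Omega>) x $ i * V i x) = - c" for m
    unfolding V_def c_def
  proof (rule scattered_field_flux[OF weak Q_meas Q_bounded u us \<theta> _ _ _ _ _ W laplacian_standing_wave[OF dim k]])
    show "test_function (smoothed_indicator (\<epsilon> m) \<Omega>)"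
      using open_S by (intro test_function_smoothed_indicator \<epsilon> bounded_S) simp
    show "open (\<Union>x\<in>closure D. ball x (d / 2))" by auto
    show "closure D \<subseteq> (\<Union>x\<in>closure D. ball x (d / 2))" using d(1) by auto
    show "Q x = 0" if "x \<notin> closure D" for x using Q_supp that by blast
    show "smoothed_indicator (\<epsilon> m) \<Omega> x = 1" if x: "x \<in> (\<Union>x\<in>closure D. ball x (d / 2))" for x
    proof (rule smoothed_indicator_eq_1[OF \<epsilon>(1)])
      obtain y where y: "y \<in> closure D" "dist y x < d / 2" using x by auto
      have "ball x (\<epsilon> m) \<subseteq> cball y d"
      proof
        fix w assume "w \<in> ball x (\<epsilon> m)"
        thus "w \<in> cball y d" using y(2) \<epsilon>(2)[of m] dist_triangle[of y w x] by simp
      qed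
      thus "ball x (\<epsilon> m) \<subseteq> \<Omega>" using d(2) y(1) by blast
    qed
  qed
  have "(\<lambda>m. \<Sum>i\<in>UNIV. LINT x|lborel. grad (smoothed_indicator (\<epsilon> m) \<Omega>) x $ i * V i x)
     \<longlonglongrightarrow> (\<Sum>i\<in>UNIV. - (LINT x:frontier \<Omega>|\<sigma>. of_real (outward_normal \<Omega> x $ i) * V i x))"
    by (intro tendsto_sum smoothed_indicator_flux[OF _ fr Vc \<epsilon>(1) \<epsilon>0]) (simp add: open_Compl)
  hence "(\<lambda>m. - c) \<longlonglongrightarrow> (\<Sum>i\<in>UNIV. - (LINT x:frontier \<Omega>|\<sigma>. of_real (outward_normal \<Omega> x $ i) * V i x))"
    unfolding flux .
  hence c_eq: "- c = (\<Sum>i\<in>UNIV. - (LINT x:frontier \<Omega>|\<sigma>. of_real (outward_normal \<Omega> x $ i) * V i x))"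
    by (simp only: LIMSEQ_const_iff)
  have intV: "set_integrable \<sigma> (frontier \<Omega>) (\<lambda>x. of_real (outward_normal \<Omega> x $ i) * V i x)" for i
    by (intro set_integrable_surface continuous_intros continuous_on_outward_normal continuous_on_subset[OF Vc fr])
  have "(LINT x:frontier \<Omega>|\<sigma>. us x * of_real (normal_deriv \<Omega> (\<lambda>y. Im_Phi k y z) x) - normal_deriv \<Omega> us x * of_real (Im_Phi k x z))
      = (LINT x:frontier \<Omega>|\<sigma>. - (\<Sum>i\<in>UNIV. of_real (outward_normal \<Omega> x $ i) * V i x))"
  proof (rule set_lebesgue_integral_cong)
    show "frontier \<Omega> \<in> sets \<sigma>" by (simp add: sets_\<sigma>)
    show "\<forall>x. x \<in> frontier \<Omega> \<longrightarrow> us x * of_real (normal_deriv \<Omega> (\<lambda>y. Im_Phi k y z) x) - normal_deriv \<Omega> us x * of_real (Im_Phi k x z)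
       = - (\<Sum>i\<in>UNIV. of_real (outward_normal \<Omega> x $ i) * V i x)"
    proof (intro allI impI)
      fix x assume "x \<in> frontier \<Omega>"
      hence x: "x \<in> - closure D" using fr by blast
      have sw: "(\<lambda>y. complex_of_real (Im_Phi k y z)) = ?W" by (simp add: standing_wave_def fun_eq_iff)
      have "of_real (normal_deriv \<Omega> (\<lambda>y. Im_Phi k y z) x) = normal_deriv \<Omega> ?W x"
        using of_real_normal_deriv[of "\<lambda>y. Im_Phi k y z" x \<Omega>] Wd unfolding sw by simp
      hence "us x * of_real (normal_deriv \<Omega> (\<lambda>y. Im_Phi k y z) x) - normal_deriv \<Omega> us x * of_real (Im_Phi k x z)
         = us x * (\<Sum>i\<in>UNIV. outward_normal \<Omega> x $ i *\<^sub>R grad ?W x $ i) - (\<Sum>i\<in>UNIV. outward_normal \<Omega> x $ i *\<^sub>R grad us x $ i) * ?W x"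
        by (simp add: normal_deriv_eq_sum[OF Wd] normal_deriv_eq_sum[OF usd[OF x]] standing_wave_def)
      also have "\<dots> = - (\<Sum>i\<in>UNIV. of_real (outward_normal \<Omega> x $ i) * V i x)"
        by (simp add: V_def sum_distrib_left sum_distrib_right sum_subtractf[symmetric] sum_negf[symmetric] scaleR_conv_of_real algebra_simps)
      finally show "us x * of_real (normal_deriv \<Omega> (\<lambda>y. Im_Phi k y z) x) - normal_deriv \<Omega> us x * of_real (Im_Phi k x z)
         = - (\<Sum>i\<in>UNIV. of_real (outward_normal \<Omega> x $ i) * V i x)" .
    qed
  qed
  also have "\<dots> = (\<Sum>i\<in>UNIV. - (LINT x:frontier \<Omega>|\<sigma>. of_real (outward_normal \<Omega> x $ i) * V i x))"
    using intV unfolding set_integrable_def set_lebesgue_integral_def scaleR_minus_right scaleR_sum_right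
    by (simp only: sum_negf integral_minus Bochner_Integration.integral_sum)
  also have "\<dots> = - c" by (rule c_eq[symmetric])
  also have "c = (LINT y:D|lebesgue. kernel_K k y z \<odot> (Q y *v ?G y))"
    unfolding c_def kernel_K_eq_grad[OF dim k] set_lebesgue_integral_def
  proof (rule integral_cong_AE)
    have H1: "H1_loc u" using weak by (simp add: weak_Helmholtz_solution_def)
    have Gm: "?G \<in> borel_measurable lebesgue" using weak_gradient_props(1)[OF H1] by (simp add: L2_loc_def)
    have m: "(\<lambda>x. grad ?W x \<odot> (Q x *v ?G x)) \<in> borel_measurable lebesgue"
      unfolding cdot_def
      by (intro borel_measurable_sum borel_measurable_times measurable_lebesgueI[OF W1] measurable_matrix_vector Q_meas Gm)
    have Dm: "D \<in> sets lebesgue" using D by (simp add: bounded_Lipschitz_domain_def)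
    show "(\<lambda>x. indicator (closure D) x *\<^sub>R (grad ?W x \<odot> (Q x *v ?G x))) \<in> borel_measurable lebesgue"
      by (intro borel_measurable_scaleR borel_measurable_indicator m) simp
    show "(\<lambda>x. indicator D x *\<^sub>R (grad ?W x \<odot> (Q x *v ?G x))) \<in> borel_measurable lebesgue"
      by (intro borel_measurable_scaleR borel_measurable_indicator m Dm)
    have "AE x in lebesgue. x \<notin> frontier D"
      using negligible_frontier_Lipschitz_domain[OF D] by (intro AE_not_in) (simp add: negligible_iff_null_sets)
    thus "AE x in lebesgue. indicator (closure D) x *\<^sub>R (grad ?W x \<odot> (Q x *v ?G x)) = indicator D x *\<^sub>R (grad ?W x \<odot> (Q x *v ?G x))"
    proof eventually_elim
      case (elim x)
      have "x \<in> closure D \<longleftrightarrow> x \<in> D"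
        using elim closure_subset interior_subset by (auto simp: frontier_def)
      thus ?case by (simp add: indicator_def)
    qed
  qed
  finally show ?thesis .
qed

lemma norm_cdot_le: "norm (a \<odot> b) \<le> real CARD('n) * norm a * norm (b :: complex^'n)"
proof -
  have "norm (a \<odot> b) \<le> (\<Sum>l\<in>(UNIV :: 'n set). norm (a $ l * b $ l))" unfolding cdot_def by (rule norm_sum)
  also have "\<dots> \<le> (\<Sum>l\<in>(UNIV :: 'n set). norm a * norm b)"
    unfolding norm_mult by (intro sum_mono mult_mono) (auto simp: Finite_Cartesian_Product.norm_nth_le)
  finally show ?thesis by simp
qed

text \<open>The kernel is evaluated at distances of at least \<open>infdist z D\<close>, and \<open>F\<close> is integrable.\<close>

lemma volume_potential_decay:
  fixes F :: "real^'n \<Rightarrow> complex^'n"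
  assumes dim: "CARD('n) = 2 \<or> CARD('n) = 3" and k: "k > 0" and F: "set_integrable lebesgue D (\<lambda>y. norm (F y))"
  shows "\<exists>C\<ge>0. \<forall>z. infdist z D \<ge> 1 \<longrightarrow>
    cmod (LINT y:D|lebesgue. kernel_K k y z \<odot> F y) \<le> C * infdist z D powr (- ((real CARD('n) - 1) / 2))"
proof -
  define a where "a = (real CARD('n) - 1) / 2"
  have a: "a \<ge> 0" using dim by (auto simp: a_def)
  obtain C where C: "C \<ge> 0" "\<And>y z::real^'n. norm (y - z) \<ge> 1 \<Longrightarrow> norm (kernel_K k y z) \<le> C * norm (y - z) powr (- a)"
    using kernel_K_decay[OF dim k] unfolding a_def by blast
  let ?M = "LINT y:D|lebesgue. norm (F y)"
  have "cmod (LINT y:D|lebesgue. kernel_K k y z \<odot> F y) \<le> (real CARD('n) * C * ?M) * infdist z D powr (- a)"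
    if z: "infdist z D \<ge> 1" for z
  proof -
    let ?r = "infdist z D"
    have K: "norm (kernel_K k y z) \<le> C * ?r powr (- a)" if "y \<in> D" for y
    proof -
      have r: "?r \<le> norm (y - z)" using infdist_le[OF that, of z] by (simp add: dist_norm norm_minus_commute)
      have "norm (kernel_K k y z) \<le> C * norm (y - z) powr (- a)" using r z by (intro C(2)) simp
      also have "\<dots> \<le> C * ?r powr (- a)"
        using r z a C(1) by (intro mult_left_mono powr_mono2') auto
      finally show ?thesis .
    qed
    have "cmod (LINT y:D|lebesgue. kernel_K k y z \<odot> F y) \<le> (LINT y|lebesgue. norm (indicator D y *\<^sub>R (kernel_K k y z \<odot> F y)))"
      unfolding set_lebesgue_integral_def by (rule integral_norm_bound)
    also have "\<dots> \<le> (LINT y|lebesgue. (real CARD('n) * C * ?r powr (- a)) * (indicator D y *\<^sub>R norm (F y)))"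
    proof (rule integral_mono')
      show "integrable lebesgue (\<lambda>y. (real CARD('n) * C * ?r powr (- a)) * (indicator D y *\<^sub>R norm (F y)))"
        using F unfolding set_integrable_def by (rule integrable_mult_right)
      show "0 \<le> (real CARD('n) * C * ?r powr (- a)) * (indicator D y *\<^sub>R norm (F y))" for y using C(1) by simp
      show "norm (indicator D y *\<^sub>R (kernel_K k y z \<odot> F y)) \<le> (real CARD('n) * C * ?r powr (- a)) * (indicator D y *\<^sub>R norm (F y))" for y
      proof (cases "y \<in> D")
        case True
        have "norm (kernel_K k y z \<odot> F y) \<le> real CARD('n) * norm (kernel_K k y z) * norm (F y)" by (rule norm_cdot_le)
        also have "\<dots> \<le> real CARD('n) * (C * ?r powr (- a)) * norm (F y)"
          by (intro mult_right_mono mult_left_mono K[OF True]) auto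
        finally show ?thesis using True by (simp add: mult.assoc)
      qed simp
    qed
    also have "\<dots> = (real CARD('n) * C * ?M) * ?r powr (- a)"
      unfolding set_lebesgue_integral_def by (subst integral_mult_right_zero) (simp only: mult_ac)
    finally show ?thesis .
  qed
  moreover have "?M \<ge> 0" unfolding set_lebesgue_integral_def by (rule Bochner_Integration.integral_nonneg) simp
  ultimately show ?thesis unfolding a_def[symmetric]
    using C(1) by (intro exI[of _ "real CARD('n) * C * ?M"]) auto
qed

theorem theorem1:
  fixes k :: real and p N :: nat
    and D \<Omega> :: "(real^'n) set"
    and Q :: "real^'n \<Rightarrow> complex^'n^'n"
    and u u_sc :: "real^'n \<Rightarrow> real^'n \<Rightarrow> complex"
    and d :: "nat \<Rightarrow> real^'n"
    and \<sigma> :: "(real^'n) measure"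
  assumes dim: "CARD('n) = 2 \<or> CARD('n) = 3"
    and k: "k > 0"
    and p: "p \<ge> 1"
    and D: "bounded_Lipschitz_domain D"
    and Q_meas: "Q \<in> borel_measurable lebesgue"
    and Q_bounded: "bounded (range Q)"
    and Q_supp: "\<forall>x. x \<notin> closure D \<longrightarrow> Q x = 0"
    and well_posed: "direct_problem_well_posed k D Q"
    and fields: "\<forall>\<theta>\<in>sphere 0 1. scattering_solution k D Q \<theta> (\<lambda>x. u x \<theta>) (\<lambda>x. u_sc x \<theta>)"
    and \<Omega>: "bounded_C1_domain \<Omega>" "closure D \<subseteq> \<Omega>"
    and \<sigma>: "is_surface_measure \<Omega> \<sigma>"
    and directions: "\<forall>j\<in>{1..N}. d j \<in> sphere 0 1"
  shows "(\<forall>z. imaging_functional k \<Omega> \<sigma> u_sc N d p z =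
            (\<Sum>j=1..N. (cmod (LINT y:D|lebesgue.
               kernel_K k y z \<odot> (Q y *v weak_gradient (\<lambda>x. u x (d j)) y))) ^ p))
       \<and> imaging_functional k \<Omega> \<sigma> u_sc N d p
           \<in> O[filtercomap (\<lambda>z. infdist z D) at_top](\<lambda>z. 1 / infdist z D powr (real p * (real CARD('n) - 1) / 2))"
proof
  define P where "P j z = cmod (LINT y:D|lebesgue. kernel_K k y z \<odot> (Q y *v weak_gradient (\<lambda>x. u x (d j)) y))" for j z
  have sol: "scattering_solution k D Q (d j) (\<lambda>x. u x (d j)) (\<lambda>x. u_sc x (d j))" "norm (d j) = 1" if "j \<in> {1..N}" for j
    using fields directions that by auto
  have eq: "imaging_functional k \<Omega> \<sigma> u_sc N d p z = (\<Sum>j=1..N. P j z ^ p)" for z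
    unfolding imaging_functional_def P_def
  proof (intro sum.cong refl)
    fix j assume j: "j \<in> {1..N}"
    show "(cmod (LINT x:frontier \<Omega>|\<sigma>. u_sc x (d j) * of_real (normal_deriv \<Omega> (\<lambda>y. Im_Phi k y z) x)
        - normal_deriv \<Omega> (\<lambda>y. u_sc y (d j)) x * of_real (Im_Phi k x z))) ^ p
      = (cmod (LINT y:D|lebesgue. kernel_K k y z \<odot> (Q y *v weak_gradient (\<lambda>x. u x (d j)) y))) ^ p"
      unfolding imaging_integral_eq[OF dim k D Q_meas Q_bounded Q_supp sol[OF j] \<Omega> \<sigma>] by simp
  qed
  thus "\<forall>z. imaging_functional k \<Omega> \<sigma> u_sc N d p z =
            (\<Sum>j=1..N. (cmod (LINT y:D|lebesgue.
               kernel_K k y z \<odot> (Q y *v weak_gradient (\<lambda>x. u x (d j)) y))) ^ p)"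
    by (simp add: P_def)
  define a where "a = (real CARD('n) - 1) / 2"
  have "\<exists>C\<ge>0. \<forall>z. infdist z D \<ge> 1 \<longrightarrow> P j z \<le> C * infdist z D powr (- a)" if j: "j \<in> {1..N}" for j
    unfolding P_def a_def
  proof (rule volume_potential_decay[OF dim k])
    let ?u = "\<lambda>x. u x (d j)"
    have weak: "weak_Helmholtz_solution k Q ?u" using sol(1)[OF j] unfolding scattering_solution_def by blast
    hence H1: "H1_loc ?u" by (simp add: weak_Helmholtz_solution_def)
    have G: "L2_loc (weak_gradient ?u)" by (rule weak_gradient_props(1)[OF H1])
    have Gm: "weak_gradient ?u \<in> borel_measurable lebesgue" using G by (simp add: L2_loc_def)
    obtain C where C: "\<And>x l. norm ((Q x *v weak_gradient ?u x) $ l) \<le> C * norm (weak_gradient ?u x)"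
      by (rule bounded_matrix_field[OF Q_bounded]) (rule that)
    let ?F = "\<lambda>y. Q y *v weak_gradient ?u y"
    have n: "norm (?F y) = sqrt (\<Sum>l\<in>UNIV. (norm (?F y $ l))\<^sup>2)" for y
      unfolding norm_vec_def[of "?F y"] L2_set_def ..
    show "set_integrable lebesgue D (\<lambda>y. norm (?F y))"
    proof (rule L2_loc_dominates_integrable[OF G])
      show "(\<lambda>y. norm (?F y)) \<in> borel_measurable lebesgue"
        unfolding n
        by (intro borel_measurable_continuous_on[where f = sqrt] continuous_intros borel_measurable_sum borel_measurable_power
              measurable_compose[OF measurable_matrix_vector[OF Q_meas Gm] borel_measurable_norm])
      show "norm (norm (?F y)) \<le> (real CARD('n) * C) * norm (weak_gradient ?u y)" for y
      proof -
        have "norm (?F y) \<le> (\<Sum>l\<in>UNIV. norm (?F y $ l))"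
          unfolding norm_vec_def[of "?F y"] by (rule L2_set_le_sum) simp
        also have "\<dots> \<le> (\<Sum>l\<in>(UNIV :: 'n set). C * norm (weak_gradient ?u y))" by (intro sum_mono C)
        finally show ?thesis by simp
      qed
    qed (use D in \<open>auto simp: bounded_Lipschitz_domain_def\<close>)
  qed
  then obtain C where C: "\<And>j. j \<in> {1..N} \<Longrightarrow> C j \<ge> 0"
     "\<And>j z. j \<in> {1..N} \<Longrightarrow> infdist z D \<ge> 1 \<Longrightarrow> P j z \<le> C j * infdist z D powr (- a)" by metis
  show "imaging_functional k \<Omega> \<sigma> u_sc N d p
           \<in> O[filtercomap (\<lambda>z. infdist z D) at_top](\<lambda>z. 1 / infdist z D powr (real p * (real CARD('n) - 1) / 2))"
  proof (rule bigoI[where c = "\<Sum>j=1..N. C j ^ p"])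
    have "\<forall>\<^sub>F z in filtercomap (\<lambda>z. infdist z D) at_top. 1 \<le> infdist z D"
      using eventually_ge_at_top[of "1::real"] by (rule eventually_filtercomapI)
    thus "\<forall>\<^sub>F z in filtercomap (\<lambda>z. infdist z D) at_top. norm (imaging_functional k \<Omega> \<sigma> u_sc N d p z)
        \<le> (\<Sum>j=1..N. C j ^ p) * norm (1 / infdist z D powr (real p * (real CARD('n) - 1) / 2))"
    proof eventually_elim
      case (elim z)
      have nn: "P j z \<ge> 0" for j by (simp add: P_def)
      have "(infdist z D powr (- a)) ^ p = infdist z D powr (- (real p * (real CARD('n) - 1) / 2))"
        using elim by (simp add: powr_power a_def field_simps)
      hence pw: "(infdist z D powr (- a)) ^ p = 1 / infdist z D powr (real p * (real CARD('n) - 1) / 2)"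
        by (simp add: powr_minus_divide)
      have "(\<Sum>j=1..N. P j z ^ p) \<le> (\<Sum>j=1..N. (C j * infdist z D powr (- a)) ^ p)"
        by (intro sum_mono power_mono C(2) elim nn)
      also have "\<dots> = (\<Sum>j=1..N. C j ^ p) * (1 / infdist z D powr (real p * (real CARD('n) - 1) / 2))"
        by (simp add: power_mult_distrib pw sum_divide_distrib)
      finally show ?case unfolding eq using nn by (simp add: sum_nonneg)
    qed
  qed
qed

end
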